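(* Let $b\in\mathbb{R}$, let $w_b(t)=(1+\log_+(1/t))^b$ and let $\mathrm{w}_b$ be its regularisation. Then the potential-type space $J_{\mathrm{w}_b}(L^2(\mathbb{R}^n))$ coincides with the refined Sobolev space $H^\varphi(\mathbb{R}^n)$, with $\varphi(t):=w_b(1/t)$, with equivalent norms. More precisely, it holds that $$\|f\|_{J_{\mathrm{w}_b}(L^2(\mathbb{R}^n))}\approx\|f\|_{H^\varphi(\mathbb{R}^n)}$$ for all $f\in J_{\mathrm{w}_b}(L^2(\mathbb{R}^n))=H^\varphi(\mathbb{R}^n)$.
   Context: Regularisation. Let $\varphi_0$ be a nonnegative, radially monotonically decreasing Schwartz function on $\mathbb{R}^n$, supported in $\{|x|\le3/2\}$ and identically $1$ on $\{|x|\le1\}$; put $\varphi_1(x)=\varphi_0(x/2)-\varphi_0(x)$ and $\varphi_j(x)=\varphi_1(2^{-j+1}x)$ for $j\ge2$. Then $\mathrm{w}_b(\xi)=\sum_{j\ge0}w_b(2^{-j})\varphi_j(\xi)=\sum_{j\ge0}(1+j\log2)^b\varphi_j(\xi)$. Potential-type space. With $a(D)$ denoting the Fourier multiplier $\widehat{a(D)f}=a\widehat f$, $J_{\mathrm{w}_b}(L^2(\mathbb{R}^n))=\{f\in\mathcal{S}'(\mathbb{R}^n):(1/\mathrm{w}_b)(D)f\in L^2(\mathbb{R}^n)\}$ with norm $\|f\|_{J_{\mathrm{w}_b}(L^2(\mathbb{R}^n))}=\|(1/\mathrm{w}_b)(D)f\|_{L^2(\mathbb{R}^n)}$. Refined Sobolev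 space. Let $\varphi:[1,\infty)\to(0,\infty)$ be a Borel measurable function such that $\varphi$ and $1/\varphi$ are bounded on every interval $[1,c]$, $1<c<\infty$, and suppose there are $d\ge1$ and $\psi:[d,\infty)\to(0,\infty)$ such that $\psi$ is Borel measurable on $[d_0,\infty)$ for some $d_0\ge d$, $\lim_{t\to\infty}\psi(\lambda t)/\psi(t)=1$ for all $\lambda>0$, and $\varphi(t)\approx\psi(t)$ for all $t\ge d$. Then $H^\varphi(\mathbb{R}^n)$ is the set of tempered distributions $f$ whose Fourier transform $\widehat f$ is locally integrable and satisfies $\|f\|_{H^\varphi(\mathbb{R}^n)}:=\big(\int_{\mathbb{R}^n}|\varphi(\langle\xi\rangle)\widehat f(\xi)|^2\,d\xi\big)^{1/2}<\infty$, where $\langle\xi\rangle=(1+|\xi|^2)^{1/2}$. $A\approx B$ means that $A\le CB$ and $B\le CA$ for some constant $C>0$ (independent of $f$, respectively of $t$).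
   Formalization: The weight is corrected to φ(t):=1/w_b(1/t): with φ(t):=w_b(1/t) as printed and the norm ‖(1/w_b)(D)f‖, the two Fourier weights have opposite exponents and the claim fails for every b≠0 (at b=0 both formulas agree). *)

theory Defs
  imports "HOL-Analysis.Analysis"
begin

section \<open>Schwartz functions and tempered distributions on \<open>real ^ 'n\<close>\<close>

text \<open>Iterated partial derivatives; a multi-index is a list of coordinate directions.\<close>

primrec pderivs :: "'n::finite list \<Rightarrow> (real ^ 'n \<Rightarrow> complex) \<Rightarrow> real ^ 'n \<Rightarrow> complex" where
  "pderivs [] f = f"
| "pderivs (i # \<alpha>) f = (\<lambda>x. frechet_derivative (pderivs \<alpha> f) (at x) (axis i 1))"

text \<open>Total differentiability of all iterated partial derivatives is the same as \<open>C\<^sup>\<infinity>\<close>.\<close>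

definition schwartz_space :: "(real ^ 'n::finite \<Rightarrow> complex) set" where
  "schwartz_space = {g. \<forall>\<alpha>. (\<forall>x. pderivs \<alpha> g differentiable (at x)) \<and>
     (\<forall>k::nat. \<exists>C. \<forall>x. (1 + norm x) ^ k * norm (pderivs \<alpha> g x) \<le> C)}"

definition schwartz_seminorm :: "nat \<Rightarrow> (real ^ 'n::finite \<Rightarrow> complex) \<Rightarrow> real" where
  "schwartz_seminorm N g =
     (SUP (\<alpha>, x) \<in> {\<alpha>. length \<alpha> \<le> N} \<times> UNIV. (1 + norm x) ^ N * norm (pderivs \<alpha> g x))"

text \<open>
  A distribution is a functional on \<^term>\<open>schwartz_space\<close>, made extensional so that equality
  of HOL functions is equality of distributions. The last clause is continuity for the
  Frechet topology of the (increasing) family of seminorms above.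
\<close>

type_synonym 'n dist = "(real ^ 'n \<Rightarrow> complex) \<Rightarrow> complex"

definition tempered_distributions :: "'n::finite dist set" where
  "tempered_distributions = {T. T \<in> extensional schwartz_space \<and>
     (\<forall>g\<in>schwartz_space. \<forall>h\<in>schwartz_space. T (\<lambda>x. g x + h x) = T g + T h) \<and>
     (\<forall>c. \<forall>g\<in>schwartz_space. T (\<lambda>x. c * g x) = c * T g) \<and>
     (\<exists>N C. \<forall>g\<in>schwartz_space. norm (T g) \<le> C * schwartz_seminorm N g)}"


section \<open>Fourier transform and Fourier multipliers\<close>

definition fourier :: "(real ^ 'n::finite \<Rightarrow> complex) \<Rightarrow> real ^ 'n \<Rightarrow> complex" where
  "fourier g \<xi> = complex_of_real ((2 * pi) powr (- real CARD('n) / 2)) *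
     (LINT x|lborel. cis (- (x \<bullet> \<xi>)) * g x)"

definition dist_fourier :: "'n::finite dist \<Rightarrow> 'n dist" where
  "dist_fourier T = restrict (\<lambda>g. T (fourier g)) schwartz_space"

definition dist_mult :: "(real ^ 'n::finite \<Rightarrow> complex) \<Rightarrow> 'n dist \<Rightarrow> 'n dist" where
  "dist_mult a T = restrict (\<lambda>g. T (\<lambda>x. a x * g x)) schwartz_space"

text \<open>\<open>a(D) f\<close>, meaningful when \<open>a\<close> is a multiplier of the Schwartz space.\<close>

definition fourier_multiplier :: "(real ^ 'n::finite \<Rightarrow> complex) \<Rightarrow> 'n dist \<Rightarrow> 'n dist" where
  "fourier_multiplier a f =
     (THE u. u \<in> tempered_distributions \<and> dist_fourier u = dist_mult a (dist_fourier f))"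


section \<open>Distributions given by locally integrable functions\<close>

definition locally_integrable :: "(real ^ 'n::finite \<Rightarrow> complex) \<Rightarrow> bool" where
  "locally_integrable g \<longleftrightarrow> (\<forall>K. compact K \<longrightarrow> set_integrable lborel K g)"

text \<open>
  The distribution \<open>T\<close> is the function \<open>g\<close>. Only compactly supported test functions occur:
  against a general Schwartz function a locally integrable \<open>g\<close> need not be integrable.
\<close>

definition represents :: "(real ^ 'n::finite \<Rightarrow> complex) \<Rightarrow> 'n dist \<Rightarrow> bool" where
  "represents g T \<longleftrightarrow> locally_integrable g \<and>
     (\<forall>h\<in>schwartz_space. bounded {x. h x \<noteq> 0} \<longrightarrow> T h = (LINT x|lborel. g x * h x))"

text \<open>The representing function, which is unique up to null sets.\<close>

definition fun_of :: "'n::finite dist \<Rightarrow> real ^ 'n \<Rightarrow> complex" where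
  "fun_of T = (SOME g. represents g T)"

definition L2_space :: "'n::finite dist set" where
  "L2_space = {T \<in> tempered_distributions. (\<exists>g. represents g T) \<and>
     integrable lborel (\<lambda>x. (norm (fun_of T x))\<^sup>2)}"

definition L2_norm :: "'n::finite dist \<Rightarrow> real" where
  "L2_norm T = sqrt (LINT x|lborel. (norm (fun_of T x))\<^sup>2)"


section \<open>The weight \<open>w\<^sub>b\<close>, its regularisation and the potential-type space\<close>

definition log_plus :: "real \<Rightarrow> real" where
  "log_plus t = max 0 (ln t)"

definition w_log :: "real \<Rightarrow> real \<Rightarrow> real" where
  "w_log b t = (1 + log_plus (1 / t)) powr b"

lemma w_log_dyadic: "w_log b ((1/2) ^ j) = (1 + real j * ln 2) powr b"
  by (simp add: w_log_def log_plus_def power_one_over ln_realpow)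

text \<open>
  ``Radially decreasing'' is required along each ray only, which covers the functions that are
  moreover radially symmetric.
\<close>

definition dyadic_generator :: "(real ^ 'n::finite \<Rightarrow> real) \<Rightarrow> bool" where
  "dyadic_generator \<phi>\<^sub>0 \<longleftrightarrow>
     (\<lambda>x. complex_of_real (\<phi>\<^sub>0 x)) \<in> schwartz_space \<and>
     (\<forall>x. 0 \<le> \<phi>\<^sub>0 x) \<and>
     (\<forall>x r s. 0 \<le> r \<and> r \<le> s \<longrightarrow> \<phi>\<^sub>0 (s *\<^sub>R x) \<le> \<phi>\<^sub>0 (r *\<^sub>R x)) \<and>
     (\<forall>x. norm x > 3 / 2 \<longrightarrow> \<phi>\<^sub>0 x = 0) \<and>
     (\<forall>x. norm x \<le> 1 \<longrightarrow> \<phi>\<^sub>0 x = 1)"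

fun dyadic :: "(real ^ 'n::finite \<Rightarrow> real) \<Rightarrow> nat \<Rightarrow> real ^ 'n \<Rightarrow> real" where
  "dyadic \<phi>\<^sub>0 0 x = \<phi>\<^sub>0 x"
| "dyadic \<phi>\<^sub>0 (Suc 0) x = \<phi>\<^sub>0 ((1/2) *\<^sub>R x) - \<phi>\<^sub>0 x"
| "dyadic \<phi>\<^sub>0 (Suc (Suc j)) x = dyadic \<phi>\<^sub>0 (Suc 0) ((1/2) ^ Suc j *\<^sub>R x)"

definition regularisation ::
  "(real ^ 'n::finite \<Rightarrow> real) \<Rightarrow> (real \<Rightarrow> real) \<Rightarrow> real ^ 'n \<Rightarrow> real" where
  "regularisation \<phi>\<^sub>0 w \<xi> = (\<Sum>j. w ((1/2) ^ j) * dyadic \<phi>\<^sub>0 j \<xi>)"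

text \<open>
  The Fourier side carries the weight \<open>1 / W\<close>, not \<open>W\<close>. Since \<open>w\<^sub>b (1/t)\<close> is
  \<open>(1 + log\<^sub>+ t)\<^sup>b\<close>, the refined Sobolev weight that matches the regularisation of \<open>w\<^sub>b\<close> is
  \<open>1 / w\<^sub>b (1/t)\<close>.
\<close>

definition J_space :: "(real ^ 'n::finite \<Rightarrow> real) \<Rightarrow> 'n dist set" where
  "J_space W = {f \<in> tempered_distributions.
     fourier_multiplier (\<lambda>\<xi>. complex_of_real (1 / W \<xi>)) f \<in> L2_space}"

definition J_norm :: "(real ^ 'n::finite \<Rightarrow> real) \<Rightarrow> 'n dist \<Rightarrow> real" where
  "J_norm W f = L2_norm (fourier_multiplier (\<lambda>\<xi>. complex_of_real (1 / W \<xi>)) f)"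


section \<open>Refined Sobolev spaces\<close>

definition refined_weight :: "(real \<Rightarrow> real) \<Rightarrow> bool" where
  "refined_weight \<phi> \<longleftrightarrow>
     (\<forall>t\<ge>1. 0 < \<phi> t) \<and>
     \<phi> \<in> borel_measurable (restrict_space borel {1..}) \<and>
     (\<forall>c>1. bounded (\<phi> ` {1..c}) \<and> bounded ((\<lambda>t. 1 / \<phi> t) ` {1..c})) \<and>
     (\<exists>d\<ge>1. \<exists>\<psi>::real \<Rightarrow> real.
        (\<forall>t\<ge>d. 0 < \<psi> t) \<and>
        (\<exists>d\<^sub>0\<ge>d. \<psi> \<in> borel_measurable (restrict_space borel {d\<^sub>0..})) \<and>
        (\<forall>l>0. ((\<lambda>t. \<psi> (l * t) / \<psi> t) \<longlongrightarrow> 1) at_top) \<and>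
        (\<exists>C>0. \<forall>t\<ge>d. \<phi> t \<le> C * \<psi> t \<and> \<psi> t \<le> C * \<phi> t))"

definition jbracket :: "real ^ 'n::finite \<Rightarrow> real" where
  "jbracket \<xi> = sqrt (1 + (norm \<xi>)\<^sup>2)"

definition H_space :: "(real \<Rightarrow> real) \<Rightarrow> 'n::finite dist set" where
  "H_space \<phi> = {f \<in> tempered_distributions. (\<exists>g. represents g (dist_fourier f)) \<and>
     integrable lborel (\<lambda>\<xi>. (norm (\<phi> (jbracket \<xi>) * fun_of (dist_fourier f) \<xi>))\<^sup>2)}"

definition H_norm :: "(real \<Rightarrow> real) \<Rightarrow> 'n::finite dist \<Rightarrow> real" where
  "H_norm \<phi> f = sqrt (LINT \<xi>|lborel. (norm (\<phi> (jbracket \<xi>) * fun_of (dist_fourier f) \<xi>))\<^sup>2)"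

end

theory Submission
  imports Defs "HOL-Probability.Probability" "HOL-Real_Asymp.Real_Asymp"
begin

text \<open>
  On the Fourier side \<open>(1/w\<^sub>b)(D)f\<close> is multiplication by \<open>1/w\<^sub>b\<close>, and at most two dyadic
  pieces, with \<open>2\<^sup>j\<close> comparable to \<open>\<langle>\<xi>\<rangle>\<close>, are nonzero at a given \<open>\<xi>\<close>, so \<open>w\<^sub>b(\<xi>)\<close>
  lies within the factor \<open>3\<^bsup>|b|\<^esup>\<close> of \<open>(1 + log \<langle>\<xi>\<rangle>)\<^sup>b\<close>. The rest is Plancherel's theorem for
  tempered distributions: the identity on Schwartz functions, from Fourier inversion by Gaussian
  regularisation, makes an \<open>L\<^sup>2\<close> distribution composed with the Fourier transform a functional
  on the Schwartz space bounded in the \<open>L\<^sup>2\<close> norm, hence \<open>L\<^sup>2\<close> again by Riesz representation.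
  The multiplier is well defined since \<open>w\<^sub>b\<close> and \<open>1/w\<^sub>b\<close> are smooth with polynomially bounded
  derivatives, and since the Fourier transform is an isomorphism of the Schwartz space.
\<close>

subsection \<open>Iterated partial derivatives\<close>

text \<open>Two conventions shape the proof. \<open>represents\<close> tests a distribution only
  against compactly supported functions, whereas the Fourier transform does not preserve compact
  support; so a square integrable representative must first be shown to pair correctly with every
  Schwartz function, which is done by cutoffs. And \<open>fun_of\<close> is a Hilbert choice, so
  both norms refer to an unspecified representative; they can be computed only once representatives
  are known to agree almost everywhere. The bump functions for both purposes, cutoffs and
  mollifiers, are dilates of the dyadic generator itself. The Riesz argument yields a representative
  whose norm is at most that of the given one: with the Fourier transform it bounds the Sobolev
  norm, with the inverse transform the potential norm, and comparing the weights costs the same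
  factor each time. Its base 3 bounds the ratio, in either direction, of 1 + j log 2 to 1 + log of
  the bracket; allowing either sign of b gives the exponent |b|.\<close>

abbreviation (input) \<S> :: "(real ^ 'n::finite \<Rightarrow> complex) set" where
  "\<S> \<equiv> schwartz_space"

definition pd :: "'n::finite \<Rightarrow> (real ^ 'n \<Rightarrow> complex) \<Rightarrow> real ^ 'n \<Rightarrow> complex" where
  "pd i f = (\<lambda>x. frechet_derivative f (at x) (axis i 1))"

lemma pd_eqI: "(f has_derivative D) (at x) \<Longrightarrow> pd i f x = D (axis i 1)"
  unfolding pd_def by (metis frechet_derivative_at)

lemma pderivs_Cons_pd: "pderivs (i # \<alpha>) f = pd i (pderivs \<alpha> f)"
  by (simp add: pd_def)

text \<open>The order of the derivatives is kept throughout; reaching the innermost one is what lets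
  inductions from the right use rules for \<open>pd i f\<close>.\<close>

lemma pderivs_snoc: "pderivs (\<alpha> @ [i]) f = pderivs \<alpha> (pd i f)"
  by (induction \<alpha>) (simp_all add: pd_def)

declare pderivs.simps(2) [simp del]

lemma pd_cong_open:
  assumes "open U" "x \<in> U" "\<And>y. y \<in> U \<Longrightarrow> f y = g y"
  shows "pd i f x = pd i g x"
proof -
  have "(f has_derivative D) (at x) \<longleftrightarrow> (g has_derivative D) (at x)" for D
    using has_derivative_transform_within_open[of f D x UNIV U g]
      has_derivative_transform_within_open[of g D x UNIV U f] assms by auto
  then show ?thesis
    by (simp add: pd_def frechet_derivative_def)
qed

text \<open>Locality of derivatives: it replaces the dyadic series by a finite sum on a ball, and
  makes \<open>(1 - cutoff k x) * h x\<close> vanish to all orders inside the ball where the cutoff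
  is 1.\<close>

lemma pderivs_cong_open:
  assumes "open U" "x \<in> U" "\<And>y. y \<in> U \<Longrightarrow> f y = g y"
  shows "pderivs \<alpha> f x = pderivs \<alpha> g x"
  using assms(2)
proof (induction \<alpha> arbitrary: x)
  case Nil
  then show ?case by (simp add: assms)
next
  case (Cons i \<alpha>)
  then show ?case
    unfolding pderivs_Cons_pd by (intro pd_cong_open[OF assms(1)]) auto
qed

lemma differentiable_cong_open:
  assumes "open U" "x \<in> U" "\<And>y. y \<in> U \<Longrightarrow> f y = g y" "g differentiable (at x)"
  shows "f differentiable (at x)"
  using assms unfolding differentiable_def
  by (metis has_derivative_transform_within_open)

lemma pd_add: "f differentiable (at x) \<Longrightarrow> g differentiable (at x) \<Longrightarrow>
    pd i (\<lambda>x. f x + g x) x = pd i f x + pd i g x"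
  unfolding frechet_derivative_works
  by (subst pd_eqI[OF has_derivative_add]) (auto simp: pd_def)

lemma pd_mult: "f differentiable (at x) \<Longrightarrow> g differentiable (at x) \<Longrightarrow>
    pd i (\<lambda>x. f x * g x) x = pd i f x * g x + f x * pd i g x"
  unfolding frechet_derivative_works
  by (subst pd_eqI[OF has_derivative_mult]) (auto simp: pd_def)

lemma pd_const: "pd i (\<lambda>x. c) = (\<lambda>x. 0)"
  by (simp add: pd_def)

text \<open>The recursion peels off the innermost derivative, so that product and quotient rules can be
  iterated.\<close>

primrec cdiff :: "((real ^ 'n \<Rightarrow> complex) \<Rightarrow> bool) \<Rightarrow> nat \<Rightarrow> (real ^ 'n::finite \<Rightarrow> complex) \<Rightarrow> bool" where
  "cdiff P 0 f \<longleftrightarrow> (\<forall>x. f differentiable (at x)) \<and> P f"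
| "cdiff P (Suc N) f \<longleftrightarrow> (\<forall>x. f differentiable (at x)) \<and> P f \<and> (\<forall>i. cdiff P N (pd i f))"

lemma cdiffD: "cdiff P N f \<Longrightarrow> f differentiable (at x)" "cdiff P N f \<Longrightarrow> P f"
  by (cases N; simp)+

lemma cdiff_Suc_imp: "cdiff P (Suc N) f \<Longrightarrow> cdiff P N f"
  by (induction N arbitrary: f) auto

lemma cdiff_iff:
  "cdiff P N f \<longleftrightarrow>
    (\<forall>\<alpha>. length \<alpha> \<le> N \<longrightarrow> (\<forall>x. pderivs \<alpha> f differentiable (at x)) \<and> P (pderivs \<alpha> f))"
proof (induction N arbitrary: f)
  case 0
  then show ?case by simp
next
  case (Suc N)
  have "(\<forall>\<alpha>. length \<alpha> \<le> Suc N \<longrightarrow> Q \<alpha>) \<longleftrightarrow>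
      Q [] \<and> (\<forall>i \<alpha>. length \<alpha> \<le> N \<longrightarrow> Q (\<alpha> @ [i]))" for Q :: "'a list \<Rightarrow> bool"
    by (metis (no_types, lifting) Suc_le_mono le0 length_append_singleton list.size(3) rev_exhaust)
  from this[of "\<lambda>\<alpha>. (\<forall>x. pderivs \<alpha> f differentiable (at x)) \<and> P (pderivs \<alpha> f)"]
  show ?case
    unfolding cdiff.simps Suc.IH pderivs_snoc by simp
qed

lemma cdiff_mono: "(\<And>f. P f \<Longrightarrow> Q f) \<Longrightarrow> cdiff P N f \<Longrightarrow> cdiff Q N f"
  by (induction N arbitrary: f) auto

lemma cdiff_add:
  assumes "\<And>f g. P f \<Longrightarrow> P g \<Longrightarrow> P (\<lambda>x. f x + g x)" "cdiff P N f" "cdiff P N g"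
  shows "cdiff P N (\<lambda>x. f x + g x)"
  using assms(2,3)
proof (induction N arbitrary: f g)
  case 0
  then show ?case using assms(1) by auto
next
  case (Suc N)
  have "pd i (\<lambda>x. f x + g x) = (\<lambda>x. pd i f x + pd i g x)" for i
    using Suc.prems by (auto intro!: ext pd_add)
  then show ?case
    using Suc assms(1) by auto
qed

text \<open>Three predicates instead of one, because growth times decay is decay: the same induction
  serves plain smoothness, products of multipliers, and multipliers acting on Schwartz
  functions.\<close>

lemma cdiff_mult:
  assumes "\<And>f g. P f \<Longrightarrow> Q g \<Longrightarrow> R (\<lambda>x. f x * g x)"
    and "\<And>f g. R f \<Longrightarrow> R g \<Longrightarrow> R (\<lambda>x. f x + g x)"
    and "cdiff P N f" "cdiff Q N g"
  shows "cdiff R N (\<lambda>x. f x * g x)"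
  using assms(3,4)
proof (induction N arbitrary: f g)
  case 0
  then show ?case using assms(1) by auto
next
  case (Suc N)
  have *: "pd i (\<lambda>x. f x * g x) = (\<lambda>x. pd i f x * g x + f x * pd i g x)" for i
    using Suc.prems by (auto intro!: ext pd_mult)
  have "cdiff R N (\<lambda>x. pd i f x * g x + f x * pd i g x)" for i
  proof (intro cdiff_add[of R] Suc.IH assms(2))
    show "cdiff P N (pd i f)" "cdiff P N f" "cdiff Q N (pd i g)" "cdiff Q N g"
      using Suc.prems cdiff_Suc_imp[of P N f] cdiff_Suc_imp[of Q N g] by auto
  qed
  then show ?case
    using Suc.prems assms(1) by (auto simp: *)
qed

lemma cdiff_const: "(\<And>c. P (\<lambda>x. c)) \<Longrightarrow> cdiff P N (\<lambda>x. c)"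
  by (induction N arbitrary: c) (auto simp: pd_const)

text \<open>The derivative of 1/f is -f' times the square of 1/f, so besides \<open>f\<close> only
  1/f itself needs the bound \<open>P\<close>; its derivatives inherit it by induction.\<close>

lemma cdiff_inverse:
  assumes mult: "\<And>f g. P f \<Longrightarrow> P g \<Longrightarrow> P (\<lambda>x. f x * g x)"
    and add: "\<And>f g. P f \<Longrightarrow> P g \<Longrightarrow> P (\<lambda>x. f x + g x)"
    and const: "\<And>c. P (\<lambda>x. c)"
    and f: "cdiff P N f" and nz: "\<And>x. f x \<noteq> 0" and inv: "P (\<lambda>x. inverse (f x))"
  shows "cdiff P N (\<lambda>x. inverse (f x))"
  using f
proof (induction N)
  case 0
  then show ?case using inv nz by (auto intro!: differentiable_inverse)
next
  case (Suc N)
  have *: "pd i (\<lambda>x. inverse (f x)) =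
      (\<lambda>x. ((-1) * pd i f x) * (inverse (f x) * inverse (f x)))" for i
  proof
    fix x
    have "(f has_derivative frechet_derivative f (at x)) (at x)"
      using Suc.prems by (simp add: frechet_derivative_works)
    from Deriv.has_derivative_inverse[OF nz[of x] this]
    show "pd i (\<lambda>x. inverse (f x)) x = ((-1) * pd i f x) * (inverse (f x) * inverse (f x))"
      by (subst pd_eqI, assumption) (simp add: pd_def mult_ac)
  qed
  have c: "cdiff P N (\<lambda>x. -1)"
    by (rule cdiff_const) (rule const)
  have "cdiff P N (\<lambda>x. ((-1) * pd i f x) * (inverse (f x) * inverse (f x)))" for i
    using Suc.prems Suc.IH c cdiff_Suc_imp[of P N f]
    by (intro cdiff_mult[of P P P] mult add) auto
  then show ?case
    using Suc.prems inv nz by (auto simp: * intro!: differentiable_inverse)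
qed

subsection \<open>The Schwartz space and its multipliers\<close>

abbreviation (input) smooth :: "(real ^ 'n::finite \<Rightarrow> complex) \<Rightarrow> bool" where
  "smooth f \<equiv> \<forall>N. cdiff (\<lambda>_. True) N f"

definition poly_growth :: "(real ^ 'n::finite \<Rightarrow> complex) \<Rightarrow> bool" where
  "poly_growth f \<longleftrightarrow> (\<exists>C k. \<forall>x. norm (f x) \<le> C * (1 + norm x) ^ k)"

definition rapid_decay :: "(real ^ 'n::finite \<Rightarrow> complex) \<Rightarrow> bool" where
  "rapid_decay f \<longleftrightarrow> (\<forall>k. \<exists>C. \<forall>x. (1 + norm x) ^ k * norm (f x) \<le> C)"

text \<open>The space often written O_M, of slowly increasing smooth functions: the exponent of the
  growth may depend on the derivative.\<close>

definition schwartz_multipliers :: "(real ^ 'n::finite \<Rightarrow> complex) set" where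
  "schwartz_multipliers = {f. \<forall>N. cdiff poly_growth N f}"

lemma smooth_iff: "smooth f \<longleftrightarrow> (\<forall>\<alpha> x. pderivs \<alpha> f differentiable (at x))"
  by (auto simp: cdiff_iff)

lemma smooth_pd: "smooth f \<Longrightarrow> smooth (pd i f)"
  by (metis cdiff.simps(2))

lemma smooth_add: "smooth f \<Longrightarrow> smooth g \<Longrightarrow> smooth (\<lambda>x. f x + g x)"
  by (auto intro: cdiff_add)

lemma pderivs_add:
  "smooth f \<Longrightarrow> smooth g \<Longrightarrow> pderivs \<alpha> (\<lambda>x. f x + g x) = (\<lambda>x. pderivs \<alpha> f x + pderivs \<alpha> g x)"
  by (induction \<alpha>) (auto simp: pderivs_Cons_pd smooth_iff intro!: ext pd_add)

lemma pd_smooth_mult: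
  assumes "smooth f" "smooth g"
  shows "pd i (\<lambda>x. f x * g x) = (\<lambda>x. pd i f x * g x + f x * pd i g x)"
  using assms cdiffD(1)[of "\<lambda>_. True" 0] by (intro ext pd_mult) blast+

text \<open>Each derivative splits a product into two products of the same kind, so the number of
  terms is at most 2 to the order. The bounds concern one point \<open>x\<close>, so that
  \<open>A\<close> and \<open>B\<close> may carry its weight.\<close>

lemma leibniz_bound:
  assumes "smooth f" "smooth g"
    and "\<And>\<beta>. length \<beta> \<le> n \<Longrightarrow> norm (pderivs \<beta> f x) \<le> A"
    and "\<And>\<beta>. length \<beta> \<le> n \<Longrightarrow> norm (pderivs \<beta> g x) \<le> B"
    and "length \<alpha> \<le> n"
  shows "norm (pderivs \<alpha> (\<lambda>x. f x * g x) x) \<le> 2 ^ length \<alpha> * (A * B)"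
  using assms
proof (induction \<alpha> arbitrary: f g n rule: rev_induct)
  case Nil
  then show ?case
    using Nil(3)[of "[]"] Nil(4)[of "[]"]
    by (auto simp: norm_mult intro!: mult_mono order_trans[OF norm_ge_zero])
next
  case (snoc i \<alpha>)
  then obtain m where n: "n = Suc m" by (cases n) auto
  have d: "norm (pderivs \<beta> (pd i f) x) \<le> A" "norm (pderivs \<beta> (pd i g) x) \<le> B"
    "norm (pderivs \<beta> f x) \<le> A" "norm (pderivs \<beta> g x) \<le> B" if "length \<beta> \<le> m" for \<beta>
    using snoc.prems(3)[of "\<beta> @ [i]"] snoc.prems(4)[of "\<beta> @ [i]"] snoc.prems(3)[of \<beta>]
      snoc.prems(4)[of \<beta>] that by (auto simp: pderivs_snoc n)
  have l: "length \<alpha> \<le> m" using snoc.prems(5) n by simp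
  note s = snoc.prems(1,2)
  have "pderivs (\<alpha> @ [i]) (\<lambda>x. f x * g x) x =
      pderivs \<alpha> (\<lambda>x. pd i f x * g x) x + pderivs \<alpha> (\<lambda>x. f x * pd i g x) x"
    unfolding pderivs_snoc pd_smooth_mult[OF s]
    by (subst pderivs_add) (use s in \<open>auto intro!: cdiff_mult smooth_pd[THEN spec]\<close>)
  also have "norm \<dots> \<le> 2 ^ length \<alpha> * (A * B) + 2 ^ length \<alpha> * (A * B)"
    by (intro order_trans[OF norm_triangle_ineq] add_mono snoc.IH[of _ _ m] d l s smooth_pd)
  finally show ?case by (simp add: mult_ac)
qed

lemma poly_growthE:
  assumes "poly_growth f"
  obtains C k where "C \<ge> 0" "\<And>x. norm (f x) \<le> C * (1 + norm x) ^ k"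
proof -
  obtain C k where C: "\<And>x. norm (f x) \<le> C * (1 + norm x) ^ k"
    using assms by (auto simp: poly_growth_def)
  have "norm (f x) \<le> max 0 C * (1 + norm x) ^ k" for x
    by (rule order_trans[OF C mult_right_mono]) auto
  then show ?thesis using that[of "max 0 C" k] by auto
qed

lemma rapid_decayE:
  assumes "rapid_decay f"
  obtains C where "C \<ge> 0" "\<And>x. (1 + norm x) ^ k * norm (f x) \<le> C"
proof -
  obtain C where C: "\<And>x. (1 + norm x) ^ k * norm (f x) \<le> C"
    using assms by (auto simp: rapid_decay_def)
  moreover have "C \<ge> 0"
    by (rule order_trans[OF _ C[of 0]]) auto
  ultimately show ?thesis using that by blast
qed

lemma poly_growth_add:
  assumes "poly_growth f" "poly_growth g"
  shows "poly_growth (\<lambda>x. f x + g x)"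
proof -
  obtain C k where C: "C \<ge> 0" "\<And>x. norm (f x) \<le> C * (1 + norm x) ^ k"
    using poly_growthE[OF assms(1)] by blast
  obtain D l where D: "D \<ge> 0" "\<And>x. norm (g x) \<le> D * (1 + norm x) ^ l"
    using poly_growthE[OF assms(2)] by blast
  have "norm (f x + g x) \<le> (C + D) * (1 + norm x) ^ (k + l)" for x
  proof -
    have "norm (f x + g x) \<le> C * (1 + norm x) ^ k + D * (1 + norm x) ^ l"
      by (rule order_trans[OF norm_triangle_ineq add_mono[OF C(2) D(2)]])
    also have "\<dots> \<le> C * (1 + norm x) ^ (k + l) + D * (1 + norm x) ^ (k + l)"
      using C D by (intro add_mono mult_left_mono power_increasing) auto
    finally show ?thesis by (simp add: algebra_simps)
  qed
  then show ?thesis by (auto simp: poly_growth_def)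
qed

lemma poly_growth_mult:
  assumes "poly_growth f" "poly_growth g"
  shows "poly_growth (\<lambda>x. f x * g x)"
proof -
  obtain C k where C: "C \<ge> 0" "\<And>x. norm (f x) \<le> C * (1 + norm x) ^ k"
    using poly_growthE[OF assms(1)] by blast
  obtain D l where D: "D \<ge> 0" "\<And>x. norm (g x) \<le> D * (1 + norm x) ^ l"
    using poly_growthE[OF assms(2)] by blast
  have "norm (f x * g x) \<le> (C * D) * (1 + norm x) ^ (k + l)" for x
    using mult_mono[OF C(2) D(2), of x x] C D
    by (simp add: norm_mult power_add algebra_simps)
  then show ?thesis unfolding poly_growth_def by blast
qed

lemma poly_growth_const: "poly_growth (\<lambda>x. c)"
  unfolding poly_growth_def by (intro exI[of _ "norm c"] exI[of _ 0]) auto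

lemma rapid_decay_add:
  assumes "rapid_decay f" "rapid_decay g"
  shows "rapid_decay (\<lambda>x. f x + g x)"
  unfolding rapid_decay_def
proof
  fix k
  obtain C where C: "\<And>x. (1 + norm x) ^ k * norm (f x) \<le> C"
    using rapid_decayE[OF assms(1)] by metis
  obtain D where D: "\<And>x. (1 + norm x) ^ k * norm (g x) \<le> D"
    using rapid_decayE[OF assms(2)] by metis
  have "(1 + norm x) ^ k * norm (f x + g x) \<le> C + D" for x
    using C[of x] D[of x] mult_left_mono[OF norm_triangle_ineq[of "f x" "g x"], of "(1 + norm x) ^ k"]
    by (simp add: algebra_simps)
  then show "\<exists>C. \<forall>x. (1 + norm x) ^ k * norm (f x + g x) \<le> C" by blast
qed

lemma rapid_decay_mult:
  assumes "poly_growth f" "rapid_decay g"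
  shows "rapid_decay (\<lambda>x. f x * g x)"
  unfolding rapid_decay_def
proof
  fix k
  obtain C l where C: "C \<ge> 0" "\<And>x. norm (f x) \<le> C * (1 + norm x) ^ l"
    using poly_growthE[OF assms(1)] by blast
  obtain D where D: "\<And>x. (1 + norm x) ^ (k + l) * norm (g x) \<le> D"
    using rapid_decayE[OF assms(2)] by metis
  have "(1 + norm x) ^ k * norm (f x * g x) \<le> C * D" for x
  proof -
    have "(1 + norm x) ^ k * norm (f x * g x) \<le> (1 + norm x) ^ k * (C * (1 + norm x) ^ l * norm (g x))"
      unfolding norm_mult by (intro mult_left_mono mult_right_mono C) auto
    also have "\<dots> = C * ((1 + norm x) ^ (k + l) * norm (g x))"
      by (simp add: power_add algebra_simps)
    also have "\<dots> \<le> C * D" by (intro mult_left_mono C D)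
    finally show ?thesis .
  qed
  then show "\<exists>C. \<forall>x. (1 + norm x) ^ k * norm (f x * g x) \<le> C" by blast
qed

lemma rapid_decay_imp_poly_growth:
  assumes "rapid_decay f"
  shows "poly_growth f"
proof -
  obtain C where "\<And>x. (1 + norm x) ^ 0 * norm (f x) \<le> C"
    using rapid_decayE[OF assms] by metis
  then show ?thesis unfolding poly_growth_def by (intro exI[of _ C] exI[of _ 0]) auto
qed

lemma schwartz_iff: "g \<in> \<S> \<longleftrightarrow> (\<forall>N. cdiff rapid_decay N g)"
  unfolding schwartz_space_def cdiff_iff rapid_decay_def by blast

lemma schwartz_smooth: "g \<in> \<S> \<Longrightarrow> smooth g"
  unfolding schwartz_iff using cdiff_mono[of rapid_decay "\<lambda>_. True"] by auto

lemma multiplier_smooth: "g \<in> schwartz_multipliers \<Longrightarrow> smooth g"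
  unfolding schwartz_multipliers_def using cdiff_mono[of poly_growth "\<lambda>_. True"] by auto

lemma schwartz_multiplier: "g \<in> \<S> \<Longrightarrow> g \<in> schwartz_multipliers"
  unfolding schwartz_iff schwartz_multipliers_def
  using cdiff_mono[of rapid_decay poly_growth] rapid_decay_imp_poly_growth by auto

lemma schwartz_rapid: "g \<in> \<S> \<Longrightarrow> rapid_decay g"
  unfolding schwartz_iff using cdiffD by blast

lemma schwartz_pd: "g \<in> \<S> \<Longrightarrow> pd i g \<in> \<S>"
  unfolding schwartz_iff by (metis cdiff.simps(2))

lemma schwartz_add: "f \<in> \<S> \<Longrightarrow> g \<in> \<S> \<Longrightarrow> (\<lambda>x. f x + g x) \<in> \<S>"
  unfolding schwartz_iff by (auto intro: cdiff_add rapid_decay_add)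

lemma schwartz_mult:
  "a \<in> schwartz_multipliers \<Longrightarrow> g \<in> \<S> \<Longrightarrow> (\<lambda>x. a x * g x) \<in> \<S>"
  unfolding schwartz_iff schwartz_multipliers_def
  by (auto intro: cdiff_mult rapid_decay_mult rapid_decay_add)

lemma multiplier_const: "(\<lambda>x. c) \<in> schwartz_multipliers"
  unfolding schwartz_multipliers_def by (auto intro: cdiff_const poly_growth_const)

lemma multiplier_inverse:
  assumes "a \<in> schwartz_multipliers" "\<And>x. a x \<noteq> 0" "poly_growth (\<lambda>x. inverse (a x))"
  shows "(\<lambda>x. inverse (a x)) \<in> schwartz_multipliers"
  using assms unfolding schwartz_multipliers_def
  by (auto intro: cdiff_inverse poly_growth_mult poly_growth_add poly_growth_const)

lemma schwartz_cmult: "g \<in> \<S> \<Longrightarrow> (\<lambda>x. c * g x) \<in> \<S>"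
  using schwartz_mult[OF multiplier_const] .

lemma schwartz_diff: "f \<in> \<S> \<Longrightarrow> g \<in> \<S> \<Longrightarrow> (\<lambda>x. f x - g x) \<in> \<S>"
  using schwartz_add[of f "\<lambda>x. -1 * g x"] schwartz_cmult[of g "-1"] by simp

lemma multiplier_coord: "(\<lambda>x. c * complex_of_real (x $ j)) \<in> schwartz_multipliers"
proof -
  have hd: "((\<lambda>x. c * complex_of_real (x $ j)) has_derivative (\<lambda>h. c * complex_of_real (h $ j))) (at x)" for x
    by (intro bounded_linear_imp_has_derivative bounded_linear_mult_right[THEN bounded_linear_compose]
        bounded_linear_of_real[THEN bounded_linear_compose] bounded_linear_vec_nth)
  have pg: "poly_growth (\<lambda>x. c * complex_of_real (x $ j))"
    unfolding poly_growth_def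
  proof (intro exI[of _ "norm c"] exI[of _ 1] allI)
    fix x :: "real ^ 'a"
    show "norm (c * complex_of_real (x $ j)) \<le> norm c * (1 + norm x) ^ 1"
      using component_le_norm_cart[of x j] by (auto simp: norm_mult intro!: mult_left_mono)
  qed
  have pd: "pd i (\<lambda>x. c * complex_of_real (x $ j)) = (\<lambda>x. c * complex_of_real (axis i 1 $ j))" for i
    using pd_eqI[OF hd] by auto
  have "cdiff poly_growth N (\<lambda>x. c * complex_of_real (x $ j))" for N
  proof (cases N)
    case 0
    then show ?thesis using hd pg by (auto simp: differentiable_def)
  next
    case (Suc M)
    then show ?thesis using hd pg
      by (auto simp: differentiable_def pd intro!: cdiff_const poly_growth_const)
  qed
  then show ?thesis by (simp add: schwartz_multipliers_def)
qed

lemma differentiable_affine: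
  assumes "f differentiable (at (c *\<^sub>R x + d))"
  shows "(\<lambda>x. f (c *\<^sub>R x + d)) differentiable (at x)"
proof -
  have "((\<lambda>x. c *\<^sub>R x + d) has_derivative (\<lambda>h. c *\<^sub>R h)) (at x)"
    by (auto intro!: derivative_eq_intros)
  from has_derivative_compose[where f = "\<lambda>x. c *\<^sub>R x + d" and g = f, OF this] assms show ?thesis
    unfolding differentiable_def by blast
qed

lemma pd_affine:
  assumes "f differentiable (at (c *\<^sub>R x + d))"
  shows "pd i (\<lambda>x. f (c *\<^sub>R x + d)) x = complex_of_real c * pd i f (c *\<^sub>R x + d)"
proof -
  let ?D = "frechet_derivative f (at (c *\<^sub>R x + d))"
  have D: "(f has_derivative ?D) (at (c *\<^sub>R x + d))"
    using assms by (simp add: frechet_derivative_works)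
  have "((\<lambda>x. f (c *\<^sub>R x + d)) has_derivative (\<lambda>h. ?D (c *\<^sub>R h))) (at x)"
    by (rule has_derivative_compose[where f = "\<lambda>x. c *\<^sub>R x + d" and g = f, OF _ D]) (auto intro!: derivative_eq_intros)
  from pd_eqI[OF this] show ?thesis
    using linear_cmul[OF has_derivative_linear[OF D]]
    by (simp add: pd_def scaleR_conv_of_real)
qed

lemma pderivs_affine:
  assumes "smooth f"
  shows "pderivs \<alpha> (\<lambda>x. f (c *\<^sub>R x + d)) =
    (\<lambda>x. complex_of_real c ^ length \<alpha> * pderivs \<alpha> f (c *\<^sub>R x + d))"
proof (induction \<alpha>)
  case Nil
  then show ?case by simp
next
  case (Cons i \<alpha>)
  have d: "pderivs \<alpha> f differentiable (at y)" for y
    using assms smooth_iff by blast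
  show ?case
    unfolding pderivs_Cons_pd Cons.IH
  proof
    fix x
    show "pd i (\<lambda>x. complex_of_real c ^ length \<alpha> * pderivs \<alpha> f (c *\<^sub>R x + d)) x =
        complex_of_real c ^ length (i # \<alpha>) * pd i (pderivs \<alpha> f) (c *\<^sub>R x + d)"
      by (subst pd_mult[OF differentiable_const differentiable_affine[OF d]])
        (simp add: pd_const pd_affine[OF d])
  qed
qed

lemma smooth_affine:
  assumes "smooth f"
  shows "smooth (\<lambda>x. f (c *\<^sub>R x + d))"
proof -
  have "(\<lambda>x. pderivs \<alpha> f (c *\<^sub>R x + d)) differentiable (at x)" for \<alpha> x
    using assms unfolding smooth_iff by (intro differentiable_affine) blast
  then show ?thesis
    unfolding smooth_iff pderivs_affine[OF assms]
    by (intro allI differentiable_mult differentiable_const)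
qed

lemma schwartz_affine:
  assumes f: "f \<in> \<S>" and c: "c \<noteq> 0"
  shows "(\<lambda>x. f (c *\<^sub>R x + d)) \<in> \<S>"
proof -
  \<comment> \<open>From |x| \<le> (|c x + d| + |d|) / |c|: this constant compares the weight at
    \<open>x\<close> with the weight at its image.\<close>
  define K where "K = 1 + (1 + norm d) / \<bar>c\<bar>"
  have K: "1 + norm x \<le> K * (1 + norm (c *\<^sub>R x + d))" for x :: "real ^ 'a"
  proof -
    have "norm (c *\<^sub>R x) \<le> norm (c *\<^sub>R x + d) + norm d"
      using norm_triangle_ineq4[of "c *\<^sub>R x + d" d] by simp
    then have "norm x \<le> (norm (c *\<^sub>R x + d) + norm d) / \<bar>c\<bar>"
      using c by (simp add: field_simps)
    also have "\<dots> \<le> ((1 + norm d) * (1 + norm (c *\<^sub>R x + d))) / \<bar>c\<bar>"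
      by (intro divide_right_mono) (auto simp: algebra_simps)
    finally have "norm x \<le> ((1 + norm d) * (1 + norm (c *\<^sub>R x + d))) / \<bar>c\<bar>" .
    then have "1 + norm x \<le> (1 + norm (c *\<^sub>R x + d)) + (1 + norm d) / \<bar>c\<bar> * (1 + norm (c *\<^sub>R x + d))"
      by (intro add_mono) auto
    then show ?thesis
      unfolding K_def distrib_right by simp
  qed
  have K0: "K \<ge> 0" by (simp add: K_def)
  have "\<exists>C. \<forall>x. (1 + norm x) ^ k * norm (pderivs \<alpha> (\<lambda>x. f (c *\<^sub>R x + d)) x) \<le> C" for k \<alpha>
  proof -
    obtain C where C: "\<And>x. (1 + norm x) ^ k * norm (pderivs \<alpha> f x) \<le> C"
      using f unfolding schwartz_space_def by blast
    have "(1 + norm x) ^ k * norm (pderivs \<alpha> (\<lambda>x. f (c *\<^sub>R x + d)) x) \<le>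
        K ^ k * (\<bar>c\<bar> ^ length \<alpha> * C)" for x
    proof -
      have "(1 + norm x) ^ k * norm (pderivs \<alpha> (\<lambda>x. f (c *\<^sub>R x + d)) x) \<le>
          (K * (1 + norm (c *\<^sub>R x + d))) ^ k * (\<bar>c\<bar> ^ length \<alpha> * norm (pderivs \<alpha> f (c *\<^sub>R x + d)))"
        unfolding pderivs_affine[OF schwartz_smooth[OF f]] norm_mult norm_power
        by (intro mult_mono power_mono K) (auto simp: K0)
      also have "\<dots> = K ^ k * (\<bar>c\<bar> ^ length \<alpha> *
          ((1 + norm (c *\<^sub>R x + d)) ^ k * norm (pderivs \<alpha> f (c *\<^sub>R x + d))))"
        by (simp add: power_mult_distrib mult_ac)
      also have "\<dots> \<le> K ^ k * (\<bar>c\<bar> ^ length \<alpha> * C)"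
        by (intro mult_left_mono C) (auto simp: K0)
      finally show ?thesis .
    qed
    then show ?thesis by blast
  qed
  then show ?thesis
    using smooth_affine[OF schwartz_smooth[OF f], unfolded smooth_iff]
    unfolding schwartz_space_def by blast
qed

lemma schwartz_scale: "f \<in> \<S> \<Longrightarrow> c \<noteq> 0 \<Longrightarrow> (\<lambda>x. f (c *\<^sub>R x)) \<in> \<S>"
  using schwartz_affine[of f c 0] by simp

lemma schwartz_minus: "f \<in> \<S> \<Longrightarrow> (\<lambda>x. f (- x)) \<in> \<S>"
  using schwartz_affine[of f "-1" 0] by simp

lemma pd_cnj:
  assumes "f differentiable (at x)"
  shows "pd i (\<lambda>x. cnj (f x)) x = cnj (pd i f x)"
proof -
  have "(f has_derivative frechet_derivative f (at x)) (at x)"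
    using assms by (simp add: frechet_derivative_works)
  from pd_eqI[OF has_derivative_cnj[OF this]] show ?thesis
    by (simp add: pd_def)
qed

lemma differentiable_cnj':
  "f differentiable (at x) \<Longrightarrow> (\<lambda>x. cnj (f x)) differentiable (at x)"
  unfolding differentiable_def by (elim exE) (rule exI, rule has_derivative_cnj)

lemma schwartz_cnj:
  assumes "f \<in> \<S>"
  shows "(\<lambda>x. cnj (f x)) \<in> \<S>"
proof -
  have *: "pderivs \<alpha> (\<lambda>x. cnj (f x)) = (\<lambda>x. cnj (pderivs \<alpha> f x))" for \<alpha>
  proof (induction \<alpha>)
    case (Cons i \<alpha>)
    then show ?case
      using assms unfolding pderivs_Cons_pd by (intro ext) (simp add: schwartz_space_def pd_cnj)
  qed simp
  show ?thesis
    using assms unfolding schwartz_space_def mem_Collect_eq * complex_mod_cnj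
    by (intro conjI allI differentiable_cnj') blast+
qed

subsection \<open>Schwartz seminorms\<close>

lemma finite_lists_le: "finite {\<alpha> :: 'n::finite list. length \<alpha> \<le> N}"
  using finite_lists_length_le[of "UNIV :: 'n set" N] by simp

lemma uniform_bound:
  fixes C :: "'n::finite list \<Rightarrow> 'a::linorder"
  shows "\<exists>K. \<forall>\<alpha>. length \<alpha> \<le> N \<longrightarrow> C \<alpha> \<le> K"
  by (intro exI[of _ "Max (C ` {\<alpha>. length \<alpha> \<le> N})"]) (auto intro!: Max_ge finite_lists_le)

text \<open>A supremum of reals bounds its members only when the set is bounded above. There are
  finitely many lists of length at most \<open>N\<close>, so the bounds for the single derivatives
  have a common one.\<close>

lemma bdd_above_schwartz_seminorm:
  fixes g :: "real ^ 'n::finite \<Rightarrow> complex"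
  assumes "g \<in> \<S>"
  shows "bdd_above ((\<lambda>(\<alpha>, x). (1 + norm x) ^ N * norm (pderivs \<alpha> g x)) ` ({\<alpha>. length \<alpha> \<le> N} \<times> UNIV))"
proof -
  have "\<forall>\<alpha>. \<exists>C. \<forall>x. (1 + norm x) ^ N * norm (pderivs \<alpha> g x) \<le> C"
    using assms unfolding schwartz_space_def by blast
  then obtain C where C: "\<And>\<alpha> x. (1 + norm x) ^ N * norm (pderivs \<alpha> g x) \<le> C \<alpha>"
    by metis
  obtain K where K: "\<And>\<alpha>. length \<alpha> \<le> N \<Longrightarrow> C \<alpha> \<le> K"
    using uniform_bound[of N C] by blast
  show ?thesis
    by (rule bdd_aboveI2[of _ _ K]) (use order_trans[OF C K] in auto)
qed

lemma schwartz_seminorm_ge: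
  assumes "g \<in> \<S>" "length \<alpha> \<le> N" "k \<le> N"
  shows "(1 + norm x) ^ k * norm (pderivs \<alpha> g x) \<le> schwartz_seminorm N g"
proof -
  have "(1 + norm x) ^ k * norm (pderivs \<alpha> g x) \<le> (1 + norm x) ^ N * norm (pderivs \<alpha> g x)"
    using assms by (intro mult_right_mono power_increasing) auto
  also have "\<dots> \<le> schwartz_seminorm N g"
    unfolding schwartz_seminorm_def
    using cSUP_upper[OF _ bdd_above_schwartz_seminorm[OF assms(1), of N], of "(\<alpha>, x)"] assms by auto
  finally show ?thesis .
qed

lemma schwartz_seminorm_le:
  fixes g :: "real ^ 'n::finite \<Rightarrow> complex"
  assumes "\<And>\<alpha> x. length \<alpha> \<le> N \<Longrightarrow> (1 + norm x) ^ N * norm (pderivs \<alpha> g x) \<le> K"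
  shows "schwartz_seminorm N g \<le> K"
proof -
  have "([], 0) \<in> {\<alpha> :: 'n list. length \<alpha> \<le> N} \<times> (UNIV :: (real^'n) set)" by simp
  then show ?thesis
    unfolding schwartz_seminorm_def using assms by (intro cSUP_least) (blast, auto)
qed

lemma schwartz_seminorm_nonneg: "g \<in> \<S> \<Longrightarrow> 0 \<le> schwartz_seminorm N g"
  by (rule order_trans[OF _ schwartz_seminorm_ge[of g "[]" N 0 0]]) auto

lemma schwartz_seminorm_mono:
  "g \<in> \<S> \<Longrightarrow> M \<le> N \<Longrightarrow> schwartz_seminorm M g \<le> schwartz_seminorm N g"
  by (intro schwartz_seminorm_le schwartz_seminorm_ge) auto

text \<open>For a linear operator this is continuity in the Frechet topology; linearity is asked for
  separately, in \<open>tempered_comp\<close>.\<close>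

definition schwartz_continuous ::
    "((real ^ 'n::finite \<Rightarrow> complex) \<Rightarrow> (real ^ 'n \<Rightarrow> complex)) \<Rightarrow> bool" where
  "schwartz_continuous A \<longleftrightarrow> (\<forall>g\<in>\<S>. A g \<in> \<S>) \<and>
     (\<forall>N. \<exists>M C. \<forall>g\<in>\<S>. schwartz_seminorm N (A g) \<le> C * schwartz_seminorm M g)"

lemma schwartz_continuousE:
  assumes "schwartz_continuous A"
  obtains M C where "C \<ge> 0"
    "\<And>g. g \<in> \<S> \<Longrightarrow> schwartz_seminorm N (A g) \<le> C * schwartz_seminorm M g"
proof -
  obtain M C where C: "\<And>g. g \<in> \<S> \<Longrightarrow> schwartz_seminorm N (A g) \<le> C * schwartz_seminorm M g"
    using assms unfolding schwartz_continuous_def by meson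
  have "schwartz_seminorm N (A g) \<le> max 0 C * schwartz_seminorm M g" if "g \<in> \<S>" for g
    by (rule order_trans[OF C[OF that] mult_right_mono]) (auto simp: schwartz_seminorm_nonneg that)
  then show ?thesis using that[of "max 0 C" M] by auto
qed

lemma schwartz_continuous_comp:
  assumes A: "schwartz_continuous A" and B: "schwartz_continuous B"
  shows "schwartz_continuous (\<lambda>g. A (B g))"
  unfolding schwartz_continuous_def
proof (intro conjI allI ballI)
  show "A (B g) \<in> \<S>" if "g \<in> \<S>" for g
    using A B that by (simp add: schwartz_continuous_def)
  fix N
  obtain M C where C: "C \<ge> 0"
    "\<And>g. g \<in> \<S> \<Longrightarrow> schwartz_seminorm N (A g) \<le> C * schwartz_seminorm M g"
    using schwartz_continuousE[OF A] by metis
  obtain L D where D: "D \<ge> 0"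
    "\<And>g. g \<in> \<S> \<Longrightarrow> schwartz_seminorm M (B g) \<le> D * schwartz_seminorm L g"
    using schwartz_continuousE[OF B] by metis
  have "schwartz_seminorm N (A (B g)) \<le> (C * D) * schwartz_seminorm L g" if "g \<in> \<S>" for g
    using C(2)[of "B g"] mult_left_mono[OF D(2)[OF that] C(1)] B that
    by (auto simp: schwartz_continuous_def mult_ac)
  then show "\<exists>L C. \<forall>g\<in>\<S>. schwartz_seminorm N (A (B g)) \<le> C * schwartz_seminorm L g"
    by blast
qed

text \<open>The transpose of a continuous linear operator of the Schwartz space. Fourier transform,
  multiplication and inverse Fourier transform of distributions are all of this form;
  \<open>restrict\<close> makes the result extensional.\<close>

lemma tempered_comp:
  assumes T: "T \<in> tempered_distributions" and A: "schwartz_continuous A"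
    and add: "\<And>g h. g \<in> \<S> \<Longrightarrow> h \<in> \<S> \<Longrightarrow> A (\<lambda>x. g x + h x) = (\<lambda>x. A g x + A h x)"
    and scale: "\<And>c g. g \<in> \<S> \<Longrightarrow> A (\<lambda>x. c * g x) = (\<lambda>x. c * A g x)"
  shows "restrict (\<lambda>g. T (A g)) \<S> \<in> tempered_distributions"
proof -
  have A1: "A g \<in> \<S>" if "g \<in> \<S>" for g
    using A that by (simp add: schwartz_continuous_def)
  obtain N C where C: "\<And>g. g \<in> \<S> \<Longrightarrow> norm (T g) \<le> C * schwartz_seminorm N g"
    using T unfolding tempered_distributions_def by blast
  obtain M D where D: "D \<ge> 0"
    "\<And>g. g \<in> \<S> \<Longrightarrow> schwartz_seminorm N (A g) \<le> D * schwartz_seminorm M g"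
    using schwartz_continuousE[OF A] by metis
  have "norm (T (A g)) \<le> (max 0 C * D) * schwartz_seminorm M g" if g: "g \<in> \<S>" for g
  proof -
    have "norm (T (A g)) \<le> max 0 C * schwartz_seminorm N (A g)"
      by (rule order_trans[OF C[OF A1[OF g]] mult_right_mono])
        (auto simp: schwartz_seminorm_nonneg A1[OF g])
    also have "\<dots> \<le> max 0 C * (D * schwartz_seminorm M g)"
      by (intro mult_left_mono D g) auto
    finally show ?thesis by (simp add: mult_ac)
  qed
  then have "\<exists>M C. \<forall>g\<in>\<S>. norm (T (A g)) \<le> C * schwartz_seminorm M g"
    by blast
  then show ?thesis
    using T A1 unfolding tempered_distributions_def
    by (simp add: schwartz_add schwartz_cmult add scale)
qed

lemma schwartz_continuous_mult:
  fixes a :: "real ^ 'n::finite \<Rightarrow> complex"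
  assumes a: "a \<in> schwartz_multipliers"
  shows "schwartz_continuous (\<lambda>g x. a x * g x)"
  unfolding schwartz_continuous_def
proof (intro conjI allI ballI)
  show "(\<lambda>x. a x * g x) \<in> \<S>" if "g \<in> \<S>" for g
    by (rule schwartz_mult[OF a that])
  fix N
  have "\<forall>\<alpha>. \<exists>C k. C \<ge> 0 \<and> (length \<alpha> \<le> N \<longrightarrow> (\<forall>x. norm (pderivs \<alpha> a x) \<le> C * (1 + norm x) ^ k))"
  proof
    fix \<alpha>
    have "poly_growth (pderivs \<alpha> a)"
      using a unfolding schwartz_multipliers_def cdiff_iff by auto
    then obtain C k where "C \<ge> 0" "\<And>x. norm (pderivs \<alpha> a x) \<le> C * (1 + norm x) ^ k"
      by (rule poly_growthE) blast
    then show "\<exists>C k. C \<ge> 0 \<and> (length \<alpha> \<le> N \<longrightarrow> (\<forall>x. norm (pderivs \<alpha> a x) \<le> C * (1 + norm x) ^ k))"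
      by blast
  qed
  then obtain C k where Ck: "\<And>\<alpha>. C \<alpha> \<ge> 0"
    "\<And>\<alpha> x. length \<alpha> \<le> N \<Longrightarrow> norm (pderivs \<alpha> a x) \<le> C \<alpha> * (1 + norm x) ^ k \<alpha>"
    by metis
  obtain C' k' where C': "\<And>\<alpha>. length \<alpha> \<le> N \<Longrightarrow> C \<alpha> \<le> C'" "\<And>\<alpha>. length \<alpha> \<le> N \<Longrightarrow> k \<alpha> \<le> k'"
    using uniform_bound[of N C] uniform_bound[of N k] by metis
  have C'0: "C' \<ge> 0" using C'(1)[of "[]"] Ck(1)[of "[]"] by simp
  have a': "norm (pderivs \<alpha> a x) \<le> C' * (1 + norm x) ^ k'" if "length \<alpha> \<le> N" for \<alpha> x
    by (rule order_trans[OF Ck(2)[OF that] mult_mono])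
      (use C' that C'0 in \<open>auto intro!: power_increasing\<close>)
  have "schwartz_seminorm N (\<lambda>x. a x * g x) \<le> (2 ^ N * C') * schwartz_seminorm (N + k') g"
    if g: "g \<in> \<S>" for g
  proof (rule schwartz_seminorm_le)
    fix \<alpha> :: "'n list" and x :: "real ^ 'n" assume l: "length \<alpha> \<le> N"
    \<comment> \<open>The extra \<open>k'\<close> powers of the weight in the seminorm of
      \<open>g\<close> absorb the growth of the derivatives of \<open>a\<close>, and
      \<open>N\<close> powers remain for the seminorm on the left.\<close>
    let ?B = "schwartz_seminorm (N + k') g / (1 + norm x) ^ (N + k')"
    have pos: "(1 + norm x) ^ m > 0" for m
      by (intro zero_less_power add_pos_nonneg) simp_all
    have "norm (pderivs \<alpha> (\<lambda>x. a x * g x) x) \<le> 2 ^ length \<alpha> * ((C' * (1 + norm x) ^ k') * ?B)"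
    proof (rule leibniz_bound[OF multiplier_smooth[OF a] schwartz_smooth[OF g] a' _ l])
      show "norm (pderivs \<beta> g x) \<le> ?B" if "length \<beta> \<le> N" for \<beta>
        using schwartz_seminorm_ge[OF g, of \<beta> "N + k'" "N + k'" x] that pos
        by (simp add: field_simps)
    qed
    also have "\<dots> \<le> 2 ^ N * ((C' * (1 + norm x) ^ k') * ?B)"
      using l C'0 schwartz_seminorm_nonneg[OF g] by (intro mult_right_mono power_increasing) auto
    finally have "(1 + norm x) ^ N * norm (pderivs \<alpha> (\<lambda>x. a x * g x) x) \<le>
        (1 + norm x) ^ N * (2 ^ N * ((C' * (1 + norm x) ^ k') * ?B))"
      by (intro mult_left_mono) auto
    also have "\<dots> = (2 ^ N * C') * schwartz_seminorm (N + k') g"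
      using pos[of N, THEN less_imp_neq] pos[of k', THEN less_imp_neq]
      unfolding power_add by (simp add: field_simps del: power_eq_0_iff)
    finally show "(1 + norm x) ^ N * norm (pderivs \<alpha> (\<lambda>x. a x * g x) x) \<le> \<dots>" .
  qed
  then show "\<exists>M C. \<forall>g\<in>\<S>. schwartz_seminorm N (\<lambda>x. a x * g x) \<le> C * schwartz_seminorm M g"
    by blast
qed

lemma schwartz_continuous_minus: "schwartz_continuous (\<lambda>g x. g (- x))"
  unfolding schwartz_continuous_def
proof (intro conjI allI ballI exI)
  fix g :: "real ^ 'a \<Rightarrow> complex" and N assume g: "g \<in> \<S>"
  show "(\<lambda>x. g (- x)) \<in> \<S>"
    using g by (rule schwartz_minus)
  show "schwartz_seminorm N (\<lambda>x. g (- x)) \<le> 1 * schwartz_seminorm N g"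
    unfolding mult_1
  proof (rule schwartz_seminorm_le)
    fix \<alpha> :: "'a list" and x :: "real ^ 'a" assume "length \<alpha> \<le> N"
    then show "(1 + norm x) ^ N * norm (pderivs \<alpha> (\<lambda>x. g (- x)) x) \<le> schwartz_seminorm N g"
      using pderivs_affine[OF schwartz_smooth[OF g], of \<alpha> "-1" 0]
        schwartz_seminorm_ge[OF g, of \<alpha> N N "-x"] by (simp add: norm_mult norm_power)
  qed
qed

subsection \<open>Integration of rapidly decreasing functions\<close>

lemmas integrable_dominated = Bochner_Integration.integrable_bound

lemma integral_lborel_affine:
  fixes f :: "'a::euclidean_space \<Rightarrow> 'b::{banach, second_countable_topology}"
  assumes f[measurable]: "f \<in> borel_measurable borel" and c: "c \<noteq> 0"
  shows "integral\<^sup>L lborel f = \<bar>c\<bar> ^ DIM('a) *\<^sub>R (LINT x|lborel. f (t + c *\<^sub>R x))"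
  by (subst lborel_affine[OF c, of t])
    (simp add: integral_density integral_distr)

lemma integrable_lborel_affine:
  fixes f :: "'a::euclidean_space \<Rightarrow> 'b::{banach, second_countable_topology}"
  assumes f: "integrable lborel f" and c: "c \<noteq> 0"
  shows "integrable lborel (\<lambda>x. f (t + c *\<^sub>R x))"
proof -
  have [measurable]: "f \<in> borel_measurable borel" using f by auto
  from f have "integrable (density (distr lborel borel (\<lambda>x. t + c *\<^sub>R x)) (\<lambda>_. \<bar>c\<bar>^DIM('a))) f"
    by (subst (asm) lborel_affine[OF c, of t])
  then have "integrable lborel (\<lambda>x. \<bar>c\<bar> ^ DIM('a) *\<^sub>R f (t + c *\<^sub>R x))"
    by (simp add: integrable_density integrable_distr_eq)
  from integrable_scaleR_right[OF this, of "inverse (\<bar>c\<bar> ^ DIM('a))"] show ?thesis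
    using c by simp
qed

text \<open>The exponent is twice the dimension n because the product over the coordinates t of 1 +
  t^2 is at most (1 + |x|)^(2n): the function lies below a tensor product of copies of the
  integrable 1/(1 + t^2).\<close>

definition decay :: "real ^ 'n::finite \<Rightarrow> real" where
  "decay x = inverse ((1 + norm x) ^ (2 * CARD('n)))"

lemma decay_pos: "0 < decay x"
  unfolding decay_def by (intro positive_imp_inverse_positive zero_less_power add_pos_nonneg) auto

lemma decay_measurable [measurable]: "decay \<in> borel_measurable borel"
  unfolding decay_def[abs_def] by measurable

lemma integrable_decay: "integrable lborel (decay :: real ^ 'n::finite \<Rightarrow> real)"
proof -
  let ?h = "\<lambda>t::real. inverse (1 + t\<^sup>2)"
  have "integrable lborel ?h"
    using integrable_inverse_1_plus_square by (simp add: set_integrable_def einterval_def)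
  then have fin: "(\<integral>\<^sup>+t. ?h t \<partial>lborel) < \<infinity>"
    by (simp add: integrable_iff_bounded)
  have le: "decay x \<le> (\<Prod>b\<in>Basis. ?h (x \<bullet> b))" for x :: "real ^ 'n"
  proof -
    have "(\<Prod>b\<in>(Basis :: (real^'n) set). 1 + (x \<bullet> b)\<^sup>2) \<le> (\<Prod>b\<in>(Basis :: (real^'n) set). (1 + norm x)\<^sup>2)"
    proof (intro prod_mono conjI)
      fix b :: "real ^ 'n" assume b: "b \<in> Basis"
      have "(x \<bullet> b)\<^sup>2 \<le> (norm x)\<^sup>2"
        using Basis_le_norm[OF b, of x] by (simp add: abs_le_square_iff[symmetric])
      then show "1 + (x \<bullet> b)\<^sup>2 \<le> (1 + norm x)\<^sup>2"
        using norm_ge_zero[of x] unfolding power2_sum by (simp del: norm_ge_zero)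
    qed (simp add: add_nonneg_nonneg)
    also have "\<dots> = (1 + norm x) ^ (2 * CARD('n))"
      by (simp add: power_mult)
    finally have *: "(\<Prod>b\<in>(Basis :: (real^'n) set). 1 + (x \<bullet> b)\<^sup>2) \<le> (1 + norm x) ^ (2 * CARD('n))" .
    have "0 < (\<Prod>b\<in>(Basis :: (real^'n) set). 1 + (x \<bullet> b)\<^sup>2)"
      by (intro prod_pos) (auto intro: add_pos_nonneg)
    from le_imp_inverse_le[OF * this] show ?thesis
      using prod_inversef[of "\<lambda>b. 1 + (x \<bullet> b)\<^sup>2" Basis] by (simp add: decay_def comp_def)
  qed
  have "(\<integral>\<^sup>+x. decay x \<partial>(lborel :: (real^'n) measure)) \<le>
      (\<integral>\<^sup>+x. (\<Prod>b\<in>Basis. ennreal (?h (x \<bullet> b))) \<partial>(lborel :: (real^'n) measure))"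
    using le by (intro nn_integral_mono) (auto simp: prod_ennreal intro!: ennreal_leI)
  also have "\<dots> = (\<Prod>b\<in>(Basis :: (real^'n) set). (\<integral>\<^sup>+t. ?h t \<partial>lborel))"
    by (rule nn_integral_lborel_prod) auto
  also have "\<dots> < \<infinity>"
    using fin by (simp add: power_less_top_ennreal)
  finally show ?thesis
    by (intro integrableI_bounded) (auto simp: abs_of_pos[OF decay_pos])
qed

lemma smooth_continuous: "smooth f \<Longrightarrow> continuous_on UNIV f"
  by (metis cdiff.simps(1) continuous_at_imp_continuous_on differentiable_imp_continuous_within)

lemma smooth_measurable: "smooth f \<Longrightarrow> f \<in> borel_measurable borel"
  using smooth_continuous borel_measurable_continuous_onI by blast

lemmas schwartz_measurable = smooth_measurable[OF schwartz_smooth]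
lemmas multiplier_measurable = smooth_measurable[OF multiplier_smooth]

lemma schwartz_le_decay:
  fixes g :: "real ^ 'n::finite \<Rightarrow> complex"
  assumes "g \<in> \<S>"
  shows "(1 + norm x) ^ k * norm (g x) \<le> schwartz_seminorm (2 * CARD('n) + k) g * decay x"
  using schwartz_seminorm_ge[OF assms, of "[]" "2 * CARD('n) + k" "2 * CARD('n) + k" x]
    decay_pos[of x] by (simp add: decay_def field_simps power_add)

lemma schwartz_weighted_integrable:
  fixes g :: "real ^ 'n::finite \<Rightarrow> complex"
  assumes g: "g \<in> \<S>"
  shows "integrable lborel (\<lambda>x. (1 + norm x) ^ k * norm (g x))"
proof (rule integrable_dominated)
  let ?K = "schwartz_seminorm (2 * CARD('n) + k) g"
  show "integrable lborel (\<lambda>x::real^'n. ?K * decay x)"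
    by (simp add: integrable_decay)
  show "(\<lambda>x. (1 + norm x) ^ k * norm (g x)) \<in> borel_measurable lborel"
    using schwartz_measurable[OF g] by measurable
  show "AE x in lborel. norm ((1 + norm x) ^ k * norm (g x)) \<le> norm (?K * decay x)"
    using schwartz_le_decay[OF g, of _ k]
    by (intro AE_I2) (smt (verit) norm_ge_zero real_norm_def zero_le_mult_iff zero_le_power)
qed

lemma schwartz_integrable:
  assumes g: "g \<in> \<S>"
  shows "integrable lborel g"
  by (rule integrable_dominated[OF schwartz_weighted_integrable[OF g, of 0]])
    (use schwartz_measurable[OF g] in auto)

section \<open>Characters and integration by parts\<close>

text \<open>Each derivative of a character is a constant multiple of it. Being a multiplier, it
  keeps its product with a Schwartz function in the Schwartz space, where integrals of derivatives
  vanish.\<close>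

lemma multiplier_cis: "(\<lambda>x. cis (- (x \<bullet> \<xi>))) \<in> schwartz_multipliers" (is ?M)
  and pd_cis: "pd i (\<lambda>x. cis (- (x \<bullet> \<xi>))) = (\<lambda>x. - (\<i> * complex_of_real (\<xi> $ i)) * cis (- (x \<bullet> \<xi>)))" (is ?P)
proof -
  let ?e = "\<lambda>x::real^'a. cis (- (x \<bullet> \<xi>))"
  have D: "(?e has_derivative (\<lambda>h. (- (h \<bullet> \<xi>)) *\<^sub>R (\<i> * cis (- (x \<bullet> \<xi>))))) (at x)" for x
  proof -
    have 1: "((\<lambda>x. - (x \<bullet> \<xi>)) has_derivative (\<lambda>h. - (h \<bullet> \<xi>))) (at x)"
      by (auto intro!: derivative_eq_intros)
    have 2: "(cis has_derivative (\<lambda>h. h *\<^sub>R (\<i> * cis t))) (at t)" for t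
    proof -
      have "((\<lambda>t. cos t + \<i> * sin t) has_derivative (\<lambda>h. h *\<^sub>R (\<i> * cis t))) (at t)"
        by (auto intro!: derivative_eq_intros simp: fun_eq_iff complex_eq_iff)
      moreover have "(\<lambda>t. complex_of_real (cos t) + \<i> * complex_of_real (sin t)) = cis"
        by (auto simp: fun_eq_iff complex_eq_iff)
      ultimately show ?thesis by simp
    qed
    show ?thesis by (rule has_derivative_compose[OF 1 2])
  qed
  have pd: "pd i ?e = (\<lambda>x. (- \<i> * complex_of_real (\<xi> $ i)) * ?e x)" for i
    using pd_eqI[OF D] by (auto simp: inner_axis' scaleR_conv_of_real)
  have pg: "poly_growth ?e"
    unfolding poly_growth_def by (intro exI[of _ 1] exI[of _ 0]) simp
  have "cdiff poly_growth N ?e" for N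
  proof (induction N)
    case 0
    show ?case using D pg by (auto simp: differentiable_def)
  next
    case (Suc N)
    have "cdiff poly_growth N (pd i ?e)" for i
      unfolding pd
      by (rule cdiff_mult[of poly_growth poly_growth poly_growth])
        (auto intro: Suc cdiff_const poly_growth_const poly_growth_mult poly_growth_add)
    then show ?case using D pg by (auto simp: differentiable_def)
  qed
  then show ?M by (simp add: schwartz_multipliers_def)
  show ?P using pd[of i] by simp
qed

lemma has_derivative_along_line:
  assumes "smooth f"
  shows "((\<lambda>s. f (x + s *\<^sub>R axis i 1)) has_derivative (\<lambda>h. h *\<^sub>R pd i f (x + s *\<^sub>R axis i 1))) (at s)"
proof -
  let ?D = "frechet_derivative f (at (x + s *\<^sub>R axis i 1))"
  have D: "(f has_derivative ?D) (at (x + s *\<^sub>R axis i 1))"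
    using cdiffD(1)[of "\<lambda>_. True" 0 f] assms unfolding frechet_derivative_works by blast
  have "((\<lambda>s. x + s *\<^sub>R axis i 1) has_derivative (\<lambda>h. h *\<^sub>R axis i 1)) (at s)"
    by (auto intro!: derivative_eq_intros)
  from has_derivative_compose[OF this D] show ?thesis
    using linear_cmul[OF has_derivative_linear[OF D]] by (simp add: pd_def)
qed

lemma pd_limit_difference_quotient:
  assumes "smooth f"
  shows "(\<lambda>m. real (Suc m) *\<^sub>R (f (x + inverse (real (Suc m)) *\<^sub>R axis i 1) - f x)) \<longlonglongrightarrow> pd i f x"
proof -
  have "((\<lambda>s. f (x + s *\<^sub>R axis i 1)) has_vector_derivative pd i f x) (at 0)"
    using has_derivative_along_line[OF assms, of x i 0] by (simp add: has_vector_derivative_def)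
  then have "((\<lambda>s. (f (x + s *\<^sub>R axis i 1) - f x) /\<^sub>R s) \<longlongrightarrow> pd i f x) (at 0)"
    unfolding has_vector_derivative_def has_derivative_at
  proof (elim conjE, intro LIM_zero_cancel[where l = "pd i f x"] tendsto_norm_zero_cancel[where f = "\<lambda>s. (f (x + s *\<^sub>R axis i 1) - f x) /\<^sub>R s - pd i f x"])
    assume *: "(\<lambda>h. norm (f (x + (0 + h) *\<^sub>R axis i 1) - f (x + 0 *\<^sub>R axis i 1) - h *\<^sub>R pd i f x) / norm h) \<midarrow>0\<rightarrow> 0"
    show "(\<lambda>s. norm ((f (x + s *\<^sub>R axis i 1) - f x) /\<^sub>R s - pd i f x)) \<midarrow>0\<rightarrow> 0"
    proof (rule Lim_transform_eventually[OF *])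
      show "\<forall>\<^sub>F h in at 0. norm (f (x + (0 + h) *\<^sub>R axis i 1) - f (x + 0 *\<^sub>R axis i 1) - h *\<^sub>R pd i f x) / norm h =
          norm ((f (x + h *\<^sub>R axis i 1) - f x) /\<^sub>R h - pd i f x)"
        unfolding eventually_at
      proof (intro exI[of _ 1] conjI ballI impI)
        fix h :: real assume "h \<noteq> 0 \<and> dist h 0 < 1"
        then have h: "h \<noteq> 0" by simp
        then have "(f (x + h *\<^sub>R axis i 1) - f x) /\<^sub>R h - pd i f x =
            (f (x + (0 + h) *\<^sub>R axis i 1) - f (x + 0 *\<^sub>R axis i 1) - h *\<^sub>R pd i f x) /\<^sub>R h"
          by (simp add: scaleR_diff_right)
        then show "norm (f (x + (0 + h) *\<^sub>R axis i 1) - f (x + 0 *\<^sub>R axis i 1) - h *\<^sub>R pd i f x) / norm h =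
            norm ((f (x + h *\<^sub>R axis i 1) - f x) /\<^sub>R h - pd i f x)"
          by (simp add: divide_inverse mult.commute)
      qed simp
    qed
  qed
  moreover have "filterlim (\<lambda>m. inverse (real (Suc m))) (at 0) sequentially"
    using LIMSEQ_inverse_real_of_nat by (intro filterlim_atI) auto
  ultimately have "(\<lambda>m. (f (x + inverse (real (Suc m)) *\<^sub>R axis i 1) - f x) /\<^sub>R inverse (real (Suc m))) \<longlonglongrightarrow> pd i f x"
    by (rule filterlim_compose)
  then show ?thesis by simp
qed

text \<open>Translation invariance: each difference quotient of \<open>f\<close> has integral \<open>0\<close>.\<close>

lemma integral_pd_eq_0:
  fixes f :: "real ^ 'n::finite \<Rightarrow> complex"
  assumes f: "f \<in> \<S>"
  shows "(LINT x|lborel. pd i f x) = 0"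
proof -
  let ?e = "axis i (1::real)"
  define q where "q m x = real (Suc m) *\<^sub>R (f (x + inverse (real (Suc m)) *\<^sub>R ?e) - f x)" for m x
  note fm[measurable] = schwartz_measurable[OF f]
  have int: "integrable lborel (\<lambda>x. f (x + v))" "(LINT x|lborel. f (x + v)) = integral\<^sup>L lborel f" for v
    using integrable_lborel_affine[OF schwartz_integrable[OF f], of 1 v]
      integral_lborel_affine[OF fm, of 1 v] by (simp_all add: add.commute)
  have q0: "(LINT x|lborel. q m x) = 0" for m
    unfolding q_def using int schwartz_integrable[OF f] by simp
  define K where "K = schwartz_seminorm (2 * CARD('n)) (pd i f)"
  have K: "norm (pd i f x) \<le> K * decay x" for x
    unfolding K_def using schwartz_le_decay[OF schwartz_pd[OF f], of x 0] by simp
  have K0: "K \<ge> 0"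
    unfolding K_def by (rule schwartz_seminorm_nonneg[OF schwartz_pd[OF f]])
  \<comment> \<open>A shift of length at most 1 changes 1 + |x| by a factor at most 2, so one
    multiple of \<open>decay x\<close> dominates the derivative along all the segments at
    once.\<close>
  have shift: "decay (x + s *\<^sub>R ?e) \<le> 2 ^ (2 * CARD('n)) * decay x" if "0 \<le> s" "s \<le> 1" for s and x :: "real^'n"
  proof -
    have "norm x \<le> norm (x + s *\<^sub>R ?e) + norm (s *\<^sub>R ?e)"
      using norm_triangle_ineq4[of "x + s *\<^sub>R ?e" "s *\<^sub>R ?e"] by simp
    then have "1 + norm x \<le> 2 * (1 + norm (x + s *\<^sub>R ?e))"
      using that norm_ge_zero[of "x + s *\<^sub>R ?e"] by (simp add: norm_axis_1 del: norm_ge_zero)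
    then have "(1 + norm x) ^ (2 * CARD('n)) \<le> 2 ^ (2 * CARD('n)) * (1 + norm (x + s *\<^sub>R ?e)) ^ (2 * CARD('n))"
      unfolding power_mult_distrib[symmetric] by (intro power_mono) auto
    moreover have "(1 + norm y) ^ m > 0" for m and y :: "real^'n"
      by (intro zero_less_power add_pos_nonneg) auto
    ultimately show ?thesis
      unfolding decay_def by (simp add: field_simps)
  qed
  have bound: "norm (q m x) \<le> K * (2 ^ (2 * CARD('n)) * decay x)" for m x
  proof -
    define r where "r = inverse (real (Suc m))"
    have r: "0 < r" "r \<le> 1" unfolding r_def by (auto simp: field_simps)
    \<comment> \<open>The mean value inequality trades the difference quotient for the derivative at
      an intermediate point, which \<open>K\<close> and \<open>shift\<close> control.\<close>
    have "\<exists>s\<in>{0<..<r}. norm (f (x + r *\<^sub>R ?e) - f (x + 0 *\<^sub>R ?e)) \<le>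
        norm ((r - 0) *\<^sub>R pd i f (x + s *\<^sub>R ?e))"
      using has_derivative_along_line[OF schwartz_smooth[OF f]] r
      by (intro mvt_general[of 0 r "\<lambda>s. f (x + s *\<^sub>R ?e)"] continuous_at_imp_continuous_on ballI)
        (auto intro: has_derivative_continuous)
    then obtain s where s: "0 < s" "s < r" "norm (f (x + r *\<^sub>R ?e) - f x) \<le> r * norm (pd i f (x + s *\<^sub>R ?e))"
      using r by auto
    have "norm (q m x) = norm (f (x + r *\<^sub>R ?e) - f x) / r"
      unfolding q_def r_def norm_scaleR by (simp add: divide_inverse mult.commute)
    also have "\<dots> \<le> norm (pd i f (x + s *\<^sub>R ?e))"
      using s r by (simp add: field_simps)
    also have "\<dots> \<le> K * decay (x + s *\<^sub>R ?e)" by (rule K)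
    also have "\<dots> \<le> K * (2 ^ (2 * CARD('n)) * decay x)"
      using s r by (intro mult_left_mono shift K0) auto
    finally show ?thesis .
  qed
  have "(\<lambda>m. LINT x|lborel. q m x) \<longlonglongrightarrow> (LINT x|lborel. pd i f x)"
  proof (rule integral_dominated_convergence)
    show "integrable lborel (\<lambda>x. K * (2 ^ (2 * CARD('n)) * decay x) :: real)"
      by (simp add: integrable_decay)
    show "AE x in lborel. (\<lambda>m. q m x) \<longlonglongrightarrow> pd i f x"
      unfolding q_def using pd_limit_difference_quotient[OF schwartz_smooth[OF f]] by simp
    show "pd i f \<in> borel_measurable lborel"
      using schwartz_measurable[OF schwartz_pd[OF f]] by simp
    show "q m \<in> borel_measurable lborel" for m
      unfolding q_def[abs_def] by measurable
  qed (use bound in auto)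
  then show ?thesis
    unfolding q0 by (simp add: LIMSEQ_const_iff)
qed

subsection \<open>The Fourier transform on the Schwartz space\<close>

text \<open>The constant depends on the dimension alone, which is passed as a type.\<close>

abbreviation (input) fconst :: "'n::finite itself \<Rightarrow> complex" where
  "fconst t \<equiv> complex_of_real ((2 * pi) powr (- real CARD('n) / 2))"

lemma integrable_cis_mult:
  fixes g :: "real ^ 'n::finite \<Rightarrow> complex"
  assumes "integrable lborel g"
  shows "integrable lborel (\<lambda>x. cis (- (x \<bullet> \<xi>)) * g x)"
  by (rule integrable_dominated[OF assms])
    (use assms in \<open>auto simp: norm_mult cis_conv_exp\<close>)

lemma norm_integral_cis_le:
  fixes g :: "real ^ 'n::finite \<Rightarrow> complex"
  shows "norm (LINT x|lborel. cis (- (x \<bullet> \<xi>)) * g x) \<le> (LINT x|lborel. norm (g x))"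
  using integral_norm_bound[of lborel "\<lambda>x. cis (- (x \<bullet> \<xi>)) * g x"] by (simp add: norm_mult)

lemma fourier_bound:
  "\<exists>K\<ge>0. \<forall>g\<in>\<S>. \<forall>\<xi>::real^'n::finite.
     norm (fourier g \<xi>) \<le> K * schwartz_seminorm (2 * CARD('n)) g"
proof (intro exI conjI ballI allI)
  let ?K = "norm (fconst TYPE('n)) * (LINT x|lborel. decay (x::real^'n))"
  show "?K \<ge> 0"
    by (intro mult_nonneg_nonneg Bochner_Integration.integral_nonneg) (auto simp: less_imp_le[OF decay_pos])
  fix g and \<xi> :: "real ^ 'n" assume g: "g \<in> (\<S> :: (real ^ 'n \<Rightarrow> complex) set)"
  have "(LINT x|lborel. norm (g x)) \<le> (LINT x|lborel. schwartz_seminorm (2 * CARD('n)) g * decay (x :: real^'n))"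
    using schwartz_le_decay[OF g, of _ 0] schwartz_integrable[OF g]
    by (intro integral_mono) (auto simp: integrable_decay)
  then have "norm (LINT x|lborel. cis (- (x \<bullet> \<xi>)) * g x) \<le>
      schwartz_seminorm (2 * CARD('n)) g * (LINT x|lborel. decay (x::real^'n))"
    using norm_integral_cis_le[of \<xi> g] by simp
  from mult_left_mono[OF this, of "norm (fconst TYPE('n))"]
  show "norm (fourier g \<xi>) \<le> ?K * schwartz_seminorm (2 * CARD('n)) g"
    by (simp add: fourier_def norm_mult mult_ac)
qed

lemma fourier_add:
  "integrable lborel f \<Longrightarrow> integrable lborel g \<Longrightarrow>
    fourier (\<lambda>x. f x + g x) = (\<lambda>\<xi>. fourier f \<xi> + fourier g \<xi>)"
  unfolding fourier_def
  by (simp add: distrib_left Bochner_Integration.integral_add integrable_cis_mult)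

lemma fourier_cmult: "fourier (\<lambda>x. c * g x) = (\<lambda>\<xi>. c * fourier g \<xi>)"
  unfolding fourier_def by (simp add: mult.left_commute[of _ c])

lemma cis_remainder: "norm (cis t - 1 - \<i> * complex_of_real t) \<le> t\<^sup>2"
proof -
  have "norm (cis t - 1 - \<i> * complex_of_real t) \<le> \<bar>t\<bar> ^ 2 / 2"
    using iexp_approx1[of t 1] by (simp add: cis_conv_exp diff_diff_eq numeral_2_eq_2)
  also have "\<dots> \<le> t\<^sup>2" by simp
  finally show ?thesis .
qed

text \<open>The first-order Taylor remainder of the character is at most the square of the inner
  product of \<open>x\<close> and \<open>h\<close>, and \<open>g\<close> has a finite integral
  against \<open>(1 + norm x) ^ 2\<close>; so the remainder of the transform is O(|h|^2). The same
  weighted integral bounds the derivative as a linear map.\<close>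

lemma fourier_has_derivative:
  fixes g :: "real ^ 'n::finite \<Rightarrow> complex"
  assumes g: "g \<in> \<S>"
  shows "(fourier g has_derivative
    (\<lambda>h. fconst TYPE('n) * (LINT x|lborel. cis (- (x \<bullet> \<xi>)) * (- \<i> * complex_of_real (x \<bullet> h) * g x)))) (at \<xi>)"
    (is "(_ has_derivative ?D) _")
proof -
  note gm[measurable] = schwartz_measurable[OF g]
  let ?c = "fconst TYPE('n)"
  let ?I = "LINT x|lborel. (1 + norm x) ^ 2 * norm (g x)"
  have w: "integrable lborel (\<lambda>x. (1 + norm x) ^ 2 * norm (g x))"
    by (rule schwartz_weighted_integrable[OF g])
  have xh: "\<bar>x \<bullet> h\<bar> \<le> norm h * (1 + norm x) ^ 2" for x h :: "real ^ 'n"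
  proof -
    have "\<bar>x \<bullet> h\<bar> \<le> norm x * norm h" by (rule Cauchy_Schwarz_ineq2)
    also have "\<dots> \<le> (1 + norm x) ^ 2 * norm h"
      by (intro mult_right_mono) (auto simp: power2_sum intro: add_increasing)
    finally show ?thesis by (simp add: mult.commute)
  qed
  have int: "integrable lborel (\<lambda>x. cis (- (x \<bullet> \<xi>)) * (- \<i> * complex_of_real (x \<bullet> h) * g x))" for h
  proof (intro integrable_cis_mult integrable_dominated[OF integrable_mult_right[OF w, of "norm h"]] AE_I2)
    fix x
    have "\<bar>x \<bullet> h\<bar> * norm (g x) \<le> (norm h * (1 + norm x) ^ 2) * norm (g x)"
      by (intro mult_right_mono xh) auto
    then show "norm (- \<i> * complex_of_real (x \<bullet> h) * g x) \<le> norm (norm h * ((1 + norm x)\<^sup>2 * norm (g x)))"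
      by (simp add: norm_mult abs_mult mult_ac)
  qed measurable
  have bl: "bounded_linear ?D"
  proof (rule bounded_linear_intro)
    fix h k :: "real ^ 'n"
    have "(\<lambda>x. cis (- (x \<bullet> \<xi>)) * (- \<i> * complex_of_real (x \<bullet> (h + k)) * g x)) =
      (\<lambda>x. cis (- (x \<bullet> \<xi>)) * (- \<i> * complex_of_real (x \<bullet> h) * g x) +
        cis (- (x \<bullet> \<xi>)) * (- \<i> * complex_of_real (x \<bullet> k) * g x))"
      by (auto simp: inner_add_right algebra_simps)
    then show "?D (h + k) = ?D h + ?D k"
      by (simp only: Bochner_Integration.integral_add[OF int[of h] int[of k]] distrib_left)
  next
    fix r and h :: "real ^ 'n"
    have "(\<lambda>x. cis (- (x \<bullet> \<xi>)) * (- \<i> * complex_of_real (x \<bullet> (r *\<^sub>R h)) * g x)) =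
      (\<lambda>x. r *\<^sub>R (cis (- (x \<bullet> \<xi>)) * (- \<i> * complex_of_real (x \<bullet> h) * g x)))"
      by (simp only: inner_scaleR_right) (auto simp: scaleR_conv_of_real)
    then show "?D (r *\<^sub>R h) = r *\<^sub>R ?D h"
      by (simp only: integral_scaleR_right mult_scaleR_right)
  next
    fix h :: "real ^ 'n"
    have "norm (LINT x|lborel. cis (- (x \<bullet> \<xi>)) * (- \<i> * complex_of_real (x \<bullet> h) * g x)) \<le>
        (LINT x|lborel. norm h * ((1 + norm x) ^ 2 * norm (g x)))"
    proof (rule order_trans[OF integral_norm_bound integral_mono])
      fix x
      have "\<bar>x \<bullet> h\<bar> * norm (g x) \<le> (norm h * (1 + norm x) ^ 2) * norm (g x)"
        by (intro mult_right_mono xh) auto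
      then show "norm (cis (- (x \<bullet> \<xi>)) * (- \<i> * complex_of_real (x \<bullet> h) * g x)) \<le> norm h * ((1 + norm x)\<^sup>2 * norm (g x))"
        by (simp add: norm_mult mult_ac)
    qed (use int[of h] w in auto)
    then show "norm (?D h) \<le> norm h * (norm ?c * ?I)"
      using mult_left_mono[of _ _ "norm ?c"] by (fastforce simp: norm_mult mult_ac)
  qed
  have rem: "norm (fourier g \<eta> - fourier g \<xi> - ?D (\<eta> - \<xi>)) \<le> (norm ?c * ?I) * (norm (\<eta> - \<xi>))\<^sup>2" for \<eta>
  proof -
    let ?h = "\<eta> - \<xi>"
    let ?r = "\<lambda>x. cis (- (x \<bullet> \<xi>)) * (cis (- (x \<bullet> ?h)) - 1 - \<i> * complex_of_real (- (x \<bullet> ?h))) * g x"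
    have req: "?r x = cis (- (x \<bullet> \<eta>)) * g x - cis (- (x \<bullet> \<xi>)) * g x
        - cis (- (x \<bullet> \<xi>)) * (- \<i> * complex_of_real (x \<bullet> ?h) * g x)" for x
    proof -
      have "cis (- (x \<bullet> \<eta>)) = cis (- (x \<bullet> \<xi>)) * cis (- (x \<bullet> ?h))"
        by (simp add: cis_mult inner_diff_right)
      then show ?thesis by (simp add: algebra_simps)
    qed
    note i1 = integrable_cis_mult[OF schwartz_integrable[OF g]]
    have "fourier g \<eta> - fourier g \<xi> - ?D ?h = ?c * (LINT x|lborel. ?r x)"
      unfolding fourier_def req
      using i1[of \<eta>] i1[of \<xi>] int[of ?h]
      by (subst Bochner_Integration.integral_diff, simp, simp,
          subst Bochner_Integration.integral_diff, simp, simp) (simp only: right_diff_distrib)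
    moreover
    have "norm (LINT x|lborel. ?r x) \<le> (LINT x|lborel. (norm ?h)\<^sup>2 * ((1 + norm x) ^ 2 * norm (g x)))"
    proof (rule order_trans[OF integral_norm_bound integral_mono])
      have "integrable lborel ?r"
        unfolding req using i1[of \<eta>] i1[of \<xi>] int[of ?h] by (intro Bochner_Integration.integrable_diff)
      then show "integrable lborel (\<lambda>x. norm (?r x))" by (rule integrable_norm)
      show "integrable lborel (\<lambda>x. (norm ?h)\<^sup>2 * ((1 + norm x) ^ 2 * norm (g x)))"
        using w by simp
      fix x
      have "norm (cis (- (x \<bullet> ?h)) - 1 - \<i> * complex_of_real (- (x \<bullet> ?h))) \<le> (- (x \<bullet> ?h))\<^sup>2"
        by (rule cis_remainder)
      also have "\<dots> = \<bar>x \<bullet> ?h\<bar>\<^sup>2" by simp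
      also have "\<dots> \<le> (norm x * norm ?h)\<^sup>2"
        by (intro power_mono Cauchy_Schwarz_ineq2) auto
      also have "\<dots> \<le> ((1 + norm x) * norm ?h)\<^sup>2"
        by (intro power_mono mult_right_mono) auto
      finally have "norm (cis (- (x \<bullet> ?h)) - 1 - \<i> * complex_of_real (- (x \<bullet> ?h))) * norm (g x) \<le>
          ((1 + norm x) * norm ?h)\<^sup>2 * norm (g x)"
        by (rule mult_right_mono) auto
      then show "norm (?r x) \<le> (norm ?h)\<^sup>2 * ((1 + norm x) ^ 2 * norm (g x))"
        by (simp add: norm_mult power_mult_distrib mult_ac)
    qed
    then have "norm (LINT x|lborel. ?r x) \<le> (norm ?h)\<^sup>2 * ?I"
      by (simp only: integral_mult_right_zero)
    from mult_left_mono[OF this norm_ge_zero[of ?c]]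
    have "norm (?c * (LINT x|lborel. ?r x)) \<le> (norm ?c * ?I) * (norm ?h)\<^sup>2"
      by (simp only: norm_mult mult_ac)
    ultimately show ?thesis by (simp only:)
  qed
  show ?thesis
  proof (rule has_derivativeI_sandwich[where e = 1, OF _ bl])
    show "((\<lambda>\<eta>. (norm ?c * ?I) * norm (\<eta> - \<xi>)) \<longlongrightarrow> 0) (at \<xi>)"
      by (auto intro!: tendsto_eq_intros)
    fix \<eta> :: "real ^ 'n" assume "\<eta> \<noteq> \<xi>"
    then show "norm (fourier g \<eta> - fourier g \<xi> - ?D (\<eta> - \<xi>)) / norm (\<eta> - \<xi>) \<le> (norm ?c * ?I) * norm (\<eta> - \<xi>)"
      using rem[of \<eta>] by (simp add: divide_le_eq power2_eq_square mult.assoc)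
  qed simp
qed

text \<open>The Fourier dual of a partial derivative; the factor \<open>- \<i>\<close> comes from
  differentiating the kernel in \<xi>.\<close>

definition coord_mult :: "'n::finite \<Rightarrow> (real ^ 'n \<Rightarrow> complex) \<Rightarrow> real ^ 'n \<Rightarrow> complex" where
  "coord_mult i g = (\<lambda>x. (- \<i> * complex_of_real (x $ i)) * g x)"

lemma schwartz_continuous_coord_mult: "schwartz_continuous (coord_mult i)"
  unfolding coord_mult_def[abs_def]
  by (rule schwartz_continuous_mult[OF multiplier_coord])

lemma schwartz_coord_mult: "g \<in> \<S> \<Longrightarrow> coord_mult i g \<in> \<S>"
  using schwartz_continuous_coord_mult by (auto simp: schwartz_continuous_def)

lemma pd_fourier: "g \<in> \<S> \<Longrightarrow> pd i (fourier g) = fourier (coord_mult i g)"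
  using pd_eqI[OF fourier_has_derivative]
  by (auto simp: fourier_def coord_mult_def inner_axis mult.assoc fun_eq_iff)

lemma smooth_fourier:
  assumes "g \<in> \<S>"
  shows "smooth (fourier g)"
proof -
  have "pderivs \<alpha> (fourier g) differentiable (at x)" for \<alpha> x
    using assms
  proof (induction \<alpha> arbitrary: g rule: rev_induct)
    case Nil
    then show ?case using fourier_has_derivative unfolding differentiable_def by fastforce
  next
    case (snoc i \<alpha>)
    then show ?case
      by (simp add: pderivs_snoc pd_fourier schwartz_coord_mult)
  qed
  then show ?thesis by (simp add: smooth_iff)
qed

text \<open>The integral of the derivative of character times \<open>g\<close> vanishes; the product
  rule turns this into the identity.\<close>

lemma fourier_pd:
  fixes g :: "real ^ 'n::finite \<Rightarrow> complex"
  assumes g: "g \<in> \<S>"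
  shows "fourier (pd i g) \<xi> = \<i> * complex_of_real (\<xi> $ i) * fourier g \<xi>"
proof -
  let ?e = "\<lambda>x. cis (- (x \<bullet> \<xi>))"
  have e: "?e \<in> schwartz_multipliers" by (rule multiplier_cis)
  have "pd i (\<lambda>x. ?e x * g x) = (\<lambda>x. pd i ?e x * g x + ?e x * pd i g x)"
    by (rule pd_smooth_mult[OF multiplier_smooth[OF e] schwartz_smooth[OF g]])
  also have "\<dots> = (\<lambda>x. - (\<i> * complex_of_real (\<xi> $ i)) * (?e x * g x) + ?e x * pd i g x)"
    by (simp add: pd_cis mult.assoc)
  finally have "(LINT x|lborel. - (\<i> * complex_of_real (\<xi> $ i)) * (?e x * g x) + ?e x * pd i g x) = 0"
    using integral_pd_eq_0[OF schwartz_mult[OF e g], of i] by simp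
  then have "- (\<i> * complex_of_real (\<xi> $ i)) * (LINT x|lborel. ?e x * g x) + (LINT x|lborel. ?e x * pd i g x) = 0"
    using integrable_cis_mult[OF schwartz_integrable[OF g], of \<xi>]
      integrable_cis_mult[OF schwartz_integrable[OF schwartz_pd[OF g, of i]], of \<xi>]
    by (subst (asm) Bochner_Integration.integral_add) auto
  then have "(LINT x|lborel. ?e x * pd i g x) = \<i> * complex_of_real (\<xi> $ i) * (LINT x|lborel. ?e x * g x)"
    by (simp add: algebra_simps)
  then show ?thesis
    unfolding fourier_def by simp
qed

text \<open>The norm of \<xi> is at most the sum of its coordinates in modulus, and a coordinate
  times the transform is, up to a factor of modulus 1, the transform of a derivative; so each power
  of the weight costs one more derivative of \<open>g\<close>.\<close>

lemma fourier_weighted_bound: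
  "\<exists>M C. C \<ge> 0 \<and> (\<forall>g\<in>\<S>. \<forall>\<xi>::real^'n::finite.
     (1 + norm \<xi>) ^ N * norm (fourier g \<xi>) \<le> C * schwartz_seminorm M g)"
proof (induction N)
  case 0
  then show ?case using fourier_bound[where 'n = 'n] unfolding power_0 mult_1 by blast
next
  case (Suc N)
  then obtain M C where C: "C \<ge> 0" "\<And>g \<xi>. g \<in> \<S> \<Longrightarrow>
      (1 + norm (\<xi>::real^'n)) ^ N * norm (fourier g \<xi>) \<le> C * schwartz_seminorm M g"
    by blast
  have "(1 + norm \<xi>) ^ Suc N * norm (fourier g \<xi>) \<le> (C * (1 + CARD('n))) * schwartz_seminorm (Suc M) g"
    if g: "g \<in> \<S>" for g and \<xi> :: "real ^ 'n"
  proof -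
    have pdle: "schwartz_seminorm M (pd i g) \<le> schwartz_seminorm (Suc M) g" for i
      by (rule schwartz_seminorm_le, subst pderivs_snoc[symmetric])
        (rule schwartz_seminorm_ge, use g in auto)
    have "(1 + norm \<xi>) ^ Suc N * norm (fourier g \<xi>) = (1 + norm \<xi>) * ((1 + norm \<xi>) ^ N * norm (fourier g \<xi>))"
      by simp
    also have "\<dots> \<le> (1 + (\<Sum>i\<in>UNIV. \<bar>\<xi> $ i\<bar>)) * ((1 + norm \<xi>) ^ N * norm (fourier g \<xi>))"
      by (intro mult_right_mono add_left_mono norm_le_l1_cart) auto
    also have "\<dots> = (1 + norm \<xi>) ^ N * norm (fourier g \<xi>) +
        (\<Sum>i\<in>UNIV. (1 + norm \<xi>) ^ N * norm (fourier (pd i g) \<xi>))"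
      by (simp add: ring_distribs sum_distrib_left sum_distrib_right fourier_pd[OF g] norm_mult mult_ac)
    also have "\<dots> \<le> C * schwartz_seminorm (Suc M) g + (\<Sum>i::'n\<in>UNIV. C * schwartz_seminorm (Suc M) g)"
      by (intro add_mono sum_mono order_trans[OF C(2)] mult_left_mono C g schwartz_pd pdle
          schwartz_seminorm_mono) auto
    finally show ?thesis by (simp add: algebra_simps)
  qed
  then show ?case using C(1) by (intro exI[of _ "Suc M"] exI[of _ "C * (1 + CARD('n))"]) auto
qed

text \<open>Derivatives of the transform become coordinate multiplications of \<open>g\<close>,
  which are continuous. The induction from the right meets the derivative next to the transform
  first.\<close>

lemma fourier_pderivs_bound:
  "\<exists>M C. C \<ge> 0 \<and> (\<forall>g\<in>\<S>. \<forall>\<xi>::real^'n::finite.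
     (1 + norm \<xi>) ^ N * norm (pderivs \<alpha> (fourier g) \<xi>) \<le> C * schwartz_seminorm M g)"
proof (induction \<alpha> rule: rev_induct)
  case Nil
  then show ?case using fourier_weighted_bound by simp
next
  case (snoc i \<alpha>)
  then obtain M C where C: "C \<ge> 0" "\<And>g \<xi>. g \<in> \<S> \<Longrightarrow>
      (1 + norm (\<xi>::real^'n)) ^ N * norm (pderivs \<alpha> (fourier g) \<xi>) \<le> C * schwartz_seminorm M g"
    by blast
  obtain L D where D: "D \<ge> 0" "\<And>g. g \<in> \<S> \<Longrightarrow>
      schwartz_seminorm M (coord_mult i g) \<le> D * schwartz_seminorm L g"
    using schwartz_continuousE[OF schwartz_continuous_coord_mult[of i]] by metis
  have "(1 + norm \<xi>) ^ N * norm (pderivs (\<alpha> @ [i]) (fourier g) \<xi>) \<le> (C * D) * schwartz_seminorm L g"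
    if g: "g \<in> \<S>" for g and \<xi> :: "real ^ 'n"
    unfolding pderivs_snoc pd_fourier[OF g] mult.assoc
    by (rule order_trans[OF C(2)[OF schwartz_coord_mult[OF g]] mult_left_mono[OF D(2)[OF g] C(1)]])
  then show ?case using C(1) D(1) by (intro exI[of _ L] exI[of _ "C * D"]) auto
qed

lemma schwartz_continuous_fourier:
  "schwartz_continuous (fourier :: (real ^ 'n::finite \<Rightarrow> complex) \<Rightarrow> _)"
  unfolding schwartz_continuous_def
proof (intro conjI allI ballI)
  fix g :: "real ^ 'n \<Rightarrow> complex" assume g: "g \<in> \<S>"
  have "\<exists>C. \<forall>x. (1 + norm x) ^ k * norm (pderivs \<alpha> (fourier g) x) \<le> C" for k \<alpha>
    using fourier_pderivs_bound[of k \<alpha>] g by blast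
  then show "fourier g \<in> \<S>"
    using smooth_fourier[OF g, unfolded smooth_iff] unfolding schwartz_space_def by blast
next
  fix N
  have "\<forall>\<alpha>. \<exists>M C. C \<ge> 0 \<and> (\<forall>g\<in>\<S>. \<forall>\<xi>::real^'n.
     (1 + norm \<xi>) ^ N * norm (pderivs \<alpha> (fourier g) \<xi>) \<le> C * schwartz_seminorm M g)"
    by (intro allI fourier_pderivs_bound)
  then obtain M C where C: "\<And>\<alpha>. C \<alpha> \<ge> 0" "\<And>\<alpha> g \<xi>. g \<in> \<S> \<Longrightarrow>
     (1 + norm \<xi>) ^ N * norm (pderivs \<alpha> (fourier g) (\<xi>::real^'n)) \<le> C \<alpha> * schwartz_seminorm (M \<alpha>) g"
    by metis
  obtain C' M' where C': "\<And>\<alpha>. length \<alpha> \<le> N \<Longrightarrow> C \<alpha> \<le> C'" "\<And>\<alpha>. length \<alpha> \<le> N \<Longrightarrow> M \<alpha> \<le> M'"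
    using uniform_bound[of N C] uniform_bound[of N M] by metis
  have C'0: "C' \<ge> 0" using C'(1)[of "[]"] C(1)[of "[]"] by simp
  have "schwartz_seminorm N (fourier g) \<le> C' * schwartz_seminorm M' g"
    if g: "g \<in> \<S>" for g :: "real ^ 'n \<Rightarrow> complex"
    by (rule schwartz_seminorm_le, rule order_trans[OF C(2)[OF g] mult_mono])
      (auto intro: C' C'0 schwartz_seminorm_mono schwartz_seminorm_nonneg g)
  then show "\<exists>M C. \<forall>g\<in>\<S>. schwartz_seminorm N (fourier (g :: real ^ 'n \<Rightarrow> complex)) \<le> C * schwartz_seminorm M g"
    by blast
qed

lemma schwartz_fourier: "g \<in> \<S> \<Longrightarrow> fourier g \<in> \<S>"
  using schwartz_continuous_fourier by (auto simp: schwartz_continuous_def)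

subsection \<open>Fourier inversion and the Plancherel identity\<close>

text \<open>Fubini and the symmetry of the kernel. It is stated for integrable functions so that it
  applies directly to modulated Gaussians.\<close>

lemma fourier_mult_formula:
  fixes f h :: "real ^ 'n::finite \<Rightarrow> complex"
  assumes f: "integrable lborel f" and h: "integrable lborel h"
  shows "(LINT x|lborel. fourier f x * h x) = (LINT x|lborel. f x * fourier h x)"
proof -
  let ?k = "\<lambda>x \<xi>. cis (- (x \<bullet> \<xi>)) * f x * h \<xi>"
  have [measurable]: "f \<in> borel_measurable borel" "h \<in> borel_measurable borel"
    using f h by auto
  have [measurable]: "(\<lambda>(x, \<xi>). cis (- (x \<bullet> \<xi>))) \<in>
      borel_measurable (borel \<Otimes>\<^sub>M (borel :: (real^'n) measure))"
    unfolding cis_conv_exp by measurable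
  have "integrable (lborel \<Otimes>\<^sub>M lborel) (\<lambda>(x, \<xi>). ?k x \<xi>)"
  proof (rule lborel_pair.Fubini_integrable)
    show "(\<lambda>(x, \<xi>). ?k x \<xi>) \<in> borel_measurable (lborel \<Otimes>\<^sub>M lborel)"
      by measurable
    show "integrable lborel (\<lambda>x. LINT \<xi>|lborel. norm (case (x, \<xi>) of (x, \<xi>) \<Rightarrow> ?k x \<xi>))"
      using f by (simp add: norm_mult)
    show "AE x in lborel. integrable lborel (\<lambda>\<xi>. case (x, \<xi>) of (x, \<xi>) \<Rightarrow> ?k x \<xi>)"
    proof (intro AE_I2, simp)
      fix x
      have "integrable lborel (\<lambda>\<xi>. f x * (cis (- (\<xi> \<bullet> x)) * h \<xi>))"
        by (intro integrable_mult_right integrable_cis_mult h)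
      then show "integrable lborel (\<lambda>\<xi>. ?k x \<xi>)"
        by (simp add: inner_commute mult_ac)
    qed
  qed
  from lborel_pair.Fubini_integral[OF this]
  have *: "(LINT \<xi>|lborel. (LINT x|lborel. ?k x \<xi>)) = (LINT x|lborel. (LINT \<xi>|lborel. ?k x \<xi>))" .
  have "(LINT \<xi>|lborel. fourier f \<xi> * h \<xi>) = fconst TYPE('n) * (LINT \<xi>|lborel. (LINT x|lborel. ?k x \<xi>))"
    unfolding fourier_def
    by (simp only: integral_mult_left_zero integral_mult_right_zero mult.assoc[of "fconst TYPE('n)"])
  also have "\<dots> = fconst TYPE('n) * (LINT x|lborel. (LINT \<xi>|lborel. f x * (cis (- (\<xi> \<bullet> x)) * h \<xi>)))"
    unfolding * by (simp add: inner_commute mult_ac)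
  also have "\<dots> = (LINT x|lborel. fconst TYPE('n) * (f x * (LINT \<xi>|lborel. cis (- (\<xi> \<bullet> x)) * h \<xi>)))"
    by (simp only: integral_mult_right_zero)
  also have "\<dots> = (LINT x|lborel. f x * fourier h x)"
    unfolding fourier_def by (simp only: mult.left_commute)
  finally show ?thesis .
qed

section \<open>Gaussians and the inversion formula\<close>

definition gauss :: "real ^ 'n::finite \<Rightarrow> real" where
  "gauss x = exp (- (norm x)\<^sup>2 / 2)"

text \<open>The characteristic function of the standard normal distribution, freed from the
  normalisation \<open>sqrt (2 * pi)\<close>.\<close>

lemma gauss_1d:
  "integrable lborel (\<lambda>x. cis (- (x * t)) * complex_of_real (exp (- x\<^sup>2 / 2)))"
  "(LINT x|lborel. cis (- (x * t)) * complex_of_real (exp (- x\<^sup>2 / 2))) =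
     complex_of_real (sqrt (2 * pi) * exp (- t\<^sup>2 / 2))"
proof -
  let ?f = "\<lambda>x. cis (- (x * t)) * complex_of_real (exp (- x\<^sup>2 / 2))"
  have eq: "std_normal_density x *\<^sub>R iexp ((- t) * x) = complex_of_real (1 / sqrt (2 * pi)) * ?f x" for x
    by (simp add: normal_density_def cis_conv_exp scaleR_conv_of_real mult_ac)
  have "integrable lborel (\<lambda>x. std_normal_density x *\<^sub>R iexp ((- t) * x))"
    by (rule integrable_dominated[of _ std_normal_density]) auto
  then have i: "integrable lborel (\<lambda>x. complex_of_real (sqrt (2 * pi)) * (std_normal_density x *\<^sub>R iexp ((- t) * x)))"
    by (rule integrable_mult_right)
  have scale: "complex_of_real (sqrt (2 * pi)) * (complex_of_real (1 / sqrt (2 * pi)) * z) = z" for z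
    by (simp flip: of_real_mult mult.assoc)
  show "integrable lborel ?f"
    using i unfolding eq scale .
  have "complex_of_real (exp (- ((- t)\<^sup>2) / 2)) = char std_normal_distribution (- t)"
    by (simp only: char_std_normal_distribution)
  also have "\<dots> = (LINT x|lborel. std_normal_density x *\<^sub>R iexp ((- t) * x))"
    unfolding char_def by (subst integral_density) auto
  also have "\<dots> = complex_of_real (1 / sqrt (2 * pi)) * (LINT x|lborel. ?f x)"
    unfolding eq by simp
  finally have "complex_of_real (sqrt (2 * pi)) * complex_of_real (exp (- t\<^sup>2 / 2)) = (LINT x|lborel. ?f x)"
    using scale by simp
  then show "(LINT x|lborel. ?f x) = complex_of_real (sqrt (2 * pi) * exp (- t\<^sup>2 / 2))"
    by simp
qed

text \<open>Lebesgue measure is the image of the product of one-dimensional ones, so integrals of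
  tensor products factor; this carries the Gaussian from dimension 1 to any dimension.\<close>

lemma integral_lborel_prod:
  fixes f :: "'a::euclidean_space \<Rightarrow> real \<Rightarrow> complex"
  assumes f: "\<And>b. b \<in> Basis \<Longrightarrow> integrable lborel (f b)"
  shows "integrable lborel (\<lambda>x. \<Prod>b\<in>Basis. f b (x \<bullet> b))"
    and "(LINT x|lborel. (\<Prod>b\<in>Basis. f b (x \<bullet> b))) = (\<Prod>b\<in>Basis. integral\<^sup>L lborel (f b))"
proof -
  interpret product_sigma_finite "\<lambda>b::'a. lborel :: real measure" ..
  have [measurable]: "b \<in> Basis \<Longrightarrow> f b \<in> borel_measurable borel" for b
    using f[of b] by auto
  have lb: "lborel = distr (\<Pi>\<^sub>M b\<in>(Basis::'a set). lborel) borel (\<lambda>f. \<Sum>b\<in>Basis. f b *\<^sub>R b)"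
    unfolding lborel_def[where 'a = 'a] lborel_eq_real[symmetric] ..
  have m1: "(\<lambda>f. \<Sum>b\<in>Basis. f b *\<^sub>R b) \<in> (\<Pi>\<^sub>M b\<in>(Basis::'a set). (lborel::real measure)) \<rightarrow>\<^sub>M borel"
    by measurable
  have m2: "(\<lambda>x. \<Prod>b\<in>Basis. f b (x \<bullet> b)) \<in> borel_measurable (borel :: 'a measure)"
    by measurable
  have e: "(\<Prod>b\<in>Basis. f b ((\<Sum>c\<in>Basis. g c *\<^sub>R c) \<bullet> b)) = (\<Prod>b\<in>Basis. f b (g b))" for g :: "'a \<Rightarrow> real"
    by (intro prod.cong) auto
  have i: "integrable (\<Pi>\<^sub>M b\<in>Basis. lborel) (\<lambda>g. \<Prod>b\<in>Basis. f b (g b))"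
    by (rule product_integrable_prod) (auto intro: f)
  show "integrable lborel (\<lambda>x. \<Prod>b\<in>Basis. f b (x \<bullet> b))"
    unfolding lb by (subst integrable_distr_eq[OF m1 m2]) (simp only: e i)
  have "(LINT x|lborel. (\<Prod>b\<in>Basis. f b (x \<bullet> b))) =
      (LINT g|(\<Pi>\<^sub>M b\<in>(Basis::'a set). lborel). (\<Prod>b\<in>Basis. f b (g b)))"
    unfolding lb by (subst integral_distr[OF m1 m2]) (simp only: e)
  also have "\<dots> = (\<Prod>b\<in>Basis. integral\<^sup>L lborel (f b))"
    by (rule product_integral_prod) (auto intro: f)
  finally show "(LINT x|lborel. (\<Prod>b\<in>Basis. f b (x \<bullet> b))) = (\<Prod>b\<in>Basis. integral\<^sup>L lborel (f b))" .
qed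

lemma gauss_fourier_integral:
  fixes z :: "real ^ 'n::finite"
  shows "integrable lborel (\<lambda>x. cis (- (x \<bullet> z)) * complex_of_real (gauss x))"
    and "(LINT x|lborel. cis (- (x \<bullet> z)) * complex_of_real (gauss x)) =
      complex_of_real ((2 * pi) powr (real CARD('n) / 2) * gauss z)"
proof -
  let ?f = "\<lambda>b x. cis (- (x * (z \<bullet> b))) * complex_of_real (exp (- x\<^sup>2 / 2))"
  have cis_sum: "cis (\<Sum>b\<in>B. g b) = (\<Prod>b\<in>B. cis (g b))" for B and g :: "real ^ 'n \<Rightarrow> real"
    by (induction B rule: infinite_finite_induct) (simp_all add: cis_mult[symmetric])
  have n2: "(norm x)\<^sup>2 = (\<Sum>b\<in>Basis. (x \<bullet> b)\<^sup>2)" for x :: "real ^ 'n"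
    unfolding power2_norm_eq_inner by (subst euclidean_inner) (simp add: power2_eq_square)
  have e: "cis (- (x \<bullet> z)) * complex_of_real (gauss x) = (\<Prod>b\<in>Basis. ?f b (x \<bullet> b))" for x :: "real ^ 'n"
  proof -
    have "- (x \<bullet> z) = (\<Sum>b\<in>Basis. - ((x \<bullet> b) * (z \<bullet> b)))"
      by (subst euclidean_inner) (simp add: sum_negf)
    then have "cis (- (x \<bullet> z)) = (\<Prod>b\<in>Basis. cis (- ((x \<bullet> b) * (z \<bullet> b))))"
      by (simp add: cis_sum)
    moreover have "gauss x = (\<Prod>b\<in>Basis. exp (- (x \<bullet> b)\<^sup>2 / 2))"
      by (simp add: gauss_def n2 sum_divide_distrib exp_sum sum_negf[symmetric] del: sum_negf)
    ultimately show ?thesis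
      by (simp add: prod.distrib)
  qed
  show "integrable lborel (\<lambda>x. cis (- (x \<bullet> z)) * complex_of_real (gauss x))"
    unfolding e by (rule integral_lborel_prod) (rule gauss_1d)
  have "(LINT x|lborel. cis (- (x \<bullet> z)) * complex_of_real (gauss x)) =
      (\<Prod>b\<in>(Basis :: (real^'n) set). complex_of_real (sqrt (2 * pi) * exp (- (z \<bullet> b)\<^sup>2 / 2)))"
    unfolding e by (subst integral_lborel_prod) (auto intro: gauss_1d simp only: gauss_1d)
  also have "\<dots> = complex_of_real (sqrt (2 * pi) ^ CARD('n) * gauss z)"
    by (simp add: gauss_def n2 sum_divide_distrib exp_sum sum_negf[symmetric] prod.distrib del: sum_negf)
  also have "sqrt (2 * pi) ^ CARD('n) = (2 * pi) powr (real CARD('n) / 2)"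
    by (simp add: powr_half_sqrt[symmetric] powr_realpow[symmetric] powr_powr)
  finally show "(LINT x|lborel. cis (- (x \<bullet> z)) * complex_of_real (gauss x)) =
      complex_of_real ((2 * pi) powr (real CARD('n) / 2) * gauss z)" .
qed

lemma gauss_measurable [measurable]: "gauss \<in> borel_measurable borel"
  unfolding gauss_def[abs_def] by measurable

lemma gauss_integrable: "integrable lborel (\<lambda>x :: real ^ 'n::finite. complex_of_real (gauss x))"
  using gauss_fourier_integral(1)[of "0 :: real ^ 'n"] by simp

lemma gauss_integral: "(LINT x|lborel. complex_of_real (gauss (x :: real ^ 'n::finite))) =
    complex_of_real ((2 * pi) powr (real CARD('n) / 2))"
  using gauss_fourier_integral(2)[of "0 :: real ^ 'n"] by (simp add: gauss_def)

lemma fconst_inverse: "fconst TYPE('n::finite) * complex_of_real ((2 * pi) powr (real CARD('n) / 2)) = 1"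
  by (simp flip: of_real_mult powr_add)

text \<open>Modulation by \<open>x\<close> becomes a translation and dilation by \<epsilon> a
  concentration: as \<epsilon> tends to 0 the transform is an approximate identity at
  \<open>- x\<close>, of total mass (2 pi)^(n/2).\<close>

lemma fourier_modulated_gauss:
  fixes x y :: "real ^ 'n::finite"
  assumes \<epsilon>: "\<epsilon> > 0"
  shows "integrable lborel (\<lambda>\<xi>. cis (- (\<xi> \<bullet> x)) * complex_of_real (gauss (\<epsilon> *\<^sub>R \<xi>)))"
    and "fourier (\<lambda>\<xi>. cis (- (\<xi> \<bullet> x)) * complex_of_real (gauss (\<epsilon> *\<^sub>R \<xi>))) y =
      complex_of_real (inverse \<epsilon> ^ CARD('n) * gauss (inverse \<epsilon> *\<^sub>R (x + y)))"
proof -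
  let ?z = "inverse \<epsilon> *\<^sub>R (x + y)"
  show "integrable lborel (\<lambda>\<xi>. cis (- (\<xi> \<bullet> x)) * complex_of_real (gauss (\<epsilon> *\<^sub>R \<xi>)))"
    using integrable_lborel_affine[OF gauss_integrable, of \<epsilon> 0] \<epsilon>
    by (intro integrable_cis_mult) simp
  let ?g = "\<lambda>\<xi>. cis (- (\<xi> \<bullet> ?z)) * complex_of_real (gauss \<xi>)"
  have "?g \<in> borel_measurable borel"
    using gauss_fourier_integral(1)[of ?z] by auto
  from integral_lborel_affine[OF this, of \<epsilon> 0] \<epsilon>
  have "(LINT \<xi>|lborel. ?g \<xi>) = \<epsilon> ^ CARD('n) *\<^sub>R (LINT \<xi>|lborel. ?g (\<epsilon> *\<^sub>R \<xi>))"
    by simp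
  also have "(\<lambda>\<xi>. ?g (\<epsilon> *\<^sub>R \<xi>)) = (\<lambda>\<xi>. cis (- (\<xi> \<bullet> (x + y))) * complex_of_real (gauss (\<epsilon> *\<^sub>R \<xi>)))"
    using \<epsilon> by (simp add: fun_eq_iff flip: mult.assoc)
  finally have "(LINT \<xi>|lborel. ?g \<xi>) = complex_of_real (\<epsilon> ^ CARD('n)) *
      (LINT \<xi>|lborel. cis (- (\<xi> \<bullet> (x + y))) * complex_of_real (gauss (\<epsilon> *\<^sub>R \<xi>)))"
    by (simp only: scaleR_conv_of_real[where 'a = complex])
  then have "(LINT \<xi>|lborel. cis (- (\<xi> \<bullet> (x + y))) * complex_of_real (gauss (\<epsilon> *\<^sub>R \<xi>))) =
      complex_of_real (inverse \<epsilon> ^ CARD('n)) * (LINT \<xi>|lborel. ?g \<xi>)"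
    using \<epsilon> by (simp add: field_simps)
  then have I: "(LINT \<xi>|lborel. cis (- (\<xi> \<bullet> (x + y))) * complex_of_real (gauss (\<epsilon> *\<^sub>R \<xi>))) =
      complex_of_real (inverse \<epsilon> ^ CARD('n)) *
        complex_of_real ((2 * pi) powr (real CARD('n) / 2) * gauss ?z)"
    unfolding gauss_fourier_integral(2) .
  have cc: "cis (- (\<xi> \<bullet> y)) * (cis (- (\<xi> \<bullet> x)) * w) = cis (- (\<xi> \<bullet> (x + y))) * w" for \<xi> w
    by (simp add: cis_mult inner_add_right add.commute flip: mult.assoc)
  have c: "fconst TYPE('n) * (p * complex_of_real ((2 * pi) powr (real CARD('n) / 2) * q)) = p * complex_of_real q" for p q
    using arg_cong[OF fconst_inverse[where 'n = 'n], of "\<lambda>w. w * (p * complex_of_real q)"]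
    by (simp add: mult_ac)
  show "fourier (\<lambda>\<xi>. cis (- (\<xi> \<bullet> x)) * complex_of_real (gauss (\<epsilon> *\<^sub>R \<xi>))) y =
      complex_of_real (inverse \<epsilon> ^ CARD('n) * gauss ?z)"
    unfolding fourier_def cc I c by (simp only: of_real_mult)
qed

theorem fourier_fourier:
  fixes g :: "real ^ 'n::finite \<Rightarrow> complex"
  assumes g: "g \<in> \<S>"
  shows "fourier (fourier g) x = g (- x)"
proof -
  define \<epsilon> where "\<epsilon> m = inverse (real (Suc m))" for m
  have \<epsilon>: "\<epsilon> m > 0" for m by (simp add: \<epsilon>_def)
  have \<epsilon>0: "\<epsilon> \<longlonglongrightarrow> 0" unfolding \<epsilon>_def by (rule LIMSEQ_inverse_real_of_nat)
  note gi = schwartz_integrable[OF g]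
  note fg = schwartz_fourier[OF g]
  note [measurable] = schwartz_measurable[OF g] schwartz_measurable[OF fg] multiplier_measurable[OF multiplier_cis]
  have gcont: "continuous_on UNIV g" by (rule smooth_continuous[OF schwartz_smooth[OF g]])
  have g1: "gauss (\<epsilon> m *\<^sub>R \<xi>) \<le> 1" "gauss (\<epsilon> m *\<^sub>R \<xi>) \<ge> 0" for m and \<xi> :: "real^'n"
    by (simp_all add: gauss_def)
  \<comment> \<open>Inserting the definition of the inner transform directly gives a double integral
    that does not converge absolutely. With the Gaussian factor the transform can be moved onto that
    factor; the substitution y = - x + \<epsilon> z then leaves a fixed Gaussian.\<close>
  have key: "(LINT \<xi>|lborel. fourier g \<xi> * (cis (- (\<xi> \<bullet> x)) * complex_of_real (gauss (\<epsilon> m *\<^sub>R \<xi>)))) =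
      (LINT z|lborel. g (- x + \<epsilon> m *\<^sub>R z) * complex_of_real (gauss z))" for m
  proof -
    have "(LINT \<xi>|lborel. fourier g \<xi> * (cis (- (\<xi> \<bullet> x)) * complex_of_real (gauss (\<epsilon> m *\<^sub>R \<xi>)))) =
        (LINT y|lborel. g y * complex_of_real (inverse (\<epsilon> m) ^ CARD('n) * gauss (inverse (\<epsilon> m) *\<^sub>R (x + y))))"
      by (subst fourier_mult_formula[OF gi fourier_modulated_gauss(1)[OF \<epsilon>]])
        (simp only: fourier_modulated_gauss(2)[OF \<epsilon>])
    also have "\<dots> = \<bar>\<epsilon> m\<bar> ^ DIM(real^'n) *\<^sub>R (LINT z|lborel. g (- x + \<epsilon> m *\<^sub>R z) *
        complex_of_real (inverse (\<epsilon> m) ^ CARD('n) * gauss (inverse (\<epsilon> m) *\<^sub>R (x + (- x + \<epsilon> m *\<^sub>R z)))))"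
      using \<epsilon>[of m] by (intro integral_lborel_affine) auto
    also have "\<dots> = (LINT z|lborel. g (- x + \<epsilon> m *\<^sub>R z) * complex_of_real (gauss z))"
      unfolding integral_scaleR_right[symmetric]
      using \<epsilon>[of m] by (intro Bochner_Integration.integral_cong) (auto simp: scaleR_conv_of_real[where 'a = complex] power_inverse)
    finally show ?thesis .
  qed
  obtain K where K: "\<And>x. norm (g x) \<le> K"
    using rapid_decayE[OF schwartz_rapid[OF g], of 0] by (metis mult_1 power_0)
  have "(\<lambda>m. LINT \<xi>|lborel. fourier g \<xi> * (cis (- (\<xi> \<bullet> x)) * complex_of_real (gauss (\<epsilon> m *\<^sub>R \<xi>))))
      \<longlonglongrightarrow> (LINT \<xi>|lborel. cis (- (\<xi> \<bullet> x)) * fourier g \<xi>)"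
  proof (rule integral_dominated_convergence)
    show "integrable lborel (\<lambda>\<xi>. norm (fourier g \<xi>))"
      using schwartz_integrable[OF fg] by simp
    show "AE \<xi> in lborel. (\<lambda>m. fourier g \<xi> * (cis (- (\<xi> \<bullet> x)) * complex_of_real (gauss (\<epsilon> m *\<^sub>R \<xi>))))
        \<longlonglongrightarrow> cis (- (\<xi> \<bullet> x)) * fourier g \<xi>"
    proof (rule AE_I2)
      fix \<xi> :: "real ^ 'n"
      have "(\<lambda>m. complex_of_real (gauss (\<epsilon> m *\<^sub>R \<xi>))) \<longlonglongrightarrow> complex_of_real (exp (- (norm (0 *\<^sub>R \<xi>))\<^sup>2 / 2))"
        unfolding gauss_def by (intro tendsto_intros \<epsilon>0) auto
      then have "(\<lambda>m. complex_of_real (gauss (\<epsilon> m *\<^sub>R \<xi>))) \<longlonglongrightarrow> 1" by simp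
      then have "(\<lambda>m. fourier g \<xi> * (cis (- (\<xi> \<bullet> x)) * complex_of_real (gauss (\<epsilon> m *\<^sub>R \<xi>))))
          \<longlonglongrightarrow> fourier g \<xi> * (cis (- (\<xi> \<bullet> x)) * 1)"
        by (intro tendsto_intros)
      then show "(\<lambda>m. fourier g \<xi> * (cis (- (\<xi> \<bullet> x)) * complex_of_real (gauss (\<epsilon> m *\<^sub>R \<xi>))))
          \<longlonglongrightarrow> cis (- (\<xi> \<bullet> x)) * fourier g \<xi>"
        by (simp add: mult.commute)
    qed
    show "AE \<xi> in lborel. norm (fourier g \<xi> * (cis (- (\<xi> \<bullet> x)) * complex_of_real (gauss (\<epsilon> m *\<^sub>R \<xi>)))) \<le> norm (fourier g \<xi>)" for m
      using g1 by (intro AE_I2) (auto simp: norm_mult intro!: mult_left_le)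
  qed measurable
  moreover have "(\<lambda>m. LINT z|lborel. g (- x + \<epsilon> m *\<^sub>R z) * complex_of_real (gauss z))
      \<longlonglongrightarrow> (LINT z|lborel. g (- x) * complex_of_real (gauss (z :: real^'n)))"
  proof (rule integral_dominated_convergence)
    show "integrable lborel (\<lambda>z::real^'n. K * gauss z)"
      using gauss_integrable[where 'n = 'n] by (simp add: complex_of_real_integrable_eq)
    show "AE z in lborel. norm (g (- x + \<epsilon> m *\<^sub>R z) * complex_of_real (gauss z)) \<le> K * gauss z" for m
      using K by (intro AE_I2) (auto simp: norm_mult gauss_def)
    show "AE z in lborel. (\<lambda>m. g (- x + \<epsilon> m *\<^sub>R z) * complex_of_real (gauss z)) \<longlonglongrightarrow> g (- x) * complex_of_real (gauss z)"
    proof (intro AE_I2 tendsto_mult tendsto_const)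
      fix z :: "real ^ 'n"
      have "(\<lambda>m. - x + \<epsilon> m *\<^sub>R z) \<longlonglongrightarrow> - x + 0 *\<^sub>R z"
        by (intro tendsto_intros \<epsilon>0)
      then have "(\<lambda>m. - x + \<epsilon> m *\<^sub>R z) \<longlonglongrightarrow> - x" by simp
      then show "(\<lambda>m. g (- x + \<epsilon> m *\<^sub>R z)) \<longlonglongrightarrow> g (- x)"
        using gcont by (metis UNIV_I continuous_on_eq_continuous_at isCont_tendsto_compose open_UNIV)
    qed
  qed measurable
  ultimately have "(LINT \<xi>|lborel. cis (- (\<xi> \<bullet> x)) * fourier g \<xi>) = (LINT z|lborel. g (- x) * complex_of_real (gauss (z :: real^'n)))"
    unfolding key by (rule LIMSEQ_unique)
  also have "\<dots> = g (- x) * complex_of_real ((2 * pi) powr (real CARD('n) / 2))"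
    by (simp only: integral_mult_right_zero gauss_integral)
  finally show ?thesis
    using fconst_inverse[where 'n = 'n] by (simp add: fourier_def[of "fourier g"] mult.left_commute)
qed

section \<open>Inverse transform and the Plancherel identity\<close>

definition inv_fourier :: "(real ^ 'n::finite \<Rightarrow> complex) \<Rightarrow> real ^ 'n \<Rightarrow> complex" where
  "inv_fourier g = (\<lambda>x. fourier g (- x))"

lemma inv_fourier_fourier: "g \<in> \<S> \<Longrightarrow> inv_fourier (fourier g) = g"
  by (simp add: inv_fourier_def fourier_fourier)

lemma schwartz_continuous_inv_fourier: "schwartz_continuous inv_fourier"
  unfolding inv_fourier_def[abs_def]
  by (rule schwartz_continuous_comp[OF schwartz_continuous_minus schwartz_continuous_fourier])

lemma schwartz_inv_fourier: "g \<in> \<S> \<Longrightarrow> inv_fourier g \<in> \<S>"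
  using schwartz_continuous_inv_fourier by (auto simp: schwartz_continuous_def)

lemma fourier_minus:
  fixes g :: "real ^ 'n::finite \<Rightarrow> complex"
  assumes g: "g \<in> \<S>"
  shows "fourier (\<lambda>x. g (- x)) \<xi> = fourier g (- \<xi>)"
proof -
  have "(LINT x|lborel. cis (- (x \<bullet> - \<xi>)) * g x) = \<bar>-1\<bar> ^ DIM(real^'n) *\<^sub>R
      (LINT x|lborel. cis (- ((0 + (-1) *\<^sub>R x) \<bullet> - \<xi>)) * g (0 + (-1) *\<^sub>R x))"
    by (intro integral_lborel_affine borel_measurable_times multiplier_measurable multiplier_cis
        schwartz_measurable g) simp
  then show ?thesis unfolding fourier_def by simp
qed

lemma fourier_inv_fourier: "g \<in> \<S> \<Longrightarrow> fourier (inv_fourier g) = g"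
  unfolding inv_fourier_def by (simp add: fun_eq_iff fourier_minus schwartz_fourier fourier_fourier)

lemma fourier_cnj: "fourier (\<lambda>x. cnj (g x)) \<xi> = cnj (fourier g (- \<xi>))"
proof -
  have "cnj (LINT x|lborel. cis (- (x \<bullet> - \<xi>)) * g x) = (LINT x|lborel. cnj (cis (- (x \<bullet> - \<xi>)) * g x))"
    by (rule Bochner_Integration.integral_cnj[symmetric])
  then show ?thesis
    unfolding fourier_def by (simp add: cis_cnj)
qed

lemma schwartz_square_integrable:
  assumes g: "g \<in> \<S>"
  shows "integrable lborel (\<lambda>x. (norm (g x))\<^sup>2)"
proof -
  have "integrable lborel (\<lambda>x. cnj (g x) * g x)"
    by (intro schwartz_integrable schwartz_mult schwartz_multiplier schwartz_cnj g)
  then have "integrable lborel (\<lambda>x. norm (cnj (g x) * g x))" by (rule integrable_norm)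
  then show ?thesis by (simp add: norm_mult power2_eq_square)
qed

text \<open>The multiplication formula with the conjugate of \<open>fourier g\<close> as second
  function: by inversion the transform of that conjugate is the conjugate of
  \<open>g\<close>.\<close>

theorem plancherel:
  fixes g :: "real ^ 'n::finite \<Rightarrow> complex"
  assumes g: "g \<in> \<S>"
  shows "(LINT x|lborel. (norm (fourier g x))\<^sup>2) = (LINT x|lborel. (norm (g x))\<^sup>2)"
proof -
  let ?h = "\<lambda>x. cnj (fourier g x)"
  have h: "?h \<in> \<S>" by (intro schwartz_cnj schwartz_fourier g)
  have sq: "z * cnj z = complex_of_real ((norm z)\<^sup>2)" for z
    by (rule complex_norm_square[symmetric])
  have "(LINT x|lborel. fourier g x * ?h x) = (LINT x|lborel. g x * fourier ?h x)"
    by (intro fourier_mult_formula schwartz_integrable g h)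
  also have "fourier ?h = (\<lambda>x. cnj (g x))"
    by (simp add: fun_eq_iff fourier_cnj fourier_fourier[OF g])
  finally have "(LINT x|lborel. complex_of_real ((norm (fourier g x))\<^sup>2)) = (LINT x|lborel. complex_of_real ((norm (g x))\<^sup>2))"
    unfolding sq .
  then show ?thesis
    unfolding integral_complex_of_real of_real_eq_iff .
qed

subsection \<open>Square integrable functions\<close>

definition square_integrable :: "'a measure \<Rightarrow> ('a \<Rightarrow> complex) \<Rightarrow> bool" where
  "square_integrable M f \<longleftrightarrow> f \<in> borel_measurable M \<and> integrable M (\<lambda>x. (norm (f x))\<^sup>2)"

lemma square_integrable_measurable: "square_integrable M f \<Longrightarrow> f \<in> borel_measurable M"
  by (simp add: square_integrable_def)

lemma norm_mult_le_squares: "norm (z * w) \<le> (norm z)\<^sup>2 + (norm w)\<^sup>2" for z w :: complex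
  using sum_squares_bound[of "norm z" "norm w"] mult_nonneg_nonneg[OF norm_ge_zero[of z] norm_ge_zero[of w]]
  unfolding norm_mult by linarith

lemma square_integrable_mult:
  assumes f: "square_integrable M f" and g: "square_integrable M g"
  shows "integrable M (\<lambda>x. f x * g x)"
proof (rule integrable_dominated)
  show "integrable M (\<lambda>x. (norm (f x))\<^sup>2 + (norm (g x))\<^sup>2)"
    using f g by (auto simp: square_integrable_def)
  show "AE x in M. norm (f x * g x) \<le> norm ((norm (f x))\<^sup>2 + (norm (g x))\<^sup>2)"
    using norm_mult_le_squares by (intro AE_I2) (simp add: add_nonneg_nonneg)
qed (use f g in \<open>auto simp: square_integrable_def\<close>)

lemma square_integrable_add:
  assumes f: "square_integrable M f" and g: "square_integrable M g"
  shows "square_integrable M (\<lambda>x. f x + g x)"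
  unfolding square_integrable_def
proof
  note [measurable] = square_integrable_measurable[OF f] square_integrable_measurable[OF g]
  show "(\<lambda>x. f x + g x) \<in> borel_measurable M" by measurable
  have *: "(norm (f x + g x))\<^sup>2 \<le> 2 * (norm (f x))\<^sup>2 + 2 * (norm (g x))\<^sup>2" for x
  proof -
    have "(norm (f x + g x))\<^sup>2 \<le> (norm (f x) + norm (g x))\<^sup>2"
      by (intro power_mono norm_triangle_ineq) auto
    also have "\<dots> \<le> 2 * (norm (f x))\<^sup>2 + 2 * (norm (g x))\<^sup>2"
      using sum_squares_bound[of "norm (f x)" "norm (g x)"] by (simp add: power2_sum)
    finally show ?thesis .
  qed
  show "integrable M (\<lambda>x. (norm (f x + g x))\<^sup>2)"
  proof (rule integrable_dominated)
    show "integrable M (\<lambda>x. 2 * (norm (f x))\<^sup>2 + 2 * (norm (g x))\<^sup>2)"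
      using f g by (auto simp: square_integrable_def)
    show "AE x in M. norm ((norm (f x + g x))\<^sup>2) \<le> norm (2 * (norm (f x))\<^sup>2 + 2 * (norm (g x))\<^sup>2)"
      using * by (intro AE_I2) (simp add: add_nonneg_nonneg)
  qed measurable
qed

lemma square_integrable_cmult: "square_integrable M f \<Longrightarrow> square_integrable M (\<lambda>x. c * f x)"
  by (auto simp: square_integrable_def norm_mult power_mult_distrib)

lemma cnj_measurable [measurable]: "cnj \<in> borel_measurable borel"
  by (intro borel_measurable_continuous_onI continuous_intros)

lemma square_integrable_cnj: "square_integrable M f \<Longrightarrow> square_integrable M (\<lambda>x. cnj (f x))"
  by (auto simp: square_integrable_def)

lemma cauchy_schwarz_integral:
  assumes f: "square_integrable M f" and g: "square_integrable M g"
  shows "norm (LINT x|M. f x * g x) \<le> sqrt (LINT x|M. (norm (f x))\<^sup>2) * sqrt (LINT x|M. (norm (g x))\<^sup>2)"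
proof -
  note [measurable] = square_integrable_measurable[OF f] square_integrable_measurable[OF g]
  let ?A = "LINT x|M. norm (f x * g x)" and ?F = "LINT x|M. (norm (f x))\<^sup>2" and ?G = "LINT x|M. (norm (g x))\<^sup>2"
  have i: "integrable M (\<lambda>x. norm (f x * g x))" "integrable M (\<lambda>x. (norm (f x))\<^sup>2)" "integrable M (\<lambda>x. (norm (g x))\<^sup>2)"
    using square_integrable_mult[OF f g] f g by (auto simp: square_integrable_def)
  have nonneg: "?A \<ge> 0" "?F \<ge> 0" "?G \<ge> 0" by (auto intro: Bochner_Integration.integral_nonneg)
  have "(\<integral>\<^sup>+x. ennreal (norm (f x)) * ennreal (norm (g x)) \<partial>M)\<^sup>2 \<le>
      (\<integral>\<^sup>+x. (ennreal (norm (f x)))\<^sup>2 \<partial>M) * (\<integral>\<^sup>+x. (ennreal (norm (g x)))\<^sup>2 \<partial>M)"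
    by (rule Cauchy_Schwarz_nn_integral) auto
  then have "(\<integral>\<^sup>+x. ennreal (norm (f x * g x)) \<partial>M)\<^sup>2 \<le>
      (\<integral>\<^sup>+x. ennreal ((norm (f x))\<^sup>2) \<partial>M) * (\<integral>\<^sup>+x. ennreal ((norm (g x))\<^sup>2) \<partial>M)"
    by (simp add: norm_mult ennreal_mult ennreal_power)
  then have "ennreal ?A ^ 2 \<le> ennreal ?F * ennreal ?G"
    using i by (simp add: nn_integral_eq_integral)
  then have "?A\<^sup>2 \<le> ?F * ?G"
    using nonneg by (simp add: ennreal_power ennreal_mult[symmetric])
  then have "?A \<le> sqrt ?F * sqrt ?G"
    using nonneg by (metis real_le_rsqrt real_sqrt_mult)
  then show ?thesis
    using integral_norm_bound[of M "\<lambda>x. f x * g x"] by linarith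
qed

text \<open>The majorant comes from \<open>S = (\<Sum>k. 4\<^sup>k |h\<^sub>k\<^sub>+\<^sub>1 - h\<^sub>k|\<^sup>2)\<close>, which is integrable, so that almost
  everywhere \<open>|h\<^sub>k\<^sub>+\<^sub>1 - h\<^sub>k| \<le> sqrt S / 2\<^sup>k\<close>.\<close>

lemma square_integrable_limit:
  fixes h :: "nat \<Rightarrow> 'a \<Rightarrow> complex"
  assumes h: "\<And>k. square_integrable M (h k)"
    and diff: "\<And>k. (LINT x|M. (norm (h (Suc k) x - h k x))\<^sup>2) \<le> C * (1/8) ^ k"
  obtains G D where "G \<in> borel_measurable M" "integrable M D"
    "AE x in M. (\<lambda>k. h k x) \<longlonglongrightarrow> G x" "AE x in M. \<forall>k. (norm (h k x))\<^sup>2 \<le> D x"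
proof -
  note [measurable] = square_integrable_measurable[OF h]
  define \<Delta> where "\<Delta> k x = h (Suc k) x - h k x" for k x
  have [measurable]: "\<Delta> k \<in> borel_measurable M" for k unfolding \<Delta>_def[abs_def] by measurable
  \<comment> \<open>The ratio 4 sits between 1 and 8: larger than 1 for geometric decay at each
    point, smaller than 8 for the integrals to remain summable.\<close>
  define a where "a k x = 4 ^ k * (norm (\<Delta> k x))\<^sup>2" for k x
  have a0: "a k x \<ge> 0" for k x by (simp add: a_def)
  have \<Delta>int: "integrable M (\<lambda>x. (norm (\<Delta> k x))\<^sup>2)" for k
    using square_integrable_add[OF h[of "Suc k"] square_integrable_cmult[OF h[of k], of "-1"]]
    by (simp add: square_integrable_def \<Delta>_def)
  have aint: "integrable M (a k)" for k
    unfolding a_def[abs_def] using \<Delta>int by simp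
  have [measurable]: "a k \<in> borel_measurable M" for k
    using aint by auto
  have ale: "integral\<^sup>L M (a k) \<le> C * (1/2) ^ k" for k
  proof -
    have "integral\<^sup>L M (a k) = 4 ^ k * (LINT x|M. (norm (\<Delta> k x))\<^sup>2)"
      unfolding a_def[abs_def] by simp
    also have "\<dots> \<le> 4 ^ k * (C * (1/8) ^ k)"
      using diff[of k] by (intro mult_left_mono) (auto simp: \<Delta>_def)
    also have "\<dots> = C * (1/2) ^ k"
      by (simp add: power_divide power_mult_distrib[symmetric] field_simps flip: power_mult_distrib)
    finally show ?thesis .
  qed
  have sum_int: "summable (\<lambda>k. integral\<^sup>L M (a k))"
  proof (rule summable_comparison_test')
    show "summable (\<lambda>k. C * (1/2) ^ k)" by (intro summable_mult summable_geometric) simp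
    show "norm (integral\<^sup>L M (a k)) \<le> C * (1/2) ^ k" for k
      using ale[of k] a0 by (simp add: Bochner_Integration.integral_nonneg)
  qed
  have "(\<integral>\<^sup>+x. (\<Sum>k. ennreal (a k x)) \<partial>M) = (\<Sum>k. ennreal (integral\<^sup>L M (a k)))"
    by (subst nn_integral_suminf) (auto intro!: suminf_cong nn_integral_eq_integral aint simp: a0)
  also have "\<dots> \<noteq> \<infinity>"
    using sum_int a0 by (subst suminf_ennreal2) (auto intro: Bochner_Integration.integral_nonneg)
  finally have "AE x in M. (\<Sum>k. ennreal (a k x)) \<noteq> \<infinity>"
    by (intro nn_integral_PInf_AE) auto
  then have asum: "AE x in M. summable (\<lambda>k. a k x)"
    by eventually_elim (auto intro: summable_suminf_not_top a0)
  define S where "S x = (\<Sum>k. a k x)" for x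
  have Sint: "integrable M S"
    unfolding S_def[abs_def] using asum sum_int a0
    by (intro integrable_suminf aint) auto
  \<comment> \<open>\<open>lim\<close> gives a measurable function everywhere; where the sequence
    diverges its value is arbitrary, and that happens on a null set only.\<close>
  define G where "G x = lim (\<lambda>k. h k x)" for x
  \<comment> \<open>From (|h 0| + 2 sqrt S)^2 \<le> 2 |h 0|^2 + 2 (2 sqrt S)^2, where the 2 in front
    of sqrt S is the sum of the geometric series of ratio 1/2.\<close>
  define D where "D x = 2 * (norm (h 0 x))\<^sup>2 + 8 * S x" for x
  have conv: "(\<lambda>k. h k x) \<longlonglongrightarrow> G x \<and> (\<forall>k. (norm (h k x))\<^sup>2 \<le> D x)" if s: "summable (\<lambda>k. a k x)" for x
  proof -
    have S0: "S x \<ge> 0" unfolding S_def using s a0 by (intro suminf_nonneg) auto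
    have \<Delta>le: "norm (\<Delta> k x) \<le> sqrt (S x) * (1/2) ^ k" for k
    proof -
      have "a k x \<le> S x"
        unfolding S_def using sum_le_suminf[OF s, of "{k}"] a0 by auto
      moreover have "(4::real) ^ k = (2 ^ k)\<^sup>2"
        by (simp add: power2_eq_square flip: power_mult_distrib)
      ultimately have "(2 ^ k * norm (\<Delta> k x))\<^sup>2 \<le> S x"
        by (simp only: a_def power_mult_distrib)
      then have "2 ^ k * norm (\<Delta> k x) \<le> sqrt (S x)"
        by (rule real_le_rsqrt)
      then show ?thesis by (simp add: field_simps power_divide)
    qed
    have geo: "summable (\<lambda>k. sqrt (S x) * (1/2) ^ k)"
      by (intro summable_mult summable_geometric) simp
    have sn: "summable (\<lambda>k. norm (\<Delta> k x))"
      by (rule summable_comparison_test'[OF geo]) (use \<Delta>le in auto)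
    have tele: "h k x = h 0 x + (\<Sum>j<k. \<Delta> j x)" for k
      by (induction k) (auto simp: \<Delta>_def)
    have "(\<lambda>k. h 0 x + (\<Sum>j<k. \<Delta> j x)) \<longlonglongrightarrow> h 0 x + (\<Sum>j. \<Delta> j x)"
      by (intro tendsto_intros summable_LIMSEQ summable_norm_cancel[OF sn])
    then have "(\<lambda>k. h k x) \<longlonglongrightarrow> h 0 x + (\<Sum>j. \<Delta> j x)"
      unfolding tele[symmetric] .
    then have "(\<lambda>k. h k x) \<longlonglongrightarrow> G x"
      unfolding G_def by (metis limI)
    moreover have "(norm (h k x))\<^sup>2 \<le> D x" for k
    proof -
      have "norm (\<Sum>j<k. \<Delta> j x) \<le> (\<Sum>j<k. sqrt (S x) * (1/2) ^ j)"
        by (rule sum_norm_le) (use \<Delta>le in auto)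
      also have "\<dots> \<le> (\<Sum>j. sqrt (S x) * (1/2) ^ j)"
        by (rule sum_le_suminf[OF geo]) (auto simp: S0)
      also have "\<dots> = 2 * sqrt (S x)"
        by (simp add: suminf_mult suminf_geometric)
      finally have "norm (h k x) \<le> norm (h 0 x) + 2 * sqrt (S x)"
        unfolding tele[of k] using norm_triangle_ineq[of "h 0 x"] by (smt (verit))
      then have "(norm (h k x))\<^sup>2 \<le> (norm (h 0 x) + 2 * sqrt (S x))\<^sup>2"
        by (intro power_mono) auto
      also have "\<dots> \<le> 2 * (norm (h 0 x))\<^sup>2 + 2 * (2 * sqrt (S x))\<^sup>2"
        using sum_squares_bound[of "norm (h 0 x)" "2 * sqrt (S x)"] by (simp only: power2_sum)
      also have "\<dots> = D x" using S0 by (simp add: D_def power_mult_distrib)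
      finally show ?thesis .
    qed
    ultimately show ?thesis by blast
  qed
  show thesis
  proof (rule that)
    show "G \<in> borel_measurable M" unfolding G_def[abs_def] by measurable
    show "integrable M D"
      unfolding D_def[abs_def] using h[of 0] Sint by (auto simp: square_integrable_def)
    show "AE x in M. (\<lambda>k. h k x) \<longlonglongrightarrow> G x"
      using asum by eventually_elim (simp add: conv)
    show "AE x in M. \<forall>k. (norm (h k x))\<^sup>2 \<le> D x"
      using asum by eventually_elim (simp add: conv)
  qed
qed

section \<open>Riesz representation on a space of square integrable functions\<close>

lemma norm_add_scaled_sq:
  "(norm (z + complex_of_real t * w))\<^sup>2 = (norm z)\<^sup>2 + 2 * t * Re (cnj z * w) + t\<^sup>2 * (norm w)\<^sup>2"
  unfolding cmod_power2 by (simp add: power2_eq_square algebra_simps)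

text \<open>A minimising sequence of \<open>\<parallel>f\<parallel>\<^sup>2 - 2 Re \<Lambda> f\<close> over \<open>V\<close> is Cauchy by the parallelogram law;
  its limit is the representing function.\<close>

lemma riesz_representation:
  fixes \<Lambda> :: "('a \<Rightarrow> complex) \<Rightarrow> complex"
  assumes V: "\<And>f. f \<in> V \<Longrightarrow> square_integrable M f" and ne: "V \<noteq> {}"
    and Vadd: "\<And>f g. f \<in> V \<Longrightarrow> g \<in> V \<Longrightarrow> (\<lambda>x. f x + g x) \<in> V"
    and Vscale: "\<And>c f. f \<in> V \<Longrightarrow> (\<lambda>x. c * f x) \<in> V"
    and add: "\<And>f g. f \<in> V \<Longrightarrow> g \<in> V \<Longrightarrow> \<Lambda> (\<lambda>x. f x + g x) = \<Lambda> f + \<Lambda> g"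
    and scale: "\<And>c f. f \<in> V \<Longrightarrow> \<Lambda> (\<lambda>x. c * f x) = c * \<Lambda> f"
    and B: "B \<ge> 0" and bound: "\<And>f. f \<in> V \<Longrightarrow> norm (\<Lambda> f) \<le> B * sqrt (LINT x|M. (norm (f x))\<^sup>2)"
  obtains G where "square_integrable M G" "(LINT x|M. (norm (G x))\<^sup>2) \<le> B\<^sup>2"
    "\<And>f. f \<in> V \<Longrightarrow> \<Lambda> f = (LINT x|M. G x * f x)"
proof -
  define n2 where "n2 f = (LINT x|M. (norm (f x))\<^sup>2)" for f :: "'a \<Rightarrow> complex"
  define Q where "Q f = n2 f - 2 * Re (\<Lambda> f)" for f
  have n2_0: "n2 f \<ge> 0" for f by (simp add: n2_def)
  have Re\<Lambda>: "Re (\<Lambda> f) \<le> B * sqrt (n2 f)" if "f \<in> V" for f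
    using bound[OF that] complex_Re_le_cmod[of "\<Lambda> f"] by (simp add: n2_def)
  \<comment> \<open>One expansion in real \<open>t\<close> serves twice: \<open>t\<close> equal to 1
    and -1 for the parallelogram law, small \<open>t\<close> for the variation around the
    minimum.\<close>
  have expand: "n2 (\<lambda>x. f x + complex_of_real t * g x) = n2 f + 2 * t * Re (LINT x|M. cnj (f x) * g x) + t\<^sup>2 * n2 g"
    if "f \<in> V" "g \<in> V" for f g t
  proof -
    have i: "integrable M (\<lambda>x. cnj (f x) * g x)"
      by (intro square_integrable_mult square_integrable_cnj V that)
    then have "integrable M (\<lambda>x. Re (cnj (f x) * g x))" by (rule integrable_Re)
    then show ?thesis
      unfolding n2_def norm_add_scaled_sq using V[OF that(1)] V[OF that(2)] integral_Re[OF i]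
      by (simp add: square_integrable_def del: times_complex.sel)
  qed
  have Qlow: "Q f \<ge> - B\<^sup>2" if "f \<in> V" for f
  proof -
    have "0 \<le> (sqrt (n2 f) - B)\<^sup>2" by simp
    also have "\<dots> = n2 f - 2 * (B * sqrt (n2 f)) + B\<^sup>2"
      using n2_0 by (simp add: power2_diff mult_ac)
    finally show ?thesis using Re\<Lambda>[OF that] by (simp add: Q_def)
  qed
  define m where "m = (INF f\<in>V. Q f)"
  have bdd: "bdd_below (Q ` V)" using Qlow by (intro bdd_belowI2[where m = "- B\<^sup>2"])
  have m_le: "m \<le> Q f" if "f \<in> V" for f
    unfolding m_def using bdd that by (rule cINF_lower)
  \<comment> \<open>The slack 8^(-k) becomes the rate that \<open>square_integrable_limit\<close>
    asks for, with constant 4.\<close>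
  have "\<exists>f\<in>V. Q f < m + (1/8) ^ k" for k
    using cINF_less_iff[OF ne bdd, of "m + (1/8) ^ k"] by (simp add: m_def)
  then obtain h where hV: "\<And>k. h k \<in> V" and hQ: "\<And>k. Q (h k) < m + (1/8) ^ k"
    by metis
  have diff: "n2 (\<lambda>x. h (Suc k) x - h k x) \<le> 4 * (1/8) ^ k" for k
  proof -
    let ?f = "h (Suc k)" and ?g = "h k"
    let ?mid = "\<lambda>x. (1/2) * (?f x + ?g x)"
    have mid: "?mid \<in> V" by (intro Vscale Vadd hV)
    have e1: "n2 (\<lambda>x. ?f x - ?g x) = n2 ?f - 2 * Re (LINT x|M. cnj (?f x) * ?g x) + n2 ?g"
      using expand[OF hV[of "Suc k"] hV[of k], of "-1"] by simp
    have e2: "n2 (\<lambda>x. ?f x + ?g x) = n2 ?f + 2 * Re (LINT x|M. cnj (?f x) * ?g x) + n2 ?g"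
      using expand[OF hV[of "Suc k"] hV[of k], of 1] by simp
    have e3: "n2 ?mid = n2 (\<lambda>x. ?f x + ?g x) / 4"
      unfolding n2_def norm_mult power_mult_distrib by (simp add: power2_eq_square)
    have "\<Lambda> ?mid = (1/2) * (\<Lambda> ?f + \<Lambda> ?g)"
      by (simp only: scale[OF Vadd[OF hV hV]] add[OF hV hV])
    from arg_cong[OF this, of Re]
    have e4: "Re (\<Lambda> ?mid) = (Re (\<Lambda> ?f) + Re (\<Lambda> ?g)) / 2"
      unfolding times_complex.sel by (simp add: add_divide_distrib)
    have dec: "(1/8 :: real) ^ Suc k \<le> (1/8) ^ k" by simp
    \<comment> \<open>Parallelogram law: the linear parts of \<open>Q\<close> cancel, since
      \<Lambda> at the midpoint is the mean of its two values.\<close>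
    have "n2 (\<lambda>x. ?f x - ?g x) = 2 * Q ?f + 2 * Q ?g - 4 * Q ?mid"
      unfolding Q_def e4 e3 e1 e2 by (simp add: field_simps)
    also have "2 * Q ?f + 2 * Q ?g - 4 * Q ?mid \<le> 4 * (1/8) ^ k"
    proof -
      have "2 * p + 2 * q - 4 * r \<le> 4 * e"
        if "p < m + d" "q < m + e" "m \<le> r" "d \<le> e" for p q r d e :: real
        using that by linarith
      from this[OF hQ hQ m_le[OF mid] dec] show ?thesis .
    qed
    finally show ?thesis by simp
  qed
  obtain G D where G[measurable]: "G \<in> borel_measurable M" and D: "integrable M D"
    and lim: "AE x in M. (\<lambda>k. h k x) \<longlonglongrightarrow> G x" and dom: "AE x in M. \<forall>k. (norm (h k x))\<^sup>2 \<le> D x"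
    using square_integrable_limit[OF V[OF hV] diff[unfolded n2_def]] by blast
  note [measurable] = square_integrable_measurable[OF V[OF hV]]
  have domk: "AE x in M. (norm (h k x))\<^sup>2 \<le> D x" for k
    using dom by eventually_elim auto
  have GD: "AE x in M. (norm (G x))\<^sup>2 \<le> D x"
    using lim dom
  proof eventually_elim
    fix x assume "(\<lambda>k. h k x) \<longlonglongrightarrow> G x" "\<forall>k. (norm (h k x))\<^sup>2 \<le> D x"
    then show "(norm (G x))\<^sup>2 \<le> D x"
      by (intro LIMSEQ_le_const2[of "\<lambda>k. (norm (h k x))\<^sup>2"] tendsto_intros) auto
  qed
  have Gsq: "square_integrable M G"
    unfolding square_integrable_def
  proof
    show "integrable M (\<lambda>x. (norm (G x))\<^sup>2)"
      by (rule integrable_dominated[OF D]) (use GD in auto)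
  qed measurable
  have n2lim: "(\<lambda>k. n2 (h k)) \<longlonglongrightarrow> n2 G"
    unfolding n2_def
  proof (rule integral_dominated_convergence[OF _ _ D])
    show "AE x in M. (\<lambda>k. (norm (h k x))\<^sup>2) \<longlonglongrightarrow> (norm (G x))\<^sup>2"
      using lim by eventually_elim (intro tendsto_intros)
    show "AE x in M. norm ((norm (h k x))\<^sup>2) \<le> D x" for k
      using domk[of k] by simp
  qed measurable
  have pair_lim: "(\<lambda>k. LINT x|M. cnj (h k x) * f x) \<longlonglongrightarrow> (LINT x|M. cnj (G x) * f x)"
    if f: "square_integrable M f" for f
  proof (rule integral_dominated_convergence)
    note [measurable] = square_integrable_measurable[OF f]
    show "integrable M (\<lambda>x. D x + (norm (f x))\<^sup>2)"
      using D f by (simp add: square_integrable_def)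
    show "AE x in M. (\<lambda>k. cnj (h k x) * f x) \<longlonglongrightarrow> cnj (G x) * f x"
      using lim by eventually_elim (intro tendsto_intros)
    show "AE x in M. norm (cnj (h k x) * f x) \<le> D x + (norm (f x))\<^sup>2" for k
      using domk[of k]
    proof eventually_elim
      fix x assume "(norm (h k x))\<^sup>2 \<le> D x"
      then show "norm (cnj (h k x) * f x) \<le> D x + (norm (f x))\<^sup>2"
        using norm_mult_le_squares[of "cnj (h k x)" "f x"] by simp
    qed
    show "(\<lambda>x. cnj (G x) * f x) \<in> borel_measurable M" "(\<lambda>x. cnj (h k x) * f x) \<in> borel_measurable M" for k
      by measurable
  qed
  have Re_eq: "Re (LINT x|M. cnj (G x) * f x) = Re (\<Lambda> f)" if f: "f \<in> V" for f
  proof -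
    \<comment> \<open>\<open>G\<close> itself may lie outside \<open>V\<close>, so the variation is
      made around \<open>h k\<close>, which minimises up to 8^(-k). Taking \<open>t\<close> as plus
      or minus the square root of this slack balances the terms and makes \<open>b k\<close> of
      order \<open>s k\<close>.\<close>
    define b where "b k = Re (LINT x|M. cnj (h k x) * f x) - Re (\<Lambda> f)" for k
    define s where "s k = sqrt ((1/8) ^ k)" for k :: nat
    have s: "s k > 0" "(s k)\<^sup>2 = (1/8) ^ k" for k by (simp_all add: s_def)
    have "\<bar>b k\<bar> \<le> s k * ((1 + n2 f) / 2)" for k
    proof -
      have "- (t * 2 * b k) \<le> (s k)\<^sup>2 + t\<^sup>2 * n2 f" for t
      proof -
        let ?g = "\<lambda>x. h k x + complex_of_real t * f x"
        have "Q ?g = Q (h k) + 2 * t * b k + t\<^sup>2 * n2 f"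
          unfolding Q_def b_def expand[OF hV f] add[OF hV Vscale[OF f]] scale[OF f]
          by (simp add: algebra_simps)
        moreover have "m \<le> Q ?g"
          by (intro m_le Vadd Vscale hV f)
        ultimately show ?thesis using hQ[of k] s(2)[of k] by simp
      qed
      from this[of "s k"] this[of "- s k"]
      have "2 * s k * \<bar>b k\<bar> \<le> (s k)\<^sup>2 + (s k)\<^sup>2 * n2 f"
        by (cases "b k \<ge> 0") auto
      then have "s k * (2 * \<bar>b k\<bar>) \<le> s k * (s k * (1 + n2 f))"
        by (simp add: power2_eq_square algebra_simps)
      then show ?thesis using s(1)[of k] by simp
    qed
    moreover have "(\<lambda>k. s k * ((1 + n2 f) / 2)) \<longlonglongrightarrow> sqrt 0 * ((1 + n2 f) / 2)"
      unfolding s_def by (intro tendsto_intros LIMSEQ_power_zero) simp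
    ultimately have "b \<longlonglongrightarrow> 0"
      by (intro tendsto_0_le[of "\<lambda>k. s k * ((1 + n2 f) / 2)" sequentially b 1])
        (auto intro!: always_eventually simp: s_def n2_0 add_nonneg_nonneg)
    moreover have "b \<longlonglongrightarrow> Re (LINT x|M. cnj (G x) * f x) - Re (\<Lambda> f)"
      unfolding b_def by (intro tendsto_intros pair_lim V f)
    ultimately show ?thesis using LIMSEQ_unique by fastforce
  qed
  show thesis
  proof (rule that)
    \<comment> \<open>The variation produces a pairing with the conjugate of the limit, while the
      representation is bilinear; hence the conjugate is the function supplied.\<close>
    show "square_integrable M (\<lambda>x. cnj (G x))" by (rule square_integrable_cnj[OF Gsq])
    show "\<Lambda> f = (LINT x|M. cnj (G x) * f x)" if f: "f \<in> V" for f
    proof (rule complex_eqI)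
      show "Re (\<Lambda> f) = Re (LINT x|M. cnj (G x) * f x)" using Re_eq[OF f] by simp
      \<comment> \<open>The imaginary parts follow from the identity of real parts at
        \<open>\<i> * f\<close>.\<close>
      have "Re (LINT x|M. cnj (G x) * (\<i> * f x)) = Re (\<Lambda> (\<lambda>x. \<i> * f x))"
        by (rule Re_eq[OF Vscale[OF f]])
      moreover have "(LINT x|M. cnj (G x) * (\<i> * f x)) = \<i> * (LINT x|M. cnj (G x) * f x)"
        unfolding mult.left_commute[of _ \<i>] by simp
      ultimately show "Im (\<Lambda> f) = Im (LINT x|M. cnj (G x) * f x)"
        by (simp add: scale[OF f])
    qed
    \<comment> \<open>The bound on \<Lambda> is available at \<open>h k\<close> but not at the
      limit; testing with \<open>h k\<close> and letting \<open>k\<close> grow gives n2 G \<le> B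
      sqrt (n2 G).\<close>
    have "(\<lambda>k. Re (LINT x|M. cnj (h k x) * G x)) \<longlonglongrightarrow> Re (LINT x|M. cnj (G x) * G x)"
      by (intro tendsto_Re pair_lim Gsq)
    moreover have "Re (LINT x|M. cnj (h k x) * G x) = Re (LINT x|M. cnj (G x) * h k x)" for k
    proof -
      have "(LINT x|M. cnj (h k x) * G x) = (LINT x|M. cnj (cnj (G x) * h k x))"
        by (simp add: mult.commute)
      also have "\<dots> = cnj (LINT x|M. cnj (G x) * h k x)" by (rule Bochner_Integration.integral_cnj)
      finally show ?thesis by simp
    qed
    moreover have "Re (LINT x|M. cnj (G x) * h k x) \<le> B * sqrt (n2 (h k))" for k
      unfolding Re_eq[OF hV] by (rule Re\<Lambda>[OF hV])
    moreover have "(\<lambda>k. B * sqrt (n2 (h k))) \<longlonglongrightarrow> B * sqrt (n2 G)"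
      by (intro tendsto_intros n2lim)
    ultimately have "Re (LINT x|M. cnj (G x) * G x) \<le> B * sqrt (n2 G)"
      by (intro LIMSEQ_le) auto
    moreover have "(LINT x|M. cnj (G x) * G x) = complex_of_real (n2 G)"
      unfolding n2_def integral_complex_of_real[symmetric]
      by (intro Bochner_Integration.integral_cong refl) (metis complex_norm_square mult.commute)
    ultimately have "n2 G \<le> B * sqrt (n2 G)" by simp
    then have "n2 G \<le> B\<^sup>2"
    proof (cases "n2 G = 0")
      case False
      then have p: "sqrt (n2 G) > 0" using n2_0[of G] by simp
      assume "n2 G \<le> B * sqrt (n2 G)"
      then have "sqrt (n2 G) * sqrt (n2 G) \<le> B * sqrt (n2 G)" using n2_0[of G] by simp
      then have "sqrt (n2 G) \<le> B" using p by (rule mult_right_le_imp_le)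
      then have "(sqrt (n2 G))\<^sup>2 \<le> B\<^sup>2" using n2_0[of G] by (intro power_mono) auto
      then show ?thesis using n2_0[of G] by simp
    qed simp
    then show "(LINT x|M. (norm (cnj (G x)))\<^sup>2) \<le> B\<^sup>2" by (simp add: n2_def)
  qed
qed

subsection \<open>Locally integrable functions as distributions\<close>

lemma locally_integrable_cball:
  "locally_integrable g \<Longrightarrow> integrable lborel (\<lambda>x. indicator (cball 0 r) x *\<^sub>R g x)"
  by (simp add: locally_integrable_def set_integrable_def)

lemma locally_integrable_measurable:
  assumes "locally_integrable g"
  shows "g \<in> borel_measurable borel"
proof (rule borel_measurable_LIMSEQ_metric)
  show "(\<lambda>x. indicator (cball 0 (real k)) x *\<^sub>R g x) \<in> borel_measurable borel" for k
    using locally_integrable_cball[OF assms, of "real k"] by auto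
  show "(\<lambda>k. indicator (cball 0 (real k)) x *\<^sub>R g x) \<longlonglongrightarrow> g x" for x
  proof (rule tendsto_eventually)
    obtain N :: nat where "norm x \<le> real N" using real_arch_simple by blast
    then show "\<forall>\<^sub>F k in sequentially. indicator (cball 0 (real k)) x *\<^sub>R g x = g x"
      by (auto simp: eventually_sequentially indicator_def intro!: exI[of _ N])
  qed
qed

lemma square_integrable_locally_integrable:
  assumes g: "square_integrable lborel g"
  shows "locally_integrable g"
  unfolding locally_integrable_def
proof (intro allI impI)
  fix K :: "(real ^ 'a) set" assume K: "compact K"
  have K': "K \<in> sets lborel" "emeasure lborel K < \<infinity>"
    using K emeasure_bounded_finite[OF compact_imp_bounded[OF K]] by (auto simp: compact_imp_closed)
  have e: "(norm (complex_of_real (indicator K x)))\<^sup>2 = (indicator K x :: real)" for x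
    by (simp add: indicator_def)
  have "square_integrable lborel (\<lambda>x. complex_of_real (indicator K x))"
    unfolding square_integrable_def e using K' by auto
  from square_integrable_mult[OF this g] show "set_integrable lborel K g"
    unfolding set_integrable_def scaleR_conv_of_real .
qed

lemma locally_integrable_mult_continuous:
  assumes g: "locally_integrable g" and a: "continuous_on UNIV a"
  shows "locally_integrable (\<lambda>x. a x * g x)"
  unfolding locally_integrable_def
proof (intro allI impI)
  fix K :: "(real ^ 'a) set" assume K: "compact K"
  then have "compact (a ` K)"
    using a by (meson compact_continuous_image continuous_on_subset subset_UNIV)
  then obtain B where B: "\<And>x. x \<in> K \<Longrightarrow> norm (a x) \<le> B"
    using compact_imp_bounded bounded_iff by (metis imageI)
  note [measurable] = locally_integrable_measurable[OF g] borel_measurable_continuous_onI[OF a]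
  have [measurable]: "K \<in> sets borel" using K by (simp add: borel_compact)
  have "integrable lborel (\<lambda>x. indicator K x *\<^sub>R g x)"
    using g K by (simp add: locally_integrable_def set_integrable_def)
  then have i: "integrable lborel (\<lambda>x. B * norm (indicator K x *\<^sub>R g x))"
    by (intro integrable_mult_right integrable_norm)
  show "set_integrable lborel K (\<lambda>x. a x * g x)"
    unfolding set_integrable_def
  proof (rule integrable_dominated[OF i])
    show "AE x in lborel. norm (indicator K x *\<^sub>R (a x * g x)) \<le> norm (B * norm (indicator K x *\<^sub>R g x))"
    proof (rule AE_I2)
      fix x
      show "norm (indicator K x *\<^sub>R (a x * g x)) \<le> norm (B * norm (indicator K x *\<^sub>R g x))"
      proof (cases "x \<in> K")
        case True
        then have "norm (a x) * norm (g x) \<le> B * norm (g x)" "B \<ge> 0"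
          using mult_right_mono[OF B[OF True] norm_ge_zero[of "g x"]] order_trans[OF norm_ge_zero B[OF True]]
          by auto
        then show ?thesis using True by (simp add: norm_mult)
      qed simp
    qed
  qed measurable
qed

lemma pderivs_const: "pderivs \<alpha> (\<lambda>x. c) = (\<lambda>x. if \<alpha> = [] then c else 0)"
  by (induction \<alpha>) (auto simp: pderivs_Cons_pd pd_const)

lemma pderivs_cmult:
  assumes "smooth f"
  shows "pderivs \<alpha> (\<lambda>x. c * f x) = (\<lambda>x. c * pderivs \<alpha> f x)"
proof (induction \<alpha>)
  case (Cons i \<alpha>)
  have "pderivs \<alpha> f differentiable (at x)" for x
    using assms smooth_iff by blast
  then show ?case
    unfolding pderivs_Cons_pd Cons.IH by (intro ext, subst pd_mult) (auto simp: pd_const)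
qed simp

lemma locally_integrable_mult_test:
  assumes g: "locally_integrable g" and h: "h \<in> \<S>" and b: "bounded {x. h x \<noteq> 0}"
  shows "integrable lborel (\<lambda>x. g x * h x)"
proof -
  obtain r where r: "\<And>x. h x \<noteq> 0 \<Longrightarrow> norm x \<le> r"
    using b by (auto simp: bounded_iff)
  have "integrable lborel (\<lambda>x. indicator (cball 0 r) x *\<^sub>R (h x * g x))"
    by (intro locally_integrable_cball locally_integrable_mult_continuous g
        smooth_continuous schwartz_smooth h)
  moreover have "indicator (cball 0 r) x *\<^sub>R (h x * g x) = g x * h x" for x
    using r[of x] by (cases "h x = 0") auto
  ultimately show ?thesis by simp
qed

section \<open>Cutoff functions and pairing with all Schwartz functions\<close>

context
  fixes \<phi> :: "real ^ 'n::finite \<Rightarrow> real"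
  assumes gen: "dyadic_generator \<phi>"
begin

lemma generator_schwartz: "(\<lambda>x. complex_of_real (\<phi> x)) \<in> \<S>"
  and generator_nonneg: "0 \<le> \<phi> x"
  and generator_antimono: "0 \<le> r \<Longrightarrow> r \<le> s \<Longrightarrow> \<phi> (s *\<^sub>R x) \<le> \<phi> (r *\<^sub>R x)"
  and generator_eq_0: "norm x > 3 / 2 \<Longrightarrow> \<phi> x = 0"
  and generator_eq_1: "norm x \<le> 1 \<Longrightarrow> \<phi> x = 1"
  using gen unfolding dyadic_generator_def by blast+

lemma generator_le_1: "\<phi> x \<le> 1"
  using generator_antimono[of 0 1 x] generator_eq_1[of 0] by simp

lemma generator_measurable: "\<phi> \<in> borel_measurable borel"
  using measurable_compose[OF schwartz_measurable[OF generator_schwartz] borel_measurable_Re] by simp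

text \<open>The plateau of the generator gives bump functions equal to 1 on the ball of radius k +
  1; \<open>Suc\<close> avoids the inverse of 0 at k = 0.\<close>

definition cutoff :: "nat \<Rightarrow> real ^ 'n \<Rightarrow> complex" where
  "cutoff k x = complex_of_real (\<phi> (inverse (real (Suc k)) *\<^sub>R x))"

lemma cutoff_schwartz: "cutoff k \<in> \<S>"
  using schwartz_scale[OF generator_schwartz, of "inverse (real (Suc k))"]
  by (simp add: cutoff_def[abs_def])

lemma cutoff_bounded_support: "bounded {x. cutoff k x \<noteq> 0}"
proof -
  have "norm x \<le> 3 / 2 * real (Suc k)" if "cutoff k x \<noteq> 0" for x
  proof (rule ccontr)
    assume "\<not> norm x \<le> 3 / 2 * real (Suc k)"
    then have "norm (inverse (real (Suc k)) *\<^sub>R x) > 3 / 2"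
      by (simp add: field_simps)
    from generator_eq_0[OF this] that show False by (simp add: cutoff_def)
  qed
  then show ?thesis unfolding bounded_iff by blast
qed

lemma cutoff_eq_1: "norm x \<le> real (Suc k) \<Longrightarrow> cutoff k x = 1"
  unfolding cutoff_def by (subst generator_eq_1) (auto simp: field_simps)

lemma norm_cutoff: "norm (cutoff k x) \<le> 1"
  by (simp add: cutoff_def generator_nonneg generator_le_1)

text \<open>Near a point of norm below k + 1 the product vanishes. Elsewhere the derivatives of 1 -
  cutoff are bounded uniformly in \<open>k\<close>, and one surplus power of the weight, taken from
  the seminorm of order \<open>Suc N\<close> of \<open>h\<close>, yields a factor 1/(k + 1).\<close>

lemma cutoff_remainder_tendsto:
  assumes h: "h \<in> \<S>"
  shows "(\<lambda>k. schwartz_seminorm N (\<lambda>x. (1 - cutoff k x) * h x)) \<longlonglongrightarrow> 0"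
proof -
  let ?\<chi> = "\<lambda>x. - 1 * complex_of_real (\<phi> x)"
  have \<chi>: "?\<chi> \<in> \<S>" by (rule schwartz_cmult[OF generator_schwartz])
  \<comment> \<open>Bounds all derivatives up to order \<open>N\<close> of 1 minus the generator;
    dilating by a factor at most 1 keeps them below the same bound.\<close>
  define A where "A = 1 + schwartz_seminorm N ?\<chi>"
  have A0: "A \<ge> 0" using schwartz_seminorm_nonneg[OF \<chi>] by (simp add: A_def)
  have sm1: "smooth (\<lambda>x::real^'n. 1)"
    using multiplier_smooth[OF multiplier_const[of 1]] .
  have sm: "smooth (\<lambda>x. 1 + ?\<chi> x)"
    by (intro smooth_add sm1 schwartz_smooth \<chi>)
  have A: "norm (pderivs \<beta> (\<lambda>x. 1 + ?\<chi> x) x) \<le> A" if "length \<beta> \<le> N" for \<beta> x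
    unfolding pderivs_add[OF sm1 schwartz_smooth[OF \<chi>]] A_def
    using schwartz_seminorm_ge[OF \<chi> that, of 0 x]
    by (intro order_trans[OF norm_triangle_ineq] add_mono) (auto simp: pderivs_const)
  define B where "B = schwartz_seminorm (Suc N) h"
  have bound: "schwartz_seminorm N (\<lambda>x. (1 - cutoff k x) * h x) \<le> 2 ^ N * (A * B) * inverse (real (Suc k))" for k
  proof (rule schwartz_seminorm_le)
    fix \<alpha> :: "'n list" and x :: "real ^ 'n" assume l: "length \<alpha> \<le> N"
    let ?c = "inverse (real (Suc k))"
    have eq: "(\<lambda>x. 1 - cutoff k x) = (\<lambda>x. 1 + ?\<chi> (?c *\<^sub>R x + 0))"
      by (simp add: cutoff_def)
    have sk: "smooth (\<lambda>x. 1 - cutoff k x)"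
      unfolding eq by (rule smooth_affine[OF sm])
    have Ak: "norm (pderivs \<beta> (\<lambda>x. 1 - cutoff k x) x) \<le> A" if "length \<beta> \<le> N" for \<beta>
    proof -
      have "norm (pderivs \<beta> (\<lambda>x. 1 - cutoff k x) x) \<le> ?c ^ length \<beta> * A"
        unfolding eq pderivs_affine[OF sm] norm_mult norm_power norm_of_real
        by (intro mult_mono A that) auto
      also have "\<dots> \<le> 1 * A"
        using A0 by (intro mult_right_mono power_le_one) (auto simp: field_simps)
      finally show ?thesis by simp
    qed
    show "(1 + norm x) ^ N * norm (pderivs \<alpha> (\<lambda>x. (1 - cutoff k x) * h x) x) \<le> 2 ^ N * (A * B) * ?c"
    proof (cases "norm x < real (Suc k)")
      case True
      have "pderivs \<alpha> (\<lambda>x. (1 - cutoff k x) * h x) x = pderivs \<alpha> (\<lambda>x. 0) x"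
        by (rule pderivs_cong_open[of "ball 0 (real (Suc k))"]) (use True cutoff_eq_1 in auto)
      then show ?thesis
        using A0 schwartz_seminorm_nonneg[OF h] by (simp add: pderivs_const B_def)
    next
      case False
      have pos: "1 + norm x > 0" by (rule add_pos_nonneg) auto
      have Bk: "norm (pderivs \<beta> h x) \<le> B / (1 + norm x) ^ Suc N" if "length \<beta> \<le> N" for \<beta>
        using schwartz_seminorm_ge[OF h, of \<beta> "Suc N" "Suc N" x] that zero_less_power[OF pos, of "Suc N"]
        by (simp add: B_def pos_le_divide_eq mult.commute del: power_Suc)
      have "norm (pderivs \<alpha> (\<lambda>x. (1 - cutoff k x) * h x) x) \<le> 2 ^ length \<alpha> * (A * (B / (1 + norm x) ^ Suc N))"
        by (rule leibniz_bound[OF sk schwartz_smooth[OF h] Ak Bk l])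
      also have "\<dots> \<le> 2 ^ N * (A * (B / (1 + norm x) ^ Suc N))"
        using l A0 schwartz_seminorm_nonneg[OF h] pos
        by (intro mult_right_mono power_increasing) (auto simp: B_def)
      finally have "(1 + norm x) ^ N * norm (pderivs \<alpha> (\<lambda>x. (1 - cutoff k x) * h x) x) \<le>
          (1 + norm x) ^ N * (2 ^ N * (A * (B / (1 + norm x) ^ Suc N)))"
        using pos by (intro mult_left_mono) auto
      also have "\<dots> = 2 ^ N * (A * B) * inverse (1 + norm x)"
      proof -
        have "u ^ N * (c * (A * (B / u ^ Suc N))) = c * (A * B) * inverse u" if "u > 0" for u c :: real
          using that by (simp add: field_simps)
        from this[OF pos] show ?thesis .
      qed
      also have "\<dots> \<le> 2 ^ N * (A * B) * ?c"
        using False A0 schwartz_seminorm_nonneg[OF h]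
        by (intro mult_left_mono le_imp_inverse_le) (auto simp: B_def)
      finally show ?thesis .
    qed
  qed
  have mem: "(\<lambda>x. (1 - cutoff k x) * h x) \<in> \<S>" for k
  proof -
    have "(\<lambda>x. h x - cutoff k x * h x) \<in> \<S>"
      by (intro schwartz_diff schwartz_mult schwartz_multiplier cutoff_schwartz h)
    then show ?thesis by (simp add: algebra_simps)
  qed
  have "(\<lambda>k. 2 ^ N * (A * B) * inverse (real (Suc k))) \<longlonglongrightarrow> 2 ^ N * (A * B) * 0"
    by (intro tendsto_intros LIMSEQ_inverse_real_of_nat)
  then have "(\<lambda>k. 2 ^ N * (A * B) * inverse (real (Suc k))) \<longlonglongrightarrow> 0" by simp
  then show ?thesis
    by (rule tendsto_sandwich[OF always_eventually always_eventually tendsto_const, rotated 2])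
      (use bound schwartz_seminorm_nonneg[OF mem] in auto)
qed

text \<open>\<open>T\<close> is continuous and the product of \<open>g\<close> and \<open>h\<close>
  is integrable, so both sides pass to the limit along the compactly supported cutoffs of
  \<open>h\<close>. After this \<open>g\<close> can be paired with Fourier transforms of Schwartz
  functions.\<close>

lemma represents_square_integrable:
  fixes h :: "real ^ 'n \<Rightarrow> complex"
  assumes T: "T \<in> tempered_distributions" and rep: "represents g T"
    and g: "square_integrable lborel g" and h: "h \<in> \<S>"
  shows "T h = (LINT x|lborel. g x * h x)"
proof -
  note [measurable] = square_integrable_measurable[OF g] schwartz_measurable[OF h]
    schwartz_measurable[OF cutoff_schwartz]
  have add: "T (\<lambda>x. f x + f' x) = T f + T f'" if "f \<in> \<S>" "f' \<in> \<S>" for f f'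
    using T that by (auto simp: tempered_distributions_def)
  obtain N C where C: "\<And>f. f \<in> \<S> \<Longrightarrow> norm (T f) \<le> C * schwartz_seminorm N f"
    using T unfolding tempered_distributions_def by blast
  let ?h = "\<lambda>k x. cutoff k x * h x"
  have hk: "?h k \<in> \<S>" for k
    by (intro schwartz_mult schwartz_multiplier cutoff_schwartz h)
  have rk: "(\<lambda>x. (1 - cutoff k x) * h x) \<in> \<S>" for k
    using schwartz_diff[OF h hk[of k]] by (simp add: algebra_simps)
  have sq_h: "square_integrable lborel h"
    using schwartz_square_integrable[OF h] schwartz_measurable[OF h] by (simp add: square_integrable_def)
  have "T (?h k) = (LINT x|lborel. g x * ?h k x)" for k
  proof -
    have "bounded {x. ?h k x \<noteq> 0}"
      by (rule bounded_subset[OF cutoff_bounded_support[of k]]) auto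
    then show ?thesis using rep hk[of k] by (simp add: represents_def)
  qed
  moreover have "(\<lambda>k. LINT x|lborel. g x * ?h k x) \<longlonglongrightarrow> (LINT x|lborel. g x * h x)"
  proof (rule integral_dominated_convergence)
    show "integrable lborel (\<lambda>x. norm (g x * h x))"
      by (intro integrable_norm square_integrable_mult g sq_h)
    show "AE x in lborel. (\<lambda>k. g x * ?h k x) \<longlonglongrightarrow> g x * h x"
    proof (intro AE_I2 tendsto_eventually)
      fix x :: "real ^ 'n"
      obtain M :: nat where M: "norm x \<le> real M" using real_arch_simple by blast
      show "\<forall>\<^sub>F k in sequentially. g x * ?h k x = g x * h x"
        unfolding eventually_sequentially using M by (intro exI[of _ M]) (auto simp: cutoff_eq_1)
    qed
    show "AE x in lborel. norm (g x * ?h k x) \<le> norm (g x * h x)" for k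
      using norm_cutoff by (intro AE_I2) (auto simp: norm_mult intro!: mult_left_mono mult_left_le_one_le)
  qed measurable
  moreover have "(\<lambda>k. T (?h k)) \<longlonglongrightarrow> T h"
  proof -
    have "T h = T (?h k) + T (\<lambda>x. (1 - cutoff k x) * h x)" for k
      using add[OF hk[of k] rk[of k]] by (simp add: algebra_simps)
    then have "norm (T (?h k) - T h) \<le> C * schwartz_seminorm N (\<lambda>x. (1 - cutoff k x) * h x)" for k
      using C[OF rk[of k]] by (metis add_diff_cancel_left' norm_minus_commute)
    moreover have "(\<lambda>k. C * schwartz_seminorm N (\<lambda>x. (1 - cutoff k x) * h x)) \<longlonglongrightarrow> C * 0"
      by (intro tendsto_intros cutoff_remainder_tendsto h)
    ultimately have "(\<lambda>k. T (?h k) - T h) \<longlonglongrightarrow> 0"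
      by (intro Lim_null_comparison[of "\<lambda>k. T (?h k) - T h"]) auto
    then show ?thesis by (rule LIM_zero_cancel)
  qed
  ultimately show ?thesis
    using LIMSEQ_unique by fastforce
qed

end

section \<open>Mollification and uniqueness of the representing function\<close>

text \<open>Away from the frontier the indicator of \<open>B\<close> is locally constant, so for
  each fixed \<open>z\<close> the integrand is eventually constant in \<open>m\<close>.\<close>

lemma mollified_indicator_tendsto:
  fixes y :: "real ^ 'n::finite"
  assumes y: "y \<notin> frontier B"
    and k: "integrable lborel k" and kb: "\<And>z. norm z > R \<Longrightarrow> k z = (0::real)" and B: "B \<in> sets borel"
  shows "(\<lambda>m. LINT z|lborel. indicator B (y - inverse (real (Suc m)) *\<^sub>R z) * k z) \<longlonglongrightarrow>
    (LINT z|lborel. indicator B y * k z)"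
proof (rule integral_dominated_convergence)
  have [measurable]: "k \<in> borel_measurable borel" using k by auto
  note [measurable] = B
  show "integrable lborel (\<lambda>z. norm (k z))" using k by (rule integrable_norm)
  show "AE z in lborel. norm (indicator B (y - inverse (real (Suc m)) *\<^sub>R z) * k z) \<le> norm (k z)" for m
    by (intro AE_I2) (auto simp: indicator_def)
  show "AE z in lborel. (\<lambda>m. indicator B (y - inverse (real (Suc m)) *\<^sub>R z) * k z) \<longlonglongrightarrow> indicator B y * k z"
  proof (intro AE_I2 tendsto_mult tendsto_const)
    fix z :: "real ^ 'n"
    have "(\<lambda>m. y - inverse (real (Suc m)) *\<^sub>R z) \<longlonglongrightarrow> y - 0 *\<^sub>R z"
      by (intro tendsto_intros LIMSEQ_inverse_real_of_nat)
    then have lim: "(\<lambda>m. y - inverse (real (Suc m)) *\<^sub>R z) \<longlonglongrightarrow> y" by simp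
    show "(\<lambda>m. indicator B (y - inverse (real (Suc m)) *\<^sub>R z) :: real) \<longlonglongrightarrow> indicator B y"
    proof (rule tendsto_eventually)
      show "\<forall>\<^sub>F m in sequentially. indicator B (y - inverse (real (Suc m)) *\<^sub>R z) = (indicator B y :: real)"
      proof (cases "y \<in> interior B")
        case True
        from topological_tendstoD[OF lim open_interior True] show ?thesis
          by eventually_elim (use True interior_subset in \<open>auto simp: indicator_def\<close>)
      next
        case False
        then have out: "y \<in> - closure B" using y by (auto simp: frontier_def)
        from topological_tendstoD[OF lim open_Compl[OF closed_closure] out] show ?thesis
          by eventually_elim (use out closure_subset in \<open>auto simp: indicator_def\<close>)
      qed
    qed
  qed
qed (use k B in measurable)

context
  fixes \<phi> :: "real ^ 'n::finite \<Rightarrow> real"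
  assumes gen: "dyadic_generator \<phi>"
begin

lemma generator_integrable: "integrable lborel \<phi>"
  using integrable_Re[OF schwartz_integrable[OF generator_schwartz[OF gen]]] by simp

text \<open>Stands in for normalising the mollifier: the limit carries this constant and is divided
  by it.\<close>

lemma generator_integral_pos: "0 < integral\<^sup>L lborel \<phi>"
proof -
  have fin: "emeasure lborel (cball (0 :: real^'n) 1) < \<infinity>"
    by (rule emeasure_bounded_finite) simp
  have "0 < measure lborel (cball (0 :: real^'n) 1)"
    using content_ball_pos[of 1 "0 :: real^'n"] content_cball_pos[of 1 "0 :: real^'n"] by simp
  also have "\<dots> = (LINT x|lborel. indicator (cball (0 :: real^'n) 1) x)" by simp
  also have "\<dots> \<le> integral\<^sup>L lborel \<phi>"
  proof (intro integral_mono generator_integrable)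
    show "integrable lborel (indicator (cball (0 :: real^'n) 1) :: _ \<Rightarrow> real)"
      using fin by simp
  qed (auto simp: indicator_def generator_eq_1[OF gen] generator_nonneg[OF gen])
  finally show ?thesis .
qed

text \<open>Every small dilate of the generator centred at a point of the box is a test function.
  Averaging these vanishing integrals over the centres and applying Fubini shows that the integral
  of \<open>g\<close> against the mollified indicator \<open>f m\<close> is 0; that indicator tends
  to a multiple of the true one off the null frontier.\<close>

lemma integral_box_eq_0:
  fixes g :: "real ^ 'n \<Rightarrow> complex"
  assumes g: "locally_integrable g"
    and zero: "\<And>h. h \<in> \<S> \<Longrightarrow> bounded {x. h x \<noteq> 0} \<Longrightarrow> (LINT x|lborel. g x * h x) = 0"
  shows "(LINT y|lborel. indicator (box a b) y *\<^sub>R g y) = 0"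
proof -
  define B where "B = box a b"
  have [measurable]: "B \<in> sets borel" by (simp add: B_def)
  note [measurable] = locally_integrable_measurable[OF g] generator_measurable[OF gen]
  have bB: "bounded B" by (simp add: B_def bounded_box)
  then obtain R where R: "\<And>x. x \<in> B \<Longrightarrow> norm x \<le> R" by (auto simp: bounded_iff)
  \<comment> \<open>For centres in \<open>B\<close> and scale at most 1 the dilates live in the ball
    of radius R + 3/2, where \<open>g\<close> agrees with the globally integrable
    \<open>G\<close>.\<close>
  define R' where "R' = R + 3 / 2"
  define G where "G y = indicator (cball 0 R') y *\<^sub>R g y" for y
  have Gint: "integrable lborel G"
    unfolding G_def[abs_def] by (rule locally_integrable_cball[OF g])
  then have [measurable]: "G \<in> borel_measurable borel" by auto
  have Bint: "integrable lborel (indicator B :: _ \<Rightarrow> real)"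
    using emeasure_bounded_finite[OF bB] by simp
  define \<epsilon> where "\<epsilon> m = inverse (real (Suc m))" for m
  have \<epsilon>: "0 < \<epsilon> m" "\<epsilon> m \<le> 1" for m by (simp_all add: \<epsilon>_def field_simps)
  define f where "f m y = (LINT z|lborel. indicator B (y - \<epsilon> m *\<^sub>R z) * \<phi> z)" for m y
  have key: "(LINT y|lborel. G y * complex_of_real (f m y)) = 0" for m
  proof -
    let ?\<phi> = "\<lambda>x y. \<phi> (inverse (\<epsilon> m) *\<^sub>R (y - x))"
    let ?\<Psi> = "\<lambda>x y. indicator B x *\<^sub>R (G y * complex_of_real (?\<phi> x y))"
    have supp: "norm (y - x) \<le> 3 / 2" if "?\<phi> x y \<noteq> 0" for x y
    proof (rule ccontr)
      assume "\<not> norm (y - x) \<le> 3 / 2"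
      then have "3 / 2 < norm (y - x)" by simp
      also have "\<dots> \<le> norm (y - x) / \<epsilon> m"
        using \<epsilon>[of m] by (simp add: field_simps mult_left_le_one_le)
      finally have "norm (inverse (\<epsilon> m) *\<^sub>R (y - x)) > 3 / 2"
        using \<epsilon>[of m] unfolding norm_scaleR by (simp add: field_simps)
      from generator_eq_0[OF gen this] that show False by simp
    qed
    have inner0: "(LINT y|lborel. ?\<Psi> x y) = 0" for x
    proof (cases "x \<in> B")
      case True
      let ?h = "\<lambda>y. complex_of_real (?\<phi> x y)"
      have "?h = (\<lambda>y. complex_of_real (\<phi> (inverse (\<epsilon> m) *\<^sub>R y + (- inverse (\<epsilon> m) *\<^sub>R x))))"
        by (simp add: scaleR_diff_right)
      also have "\<dots> \<in> \<S>"
        using \<epsilon>[of m] by (intro schwartz_affine generator_schwartz[OF gen]) auto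
      finally have h: "?h \<in> \<S>" .
      have "norm y \<le> norm x + 3 / 2" if "?h y \<noteq> 0" for y
        using supp[of y x] that norm_triangle_ineq2[of y x] by simp
      then have "bounded {y. ?h y \<noteq> 0}" unfolding bounded_iff by blast
      from zero[OF h this] have "(LINT y|lborel. g y * ?h y) = 0" .
      moreover have "?\<Psi> x y = g y * ?h y" for y
        using supp[of y x] R[OF True] norm_triangle_ineq2[of y x] True
        by (cases "?h y = 0") (auto simp: G_def R'_def indicator_def)
      ultimately show ?thesis by (simp only:)
    qed simp
    have "integrable (lborel \<Otimes>\<^sub>M lborel) (\<lambda>(x, y). ?\<Psi> x y)"
    proof (rule integrable_dominated)
      show "integrable (lborel \<Otimes>\<^sub>M lborel) (\<lambda>(x, y). indicator B x *\<^sub>R G y)"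
      proof (rule lborel_pair.Fubini_integrable)
        have "integrable lborel (\<lambda>x. indicator B x * (LINT y|lborel. norm (G y)))"
          using Bint by (rule integrable_mult_left)
        then show "integrable lborel (\<lambda>x. LINT y|lborel. norm (case (x, y) of (x, y) \<Rightarrow> indicator B x *\<^sub>R G y))"
          by simp
        show "AE x in lborel. integrable lborel (\<lambda>y. case (x, y) of (x, y) \<Rightarrow> indicator B x *\<^sub>R G y)"
          using Gint by simp
      qed measurable
      show "AE p in lborel \<Otimes>\<^sub>M lborel. norm (case p of (x, y) \<Rightarrow> ?\<Psi> x y) \<le> norm (case p of (x, y) \<Rightarrow> indicator B x *\<^sub>R G y)"
        using generator_le_1[OF gen] generator_nonneg[OF gen]
        by (intro AE_I2) (auto simp: norm_mult indicator_def intro!: mult_left_le)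
    qed measurable
    from lborel_pair.Fubini_integral[OF this]
    have "(LINT y|lborel. (LINT x|lborel. ?\<Psi> x y)) = 0"
      by (simp only: inner0) simp
    moreover have "(LINT x|lborel. ?\<Psi> x y) = complex_of_real (\<epsilon> m ^ CARD('n)) * (G y * complex_of_real (f m y))" for y
    proof -
      have "(LINT x|lborel. ?\<Psi> x y) = (LINT x|lborel. G y * complex_of_real (indicator B x * ?\<phi> x y))"
        by (intro Bochner_Integration.integral_cong) (auto simp: indicator_def)
      also have "\<dots> = G y * complex_of_real (LINT x|lborel. indicator B x * ?\<phi> x y)"
        by (simp only: integral_mult_right_zero integral_complex_of_real)
      \<comment> \<open>Substitution x = y - \<epsilon> z in the centre; its Jacobian is
        \<epsilon>^n.\<close>
      also have "(LINT x|lborel. indicator B x * ?\<phi> x y) =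
          \<bar>- \<epsilon> m\<bar> ^ DIM(real^'n) *\<^sub>R (LINT z|lborel. indicator B (y + (- \<epsilon> m) *\<^sub>R z) * ?\<phi> (y + (- \<epsilon> m) *\<^sub>R z) y)"
      proof (rule integral_lborel_affine)
        show "(\<lambda>x. indicator B x * ?\<phi> x y) \<in> borel_measurable borel" by measurable
        show "- \<epsilon> m \<noteq> 0" using \<epsilon>[of m] by simp
      qed
      also have "\<dots> = \<epsilon> m ^ CARD('n) * f m y"
        using \<epsilon>[of m] by (simp add: f_def)
      finally show ?thesis by simp
    qed
    ultimately show ?thesis using \<epsilon>(1)[of m] by simp
  qed
  let ?I = "integral\<^sup>L lborel \<phi>"
  have "(\<lambda>m. LINT y|lborel. G y * complex_of_real (f m y)) \<longlonglongrightarrow>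
      (LINT y|lborel. G y * complex_of_real (indicator B y * ?I))"
  proof (rule integral_dominated_convergence)
    show "integrable lborel (\<lambda>y. norm (G y) * ?I)"
      using Gint by simp
    show "(\<lambda>y. G y * complex_of_real (indicator B y * ?I)) \<in> borel_measurable lborel" by measurable
    show "(\<lambda>y. G y * complex_of_real (f m y)) \<in> borel_measurable lborel" for m
      unfolding f_def by measurable
    show "AE y in lborel. norm (G y * complex_of_real (f m y)) \<le> norm (G y) * ?I" for m
    proof (rule AE_I2)
      fix y
      have "\<bar>f m y\<bar> \<le> (LINT z|lborel. norm (indicator B (y - \<epsilon> m *\<^sub>R z) * \<phi> z))"
        unfolding f_def using integral_norm_bound[of lborel "\<lambda>z. indicator B (y - \<epsilon> m *\<^sub>R z) * \<phi> z"] by simp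
      also have "\<dots> \<le> ?I"
      proof (rule integral_mono)
        show "integrable lborel (\<lambda>z. norm (indicator B (y - \<epsilon> m *\<^sub>R z) * \<phi> z))"
          by (rule integrable_dominated[OF generator_integrable])
            (auto simp: indicator_def intro!: AE_I2)
      qed (auto simp: generator_integrable indicator_def generator_nonneg[OF gen])
      finally show "norm (G y * complex_of_real (f m y)) \<le> norm (G y) * ?I"
        by (simp add: norm_mult mult_left_mono)
    qed
    have fr: "AE y in lborel. y \<notin> frontier B"
    proof (rule AE_not_in)
      have "negligible (frontier B)"
        unfolding B_def by (rule negligible_convex_frontier[OF convex_box(2)])
      then have "frontier B \<in> null_sets lebesgue" by (simp add: negligible_iff_null_sets)
      then show "frontier B \<in> null_sets lborel"
        by (simp add: null_sets_completion_iff)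
    qed
    show "AE y in lborel. (\<lambda>m. G y * complex_of_real (f m y)) \<longlonglongrightarrow> G y * complex_of_real (indicator B y * ?I)"
      using fr
    proof eventually_elim
      fix y assume "y \<notin> frontier B"
      from mollified_indicator_tendsto[OF this generator_integrable, of "3/2"]
      have "(\<lambda>m. f m y) \<longlonglongrightarrow> indicator B y * ?I"
        unfolding f_def \<epsilon>_def by (simp add: generator_eq_0[OF gen])
      then show "(\<lambda>m. G y * complex_of_real (f m y)) \<longlonglongrightarrow> G y * complex_of_real (indicator B y * ?I)"
        by (intro tendsto_intros)
    qed
  qed
  then have "(LINT y|lborel. G y * complex_of_real (indicator B y * ?I)) = 0"
    unfolding key by (simp add: LIMSEQ_const_iff)
  also have "(\<lambda>y. G y * complex_of_real (indicator B y * ?I)) = (\<lambda>y. complex_of_real ?I * (indicator B y *\<^sub>R g y))"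
    using R by (fastforce simp: fun_eq_iff G_def R'_def indicator_def)
  finally have "complex_of_real ?I * (LINT y|lborel. indicator B y *\<^sub>R g y) = 0"
    by (simp only: integral_mult_right_zero)
  then show ?thesis
    using generator_integral_pos by (simp add: B_def)
qed

text \<open>The integrals over boxes vanish by mollification with dilates of \<open>\<phi>\<close>, and the sets with
  vanishing integral form a Dynkin system.\<close>

theorem fundamental_lemma:
  fixes g :: "real ^ 'n \<Rightarrow> complex"
  assumes g: "locally_integrable g"
    and zero: "\<And>h. h \<in> \<S> \<Longrightarrow> bounded {x. h x \<noteq> 0} \<Longrightarrow> (LINT x|lborel. g x * h x) = 0"
  shows "AE x in lborel. g x = 0"
proof -
  note [measurable] = locally_integrable_measurable[OF g]
  define U where "U r = box (- real r *\<^sub>R One) (real r *\<^sub>R One :: real ^ 'n)" for r :: nat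
  have [measurable]: "U r \<in> sets borel" for r by (simp add: U_def)
  \<comment> \<open>Truncation makes the complement step of the Dynkin system possible: the whole
    integral of \<open>u r\<close> is finite and is itself an integral of \<open>g\<close> over a
    box. A box cut with \<open>U r\<close> is again a box.\<close>
  define u where "u r x = indicator (U r) x *\<^sub>R g x" for r x
  have u_int: "integrable lborel (u r)" for r
  proof -
    have "set_integrable lborel (closure (U r)) g"
      using g unfolding locally_integrable_def U_def by (meson bounded_box compact_closure)
    then have "set_integrable lborel (U r) g"
      by (rule set_integrable_subset) (auto simp: closure_subset)
    then show ?thesis by (simp add: set_integrable_def u_def[abs_def])
  qed
  have zero_sets: "(LINT x:A|lborel. u r x) = 0" if "A \<in> sets borel" for A r
  proof -
    have "Int_stable (range (\<lambda>(a, b). box a b :: (real^'n) set))"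
      by (auto simp: Int_stable_def box_Int_box)
    moreover have "range (\<lambda>(a, b). box a b :: (real^'n) set) \<subseteq> Pow UNIV" by simp
    moreover have "A \<in> sigma_sets UNIV (range (\<lambda>(a, b). box a b :: (real^'n) set))"
      using that by (simp add: borel_eq_box[where 'a = "real^'n"])
    ultimately show ?thesis
    proof (induction A rule: sigma_sets_induct_disjoint)
      case (basic A)
      then obtain a b where A: "A = box a b" by auto
      obtain c d where cd: "A \<inter> U r = box c d"
        unfolding A U_def box_Int_box by blast
      have "(LINT x:A|lborel. u r x) = (LINT x|lborel. indicator (A \<inter> U r) x *\<^sub>R g x)"
        by (simp add: set_lebesgue_integral_def u_def indicator_inter_arith)
      then show "(LINT x:A|lborel. u r x) = 0"
        unfolding cd using integral_box_eq_0[OF g zero] by simp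
    next
      case empty
      show ?case by (simp add: set_lebesgue_integral_def)
    next
      case (compl A)
      then have A: "A \<in> sets borel"
        by (simp add: borel_eq_box[where 'a = "real^'n"])
      have "(LINT x:UNIV - A|lborel. u r x) = (LINT x|lborel. u r x - indicator A x *\<^sub>R u r x)"
        unfolding set_lebesgue_integral_def
        by (intro Bochner_Integration.integral_cong) (auto simp: indicator_def)
      also have "\<dots> = (LINT x|lborel. u r x) - (LINT x:A|lborel. u r x)"
        unfolding set_lebesgue_integral_def
        using A u_int[of r] by (intro Bochner_Integration.integral_diff integrable_mult_indicator) auto
      also have "(LINT x|lborel. u r x) = 0"
        unfolding u_def U_def by (rule integral_box_eq_0[OF g zero])
      finally show ?case using compl by simp
    next
      case (union A)
      then have A: "disjoint_family A" "range A \<subseteq> sigma_sets UNIV (range (\<lambda>(a, b). box a b :: (real^'n) set))"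
        and 0: "\<And>i. (LINT x:A i|lborel. u r x) = 0" by blast+
      have A': "A i \<in> sets borel" for i
        using A(2) by (auto simp: borel_eq_box[where 'a = "real^'n"])
      have "(LINT x:(\<Union>i. A i)|lborel. u r x) = (\<Sum>i. (LINT x:A i|lborel. u r x))"
      proof (rule lebesgue_integral_countable_add)
        show "A i \<inter> A j = {}" if "i \<noteq> j" for i j
          using A(1) that by (auto simp: disjoint_family_on_def)
        show "set_integrable lborel (\<Union>i. A i) (u r)"
          unfolding set_integrable_def using A' u_int by (intro integrable_mult_indicator) auto
      qed (use A' in auto)
      then show "(LINT x:(\<Union>i. A i)|lborel. u r x) = 0" using 0 by simp
    qed
  qed
  have nonpos: "AE x in lborel. Re (c * u r x) \<le> 0" for r c
  proof -
    \<comment> \<open>The integral over this set of a function positive on it is 0, which forces the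
      set to be null.\<close>
    define A where "A = {x. Re (c * u r x) > 0}"
    have [measurable]: "u r \<in> borel_measurable borel" using u_int[of r] by auto
    have A[measurable]: "A \<in> sets borel"
      unfolding A_def by measurable
    let ?v = "\<lambda>x. Re (c * (indicator A x *\<^sub>R u r x))"
    have i: "integrable lborel (\<lambda>x. indicator A x *\<^sub>R u r x)"
      using u_int by (intro integrable_mult_indicator) auto
    then have iv: "integrable lborel ?v"
      by (intro integrable_Re integrable_mult_right)
    have "integral\<^sup>L lborel ?v = Re (c * (LINT x|lborel. indicator A x *\<^sub>R u r x))"
      using integral_Re[OF integrable_mult_right[OF i, of c]] by (simp only: integral_mult_right_zero)
    also have "\<dots> = 0"
      using zero_sets[OF A, of r] by (simp add: set_lebesgue_integral_def)
    finally have "AE x in lborel. ?v x = 0"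
      using integral_nonneg_eq_0_iff_AE[OF iv] by (auto simp: A_def indicator_def)
    then show ?thesis
      by eventually_elim (auto simp: A_def indicator_def split: if_splits)
  qed
  \<comment> \<open>The factors 1, -1, \<i> and - \<i> bound real and imaginary part from both
    sides.\<close>
  have "AE x in lborel. \<forall>r. Re (1 * u r x) \<le> 0 \<and> Re (- 1 * u r x) \<le> 0 \<and> Re (\<i> * u r x) \<le> 0 \<and> Re (- \<i> * u r x) \<le> 0"
    unfolding AE_all_countable by (intro allI AE_conjI nonpos)
  then show ?thesis
  proof eventually_elim
    fix x assume *: "\<forall>r. Re (1 * u r x) \<le> 0 \<and> Re (- 1 * u r x) \<le> 0 \<and> Re (\<i> * u r x) \<le> 0 \<and> Re (- \<i> * u r x) \<le> 0"
    obtain r :: nat where r: "norm x < real r" using reals_Archimedean2 by blast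
    have "x \<in> U r"
      unfolding U_def mem_box using Basis_le_norm[of _ x] r
      by (auto simp: abs_le_iff) (smt (verit) Basis_le_norm)+
    then have "u r x = g x" by (simp add: u_def)
    then show "g x = 0" using spec[OF *, of r] by (simp add: complex_eq_iff)
  qed
qed

text \<open>Makes the norms, defined through the chosen \<open>fun_of\<close>, computable from any
  representative.\<close>

lemma represents_unique:
  assumes f: "represents f T" and g: "represents g (T :: 'n dist)"
  shows "AE x in lborel. f x = g x"
proof -
  have li: "locally_integrable (\<lambda>x. f x - g x)"
    using f g unfolding represents_def locally_integrable_def by (auto intro: set_integral_diff)
  have "AE x in lborel. f x - g x = 0"
  proof (rule fundamental_lemma[OF li])
    fix h :: "real ^ 'n \<Rightarrow> complex" assume h: "h \<in> \<S>" "bounded {x. h x \<noteq> 0}"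
    have "(LINT x|lborel. (f x - g x) * h x) = (LINT x|lborel. f x * h x) - (LINT x|lborel. g x * h x)"
      unfolding left_diff_distrib using f g h
      by (intro Bochner_Integration.integral_diff locally_integrable_mult_test) (auto simp: represents_def)
    also have "\<dots> = T h - T h" using f g h by (simp add: represents_def)
    finally show "(LINT x|lborel. (f x - g x) * h x) = 0" by simp
  qed
  then show ?thesis by simp
qed

end

subsection \<open>The regularised weight\<close>

lemma dyadic_Suc:
  "dyadic \<phi> (Suc j) x = \<phi> ((1/2) ^ Suc j *\<^sub>R x) - \<phi> ((1/2) ^ j *\<^sub>R x)"
  by (cases j) auto

lemma sum_dyadic: "(\<Sum>j\<le>J. dyadic \<phi> j x) = \<phi> ((1/2) ^ J *\<^sub>R x)"
  by (induction J) (simp_all add: dyadic_Suc del: dyadic.simps(2,3))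

text \<open>Powers with negative \<open>b\<close> reverse inequalities, so the ratio 3 is used in
  one direction or the other and enters with exponent |b| in both cases.\<close>

lemma powr_comparable:
  fixes u v :: real
  assumes "0 < u" "0 < v" "u \<le> 3 * v" "v \<le> 3 * u"
  shows "u powr b \<le> 3 powr \<bar>b\<bar> * v powr b"
proof (cases "b \<ge> 0")
  case True
  then have "u powr b \<le> (3 * v) powr b" using assms by (intro powr_mono2) auto
  then show ?thesis using True assms by (simp add: powr_mult)
next
  case False
  then have "u powr b \<le> (v / 3) powr b" using assms by (intro powr_mono2') auto
  also have "\<dots> = 3 powr (- b) * v powr b"
    using assms by (simp add: powr_divide powr_minus_divide)
  finally show ?thesis using False by simp
qed

lemma jbracket_ge: "1 \<le> jbracket x" "norm x \<le> jbracket x" "jbracket x \<le> 1 + norm x"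
proof -
  show "1 \<le> jbracket x" by (simp add: jbracket_def)
  show "norm x \<le> jbracket x" unfolding jbracket_def by (rule real_le_rsqrt) simp
  show "jbracket x \<le> 1 + norm x" unfolding jbracket_def
    by (rule real_le_lsqrt) (auto simp: power2_sum)
qed

definition log_weight :: "real ^ 'n::finite \<Rightarrow> real" where
  "log_weight x = 1 + ln (jbracket x)"

lemma log_weight_ge: "1 \<le> log_weight x" "log_weight x \<le> 1 + norm x"
  using jbracket_ge[of x] ln_le_minus_one[of "jbracket x"] by (auto simp: log_weight_def)

text \<open>The bracket is at least 1, so \<open>log_plus\<close> is the plain logarithm.\<close>

lemma sobolev_weight_eq: "1 / w_log b (1 / jbracket \<xi>) = 1 / log_weight \<xi> powr b"
  using jbracket_ge(1)[of \<xi>] by (simp add: w_log_def log_plus_def log_weight_def)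

text \<open>Smoothness is carried in the conclusion because the induction step needs it for the
  partial sum.\<close>

lemma pderivs_sum:
  assumes "finite J" "\<And>j. j \<in> J \<Longrightarrow> smooth (f j)"
  shows "pderivs \<alpha> (\<lambda>x. \<Sum>j\<in>J. f j x) = (\<lambda>x. \<Sum>j\<in>J. pderivs \<alpha> (f j) x) \<and> smooth (\<lambda>x. \<Sum>j\<in>J. f j x)"
  using assms
proof (induction J rule: finite_induct)
  case empty
  then show ?case using multiplier_smooth[OF multiplier_const[of 0]] by (simp add: pderivs_const)
next
  case (insert i J)
  then have IH: "pderivs \<alpha> (\<lambda>x. \<Sum>j\<in>J. f j x) = (\<lambda>x. \<Sum>j\<in>J. pderivs \<alpha> (f j) x)"
    "smooth (\<lambda>x. \<Sum>j\<in>J. f j x)" and i: "smooth (f i)" by auto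
  show ?case
    unfolding sum.insert[OF insert.hyps(1,2)]
    using pderivs_add[OF i IH(2), of \<alpha>] smooth_add[OF i IH(2)] by (simp only: IH(1)) blast
qed

section \<open>The dyadic partition of unity and the multiplier property\<close>

context
  fixes \<phi> :: "real ^ 'n::finite \<Rightarrow> real"
  assumes gen: "dyadic_generator \<phi>"
begin

lemma dyadic_nonneg: "0 \<le> dyadic \<phi> j x"
proof (cases j)
  case 0
  then show ?thesis by (simp add: generator_nonneg[OF gen])
next
  case (Suc i)
  have "(1/2 :: real) ^ Suc i \<le> (1/2) ^ i" by simp
  then show ?thesis
    unfolding Suc dyadic_Suc using generator_antimono[OF gen, of "(1/2) ^ Suc i" "(1/2) ^ i" x] by simp
qed

lemma scaled_generator_eq_1: "norm x \<le> 2 ^ k \<Longrightarrow> \<phi> ((1/2) ^ k *\<^sub>R x) = 1"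
  by (rule generator_eq_1[OF gen]) (simp add: power_divide field_simps)

lemma scaled_generator_eq_0: "3 / 2 * 2 ^ k < norm x \<Longrightarrow> \<phi> ((1/2) ^ k *\<^sub>R x) = 0"
  by (rule generator_eq_0[OF gen]) (simp add: power_divide field_simps)

lemma dyadic_support:
  assumes "dyadic \<phi> j x \<noteq> 0"
  shows "norm x \<le> 3 / 2 * 2 ^ j" and "j > 0 \<Longrightarrow> 2 ^ (j - 1) \<le> norm x"
proof -
  show "norm x \<le> 3 / 2 * 2 ^ j"
  proof (rule ccontr)
    assume n: "\<not> norm x \<le> 3 / 2 * 2 ^ j"
    have z: "\<phi> ((1/2) ^ i *\<^sub>R x) = 0" if "i \<le> j" for i
    proof (rule scaled_generator_eq_0)
      have "(2::real) ^ i \<le> 2 ^ j" using that by (intro power_increasing) auto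
      then show "3 / 2 * 2 ^ i < norm x" using n by linarith
    qed
    show False
      using assms z[of j] z[of "j - 1"] by (cases j) (auto simp: dyadic_Suc simp del: dyadic.simps(2,3))
  qed
  show "2 ^ (j - 1) \<le> norm x" if j: "j > 0"
  proof (rule ccontr)
    assume n: "\<not> 2 ^ (j - 1) \<le> norm x"
    obtain i where i: "j = Suc i" using j by (cases j) auto
    have o: "\<phi> ((1/2) ^ k *\<^sub>R x) = 1" if "i \<le> k" for k
    proof (rule scaled_generator_eq_1)
      have "(2::real) ^ i \<le> 2 ^ k" using that by (intro power_increasing) auto
      then show "norm x \<le> 2 ^ k" using n unfolding i diff_Suc_1 by linarith
    qed
    show False using assms o[of i] o[of "Suc i"] by (simp add: i dyadic_Suc del: dyadic.simps(2,3))
  qed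
qed

text \<open>All dilates of the generator with index at least \<open>J\<close> equal 1 at \<xi>, so
  later pieces vanish and the telescoping sum is 1: the regularisation is a finite convex
  combination of the dyadic values of \<open>w\<close>.\<close>

lemma regularisation_finite_sum:
  assumes "norm \<xi> \<le> 2 ^ J"
  shows "regularisation \<phi> w \<xi> = (\<Sum>j\<le>J. w ((1/2) ^ j) * dyadic \<phi> j \<xi>)"
    and "(\<Sum>j\<le>J. dyadic \<phi> j \<xi>) = 1"
proof -
  have s1: "\<phi> ((1/2) ^ k *\<^sub>R \<xi>) = 1" if "J \<le> k" for k
  proof (rule scaled_generator_eq_1)
    have "(2::real) ^ J \<le> 2 ^ k" using that by (intro power_increasing) auto
    then show "norm \<xi> \<le> 2 ^ k" using assms by linarith
  qed
  then show "(\<Sum>j\<le>J. dyadic \<phi> j \<xi>) = 1" by (simp add: sum_dyadic)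
  have "dyadic \<phi> j \<xi> = 0" if "j > J" for j
    using that s1[of "j - 1"] s1[of j] by (cases j) (auto simp: dyadic_Suc simp del: dyadic.simps(2,3))
  then show "regularisation \<phi> w \<xi> = (\<Sum>j\<le>J. w ((1/2) ^ j) * dyadic \<phi> j \<xi>)"
    unfolding regularisation_def by (intro suminf_finite) auto
qed

text \<open>Where the piece \<open>j\<close> is nonzero, the logarithm of the bracket lies between
  (j - 1) log 2 and (j + 2) log 2. As log 2 \<le> 1, the additive errors log 2 and 2 log 2 are
  absorbed by the factor 3.\<close>

lemma dyadic_index_comparable:
  assumes "dyadic \<phi> j x \<noteq> 0"
  shows "1 + real j * ln 2 \<le> 3 * log_weight x" "log_weight x \<le> 3 * (1 + real j * ln 2)"
proof -
  have ln2: "0 < ln (2::real)" "ln (2::real) \<le> 1" using ln_2_less_1 by auto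
  have J: "jbracket x > 0" using jbracket_ge(1)[of x] by simp
  show "1 + real j * ln 2 \<le> 3 * log_weight x"
  proof (cases "j = 0")
    case True
    then show ?thesis using log_weight_ge(1)[of x] by simp
  next
    case False
    have "(2::real) ^ (j - 1) \<le> jbracket x"
      using dyadic_support(2)[OF assms] False jbracket_ge(2)[of x] by simp
    then have "ln ((2::real) ^ (j - 1)) \<le> ln (jbracket x)" using J by simp
    then have "(real j - 1) * ln 2 \<le> ln (jbracket x)"
      using False by (simp add: ln_realpow of_nat_diff)
    then have "1 + real j * ln 2 \<le> 1 + ln 2 + ln (jbracket x)"
      by (simp add: algebra_simps)
    also have "\<dots> \<le> 3 * log_weight x"
      using ln2 log_weight_ge(1)[of x] unfolding log_weight_def distrib_left by linarith
    finally show ?thesis .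
  qed
  have "jbracket x \<le> 1 + 3 / 2 * 2 ^ j"
    using jbracket_ge(3)[of x] dyadic_support(1)[OF assms] by simp
  also have "\<dots> \<le> 2 ^ (j + 2)"
  proof -
    have "1 \<le> (2::real) ^ j" by simp
    then have "1 + 3 / 2 * 2 ^ j \<le> 4 * (2::real) ^ j" by linarith
    then show ?thesis by (simp add: power_add)
  qed
  finally have "ln (jbracket x) \<le> ln (2 ^ (j + 2))" using J by simp
  also have "\<dots> = real (j + 2) * ln 2" by (rule ln_realpow)
  finally show "log_weight x \<le> 3 * (1 + real j * ln 2)"
  proof -
    have p: "0 \<le> real j * ln 2" by simp
    assume "ln (jbracket x) \<le> real (j + 2) * ln 2"
    then have "ln (jbracket x) \<le> real j * ln 2 + 2 * ln 2" by (simp add: distrib_right)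
    then show ?thesis
      using ln2 p unfolding log_weight_def distrib_left by linarith
  qed
qed

text \<open>The comparison holds at each index whose piece is nonzero, and a convex combination
  preserves it.\<close>

lemma regularisation_comparable:
  "regularisation \<phi> (w_log b) \<xi> \<le> 3 powr \<bar>b\<bar> * log_weight \<xi> powr b"
  "log_weight \<xi> powr b \<le> 3 powr \<bar>b\<bar> * regularisation \<phi> (w_log b) \<xi>"
proof -
  obtain J :: nat where "norm \<xi> < 2 ^ J" using real_arch_pow[of 2 "norm \<xi>"] by auto
  then have J: "norm \<xi> \<le> 2 ^ J" by simp
  let ?c = "\<lambda>j. w_log b ((1/2) ^ j)" and ?d = "\<lambda>j. dyadic \<phi> j \<xi>" and ?L = "log_weight \<xi> powr b"
  note W = regularisation_finite_sum(1)[OF J, of "w_log b"] and one = regularisation_finite_sum(2)[OF J]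
  have le: "?c j * ?d j \<le> (3 powr \<bar>b\<bar> * ?L) * ?d j \<and> ?L * ?d j \<le> (3 powr \<bar>b\<bar> * ?c j) * ?d j" for j
  proof (cases "?d j = 0")
    case False
    have "0 < 1 + real j * ln 2" by (intro add_pos_nonneg) auto
    moreover have "0 < log_weight \<xi>" using log_weight_ge(1)[of \<xi>] by simp
    ultimately show ?thesis
      using dyadic_index_comparable[OF False]
      by (intro conjI mult_right_mono dyadic_nonneg) (auto simp: w_log_dyadic intro!: powr_comparable)
  qed simp
  have "regularisation \<phi> (w_log b) \<xi> \<le> (\<Sum>j\<le>J. (3 powr \<bar>b\<bar> * ?L) * ?d j)"
    unfolding W using le by (intro sum_mono) blast
  then show "regularisation \<phi> (w_log b) \<xi> \<le> 3 powr \<bar>b\<bar> * ?L"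
    unfolding sum_distrib_left[symmetric] one by simp
  have "(\<Sum>j\<le>J. ?L * ?d j) \<le> (\<Sum>j\<le>J. 3 powr \<bar>b\<bar> * (?c j * ?d j))"
    using le by (intro sum_mono) (simp add: mult.assoc)
  then show "?L \<le> 3 powr \<bar>b\<bar> * regularisation \<phi> (w_log b) \<xi>"
    unfolding sum_distrib_left[symmetric] one W by simp
qed

lemma regularisation_pos: "0 < regularisation \<phi> (w_log b) \<xi>"
proof -
  have "0 < log_weight \<xi> powr b" using log_weight_ge(1)[of \<xi>] by simp
  also note regularisation_comparable(2)[of \<xi> b]
  finally show ?thesis by (simp add: zero_less_mult_iff)
qed

lemma dyadic_schwartz:
  "(\<lambda>x. complex_of_real (dyadic \<phi> j x)) \<in> \<S>"
proof (cases j)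
  case 0
  then show ?thesis using generator_schwartz[OF gen] by simp
next
  case (Suc i)
  then show ?thesis
    unfolding Suc dyadic_Suc of_real_diff
    by (intro schwartz_diff schwartz_scale[OF generator_schwartz[OF gen]]) auto
qed

text \<open>Uniformity in \<open>j\<close>: each later piece is a difference of dilates of one
  function by factors at most 1, and such dilations do not enlarge the supremum of a
  derivative.\<close>

lemma dyadic_pderivs_bounded:
  obtains K where "K \<ge> 0" "\<And>j x. norm (pderivs \<alpha> (\<lambda>x. complex_of_real (dyadic \<phi> j x)) x) \<le> K"
proof -
  let ?\<phi> = "\<lambda>x. complex_of_real (\<phi> x)"
  note S = generator_schwartz[OF gen]
  define K where "K = schwartz_seminorm (length \<alpha>) ?\<phi> + schwartz_seminorm (length \<alpha>) (\<lambda>x. - 1 * ?\<phi> x)"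
  have K0: "schwartz_seminorm (length \<alpha>) ?\<phi> \<ge> 0" "schwartz_seminorm (length \<alpha>) (\<lambda>x. - 1 * ?\<phi> x) \<ge> 0"
    by (rule schwartz_seminorm_nonneg S schwartz_cmult)+
  have scaled: "norm (pderivs \<alpha> (\<lambda>x. f ((1/2) ^ i *\<^sub>R x)) x) \<le> schwartz_seminorm (length \<alpha>) f"
    if f: "f \<in> \<S>" for f :: "real^'n \<Rightarrow> complex" and i x
  proof -
    have "norm (pderivs \<alpha> (\<lambda>x. f ((1/2) ^ i *\<^sub>R x)) x) =
        ((1/2) ^ i) ^ length \<alpha> * norm (pderivs \<alpha> f ((1/2) ^ i *\<^sub>R x))"
      using pderivs_affine[OF schwartz_smooth[OF f], of \<alpha> "(1/2) ^ i" 0]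
      by (simp add: norm_mult norm_power norm_divide)
    also have "\<dots> \<le> 1 * schwartz_seminorm (length \<alpha>) f"
      using schwartz_seminorm_ge[OF f, of \<alpha> "length \<alpha>" 0]
      by (intro mult_mono power_le_one) (auto simp: power_le_one)
    finally show ?thesis by simp
  qed
  have "norm (pderivs \<alpha> (\<lambda>x. complex_of_real (dyadic \<phi> j x)) x) \<le> K" for j x
  proof (cases j)
    case 0
    then show ?thesis using scaled[OF S, of 0 x] K0 by (simp add: K_def)
  next
    case (Suc i)
    let ?f = "\<lambda>x. ?\<phi> ((1/2) ^ Suc i *\<^sub>R x)" and ?g = "\<lambda>x. - 1 * ?\<phi> ((1/2) ^ i *\<^sub>R x)"
    have "smooth ?f" "smooth ?g"
      by (intro schwartz_smooth schwartz_cmult schwartz_scale[OF S]; simp)+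
    then have "pderivs \<alpha> (\<lambda>x. ?f x + ?g x) = (\<lambda>x. pderivs \<alpha> ?f x + pderivs \<alpha> ?g x)"
      by (rule pderivs_add)
    moreover have "(\<lambda>x. complex_of_real (dyadic \<phi> j x)) = (\<lambda>x. ?f x + ?g x)"
      unfolding Suc dyadic_Suc by simp
    ultimately show ?thesis
      unfolding K_def
      using norm_triangle_mono[OF scaled[OF S, of "Suc i" x] scaled[OF schwartz_cmult[OF S, of "- 1"], of i x]]
      by simp
  qed
  then show ?thesis using that[of K] K0 by (simp add: K_def)
qed

text \<open>On a ball the regularisation is a finite dyadic sum, which gives smoothness. Since the
  derivatives of the pieces are uniformly bounded, growth is governed by the number of terms and the
  size of the coefficients.\<close>

lemma regularisation_multiplier:
  "(\<lambda>\<xi>. complex_of_real (regularisation \<phi> (w_log b) \<xi>)) \<in> schwartz_multipliers"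
proof -
  let ?W = "\<lambda>\<xi>. complex_of_real (regularisation \<phi> (w_log b) \<xi>)"
  let ?c = "\<lambda>j. complex_of_real (w_log b ((1/2) ^ j))"
  let ?d = "\<lambda>j x. complex_of_real (dyadic \<phi> j x)"
  let ?P = "\<lambda>J x. \<Sum>j\<le>J. ?c j * ?d j x"
  have sm: "smooth (\<lambda>x. ?c j * ?d j x)" for j
    by (intro schwartz_smooth schwartz_cmult dyadic_schwartz)
  have P: "pderivs \<alpha> (?P J) = (\<lambda>x. \<Sum>j\<le>J. pderivs \<alpha> (\<lambda>x. ?c j * ?d j x) x)" "smooth (?P J)" for J \<alpha>
    using pderivs_sum[of "{..J}" "\<lambda>j x. ?c j * ?d j x" \<alpha>] sm by auto
  have cm: "pderivs \<alpha> (\<lambda>x. ?c j * ?d j x) = (\<lambda>x. ?c j * pderivs \<alpha> (?d j) x)" for \<alpha> j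
    by (rule pderivs_cmult[OF schwartz_smooth[OF dyadic_schwartz]])
  have loc: "pderivs \<alpha> ?W y = pderivs \<alpha> (?P J) y" if "y \<in> ball 0 (2 ^ J)" for \<alpha> y J
    by (rule pderivs_cong_open[OF open_ball that]) (simp add: regularisation_finite_sum(1)[OF less_imp_le])
  have diff: "pderivs \<alpha> ?W differentiable (at x)" for \<alpha> x
  proof -
    obtain J :: nat where J: "norm x < 2 ^ J" using real_arch_pow[of 2 "norm x"] by auto
    show ?thesis
    proof (rule differentiable_cong_open)
      show "x \<in> ball 0 (2 ^ J)" using J by simp
      show "pderivs \<alpha> (?P J) differentiable (at x)" using P(2)[of J] unfolding smooth_iff by blast
    qed (use loc in auto)
  qed
  have growth: "poly_growth (pderivs \<alpha> ?W)" for \<alpha>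
  proof -
    obtain K where K: "K \<ge> 0" "\<And>j x. norm (pderivs \<alpha> (?d j) x) \<le> K"
      using dyadic_pderivs_bounded by blast
    define m where "m = nat \<lceil>\<bar>b\<bar>\<rceil>"
    have m: "\<bar>b\<bar> \<le> real m" unfolding m_def by linarith
    have "norm (pderivs \<alpha> ?W x) \<le> (2 ^ Suc m * K) * (1 + norm x) ^ Suc m" for x
    proof -
      \<comment> \<open>A generous choice, linear rather than logarithmic in |x|: then 2^J > J >
        |x|, and both the J + 1 terms and the coefficient bound (1 + J)^m stay polynomial.\<close>
      define J where "J = nat (\<lfloor>norm x\<rfloor> + 1)"
      have J: "norm x < real J" "real J \<le> norm x + 1"
        unfolding J_def by (auto simp: floor_le_iff)
      have "real J < 2 ^ J" by (rule of_nat_less_two_power)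
      then have x: "x \<in> ball 0 (2 ^ J)"
        using J(1) unfolding mem_ball dist_0_norm by linarith
      have c: "w_log b ((1/2) ^ j) \<le> (1 + real J) ^ m" if "j \<le> J" for j
      proof -
        have "real j * ln 2 \<le> real J * 1"
          using that ln_2_less_1 by (intro mult_mono) auto
        then have 1: "1 \<le> 1 + real j * ln 2" "1 + real j * ln 2 \<le> 1 + real J" by auto
        have "(1 + real j * ln 2) powr b \<le> (1 + real j * ln 2) powr real m"
          using 1 m by (intro powr_mono) auto
        also have "\<dots> \<le> (1 + real J) powr real m"
          using 1 by (intro powr_mono2) auto
        also have "\<dots> = (1 + real J) ^ m" by (intro powr_realpow) auto
        finally show ?thesis by (simp add: w_log_dyadic)
      qed
      have "norm (pderivs \<alpha> ?W x) = norm (\<Sum>j\<le>J. ?c j * pderivs \<alpha> (?d j) x)"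
        by (simp only: loc[OF x] P(1) cm)
      also have "\<dots> \<le> (\<Sum>j\<le>J. (1 + real J) ^ m * K)"
      proof (rule sum_norm_le)
        fix j assume "j \<in> {..J}"
        then show "norm (?c j * pderivs \<alpha> (?d j) x) \<le> (1 + real J) ^ m * K"
          unfolding norm_mult using c[of j]
          by (intro mult_mono K) (auto simp: w_log_def)
      qed
      also have "\<dots> = (1 + real J) ^ Suc m * K" by (simp add: mult.assoc)
      also have "\<dots> \<le> (2 * (1 + norm x)) ^ Suc m * K"
      proof (intro mult_right_mono power_mono K)
        show "1 + real J \<le> 2 * (1 + norm x)"
          using J(2) norm_ge_zero[of x] unfolding distrib_left by linarith
      qed simp
      also have "\<dots> = (2 ^ Suc m * K) * (1 + norm x) ^ Suc m"
        unfolding power_mult_distrib by (simp only: mult_ac)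
      finally show ?thesis .
    qed
    then show ?thesis unfolding poly_growth_def by blast
  qed
  show ?thesis
    unfolding schwartz_multipliers_def cdiff_iff using diff growth by blast
qed

text \<open>The lower half of the comparison bounds 1/W by a power of the logarithmic weight; the
  quotient rule extends this to derivatives.\<close>

lemma inverse_regularisation_multiplier:
  "(\<lambda>\<xi>. complex_of_real (1 / regularisation \<phi> (w_log b) \<xi>)) \<in> schwartz_multipliers"
proof -
  let ?W = "\<lambda>\<xi>. regularisation \<phi> (w_log b) \<xi>"
  define m where "m = nat \<lceil>\<bar>b\<bar>\<rceil>"
  have m: "\<bar>b\<bar> \<le> real m" unfolding m_def by linarith
  have "norm (inverse (complex_of_real (?W \<xi>))) \<le> 3 powr \<bar>b\<bar> * (1 + norm \<xi>) ^ m" for \<xi>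
  proof -
    have L: "1 \<le> log_weight \<xi>" "log_weight \<xi> \<le> 1 + norm \<xi>" by (rule log_weight_ge)+
    have "norm (inverse (complex_of_real (?W \<xi>))) = 1 / ?W \<xi>"
      using regularisation_pos[of b \<xi>] by (simp add: norm_inverse divide_inverse)
    also have "\<dots> \<le> 3 powr \<bar>b\<bar> * log_weight \<xi> powr (- b)"
      using regularisation_comparable(2)[of \<xi> b] regularisation_pos[of b \<xi>] L
      by (simp add: powr_minus field_simps)
    also have "log_weight \<xi> powr (- b) \<le> log_weight \<xi> powr real m"
      using L m by (intro powr_mono) auto
    also have "log_weight \<xi> powr real m \<le> (1 + norm \<xi>) powr real m"
      using L by (intro powr_mono2) auto
    also have "(1 + norm \<xi>) powr real m = (1 + norm \<xi>) ^ m"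
      by (intro powr_realpow add_pos_nonneg) auto
    finally show ?thesis by simp
  qed
  then have "poly_growth (\<lambda>\<xi>. inverse (complex_of_real (?W \<xi>)))"
    unfolding poly_growth_def by blast
  from multiplier_inverse[OF regularisation_multiplier _ this] regularisation_pos
  have "(\<lambda>\<xi>. inverse (complex_of_real (?W \<xi>))) \<in> schwartz_multipliers"
    by (simp add: less_imp_neq[symmetric])
  then show ?thesis by (simp add: divide_inverse)
qed

end

section \<open>Slow variation of the logarithmic weight\<close>

text \<open>Certifies that the weight is admissible for a refined Sobolev space. It is itself slowly
  varying, so it serves as its own \<psi> with d = 1.\<close>

lemma refined_weight_log: "refined_weight (\<lambda>t. 1 / w_log b (1 / t))"
proof -
  define \<phi> where "\<phi> t = 1 / w_log b (1 / t)" for t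
  have eq: "\<phi> t = (1 + ln t) powr (- b)" if "t \<ge> 1" for t
    using that by (simp add: \<phi>_def w_log_def log_plus_def powr_minus divide_inverse)
  have ln0: "1 \<le> 1 + ln t" if "t \<ge> (1::real)" for t using that by simp
  have pos: "0 < \<phi> t" if "t \<ge> 1" for t
    using eq[OF that] ln0[OF that] by simp
  have "\<phi> \<in> borel_measurable borel"
    unfolding \<phi>_def[abs_def] w_log_def log_plus_def by measurable
  then have meas: "\<phi> \<in> borel_measurable (restrict_space borel {1..})"
    by (rule measurable_restrict_space1)
  have bd: "(1 + ln t) powr p \<le> (1 + ln c) powr \<bar>p\<bar>" if "t \<in> {1..c}" for t c p :: real
  proof -
    have "(1 + ln t) powr p \<le> (1 + ln t) powr \<bar>p\<bar>"
      using that ln0[of t] by (intro powr_mono) auto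
    also have "\<dots> \<le> (1 + ln c) powr \<bar>p\<bar>"
      using that ln0[of t] by (intro powr_mono2) auto
    finally show ?thesis .
  qed
  have bounded1: "bounded (\<phi> ` {1..c})" for c
    unfolding bounded_iff
  proof (intro exI[of _ "(1 + ln c) powr \<bar>- b\<bar>"] ballI)
    fix y assume "y \<in> \<phi> ` {1..c}"
    then show "norm y \<le> (1 + ln c) powr \<bar>- b\<bar>"
      using bd[of _ c "- b"] by (auto simp: eq)
  qed
  have bounded2: "bounded ((\<lambda>t. 1 / \<phi> t) ` {1..c})" for c
    unfolding bounded_iff
  proof (intro exI[of _ "(1 + ln c) powr \<bar>b\<bar>"] ballI)
    fix y assume "y \<in> (\<lambda>t. 1 / \<phi> t) ` {1..c}"
    then obtain t where t: "t \<in> {1..c}" "y = 1 / \<phi> t" by auto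
    have "1 / \<phi> t = (1 + ln t) powr b"
      using eq[of t] t by (simp add: powr_minus inverse_eq_divide)
    then show "norm y \<le> (1 + ln c) powr \<bar>b\<bar>"
      using bd[OF t(1), of b] t by simp
  qed
  have lim: "((\<lambda>t. \<phi> (l * t) / \<phi> t) \<longlongrightarrow> 1) at_top" if l: "l > 0" for l
  proof -
    have "((\<lambda>t::real. (1 + ln l + ln t) / (1 + ln t)) \<longlongrightarrow> 1) at_top"
      by real_asymp
    then have "((\<lambda>t. ((1 + ln l + ln t) / (1 + ln t)) powr (- b)) \<longlongrightarrow> 1 powr (- b)) at_top"
      by (intro tendsto_intros) auto
    then have *: "((\<lambda>t. ((1 + ln l + ln t) / (1 + ln t)) powr (- b)) \<longlongrightarrow> 1) at_top" by simp
    show ?thesis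
    proof (rule Lim_transform_eventually[OF *])
      show "\<forall>\<^sub>F t in at_top. ((1 + ln l + ln t) / (1 + ln t)) powr (- b) = \<phi> (l * t) / \<phi> t"
        \<comment> \<open>Past this threshold both \<open>t\<close> and \<open>l * t\<close> are at
          least 1, where the weight is a power of 1 + ln.\<close>
        using eventually_ge_at_top[of "max 1 (1 / l)"]
      proof eventually_elim
        fix t assume t: "max 1 (1 / l) \<le> t"
        then have t1: "t \<ge> 1" and lt: "l * t \<ge> 1" using l by (auto simp: field_simps)
        have "1 + ln l + ln t = 1 + ln (l * t)" using t1 l by (simp add: ln_mult)
        show "((1 + ln l + ln t) / (1 + ln t)) powr (- b) = \<phi> (l * t) / \<phi> t"
          unfolding \<open>1 + ln l + ln t = 1 + ln (l * t)\<close> using ln0[OF t1] ln0[OF lt] by (simp add: eq[OF t1] eq[OF lt] powr_divide)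
      qed
    qed
  qed
  have "refined_weight \<phi>"
    unfolding refined_weight_def
  proof (intro conjI allI impI)
    show "\<exists>d\<ge>1. \<exists>\<psi>::real \<Rightarrow> real. (\<forall>t\<ge>d. 0 < \<psi> t) \<and>
        (\<exists>d\<^sub>0\<ge>d. \<psi> \<in> borel_measurable (restrict_space borel {d\<^sub>0..})) \<and>
        (\<forall>l>0. ((\<lambda>t. \<psi> (l * t) / \<psi> t) \<longlongrightarrow> 1) at_top) \<and>
        (\<exists>C>0. \<forall>t\<ge>d. \<phi> t \<le> C * \<psi> t \<and> \<psi> t \<le> C * \<phi> t)"
      using pos meas lim by (intro exI[of _ 1] conjI exI[of _ \<phi>]) auto
  qed (use pos meas bounded1 bounded2 in auto)
  then show ?thesis by (simp add: \<phi>_def[abs_def])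
qed

subsection \<open>Fourier transform and multipliers of tempered distributions\<close>

lemma tempered_add:
  "T \<in> tempered_distributions \<Longrightarrow> g \<in> \<S> \<Longrightarrow> h \<in> \<S> \<Longrightarrow>
    T (\<lambda>x. g x + h x) = T g + T h"
  and tempered_cmult:
  "T \<in> tempered_distributions \<Longrightarrow> g \<in> \<S> \<Longrightarrow> T (\<lambda>x. c * g x) = c * T g"
  by (auto simp: tempered_distributions_def)

lemma inv_fourier_add:
  "g \<in> \<S> \<Longrightarrow> h \<in> \<S> \<Longrightarrow>
    inv_fourier (\<lambda>x. g x + h x) = (\<lambda>x. inv_fourier g x + inv_fourier h x)"
  by (simp add: inv_fourier_def fourier_add schwartz_integrable)

lemma inv_fourier_cmult: "inv_fourier (\<lambda>x. c * g x) = (\<lambda>x. c * inv_fourier g x)"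
  by (simp add: inv_fourier_def fourier_cmult)

lemma tempered_dist_fourier:
  "T \<in> tempered_distributions \<Longrightarrow> dist_fourier T \<in> tempered_distributions"
  unfolding dist_fourier_def
  by (rule tempered_comp[OF _ schwartz_continuous_fourier])
    (auto simp: fourier_add schwartz_integrable fourier_cmult)

lemma tempered_dist_mult:
  "a \<in> schwartz_multipliers \<Longrightarrow> T \<in> tempered_distributions \<Longrightarrow> dist_mult a T \<in> tempered_distributions"
  unfolding dist_mult_def
  by (rule tempered_comp[OF _ schwartz_continuous_mult]) (auto simp: algebra_simps)

text \<open>Every Schwartz function is a transform, by inversion; off the Schwartz space
  extensionality makes \<open>u\<close> and \<open>v\<close> agree.\<close>

lemma dist_fourier_inject:
  fixes u v :: "'n::finite dist"
  assumes u: "u \<in> tempered_distributions" and v: "v \<in> tempered_distributions"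
    and eq: "dist_fourier u = dist_fourier v"
  shows "u = v"
proof (rule extensionalityI)
  show "u \<in> extensional \<S>" "v \<in> extensional \<S>"
    using u v by (auto simp: tempered_distributions_def)
  fix h :: "real ^ 'n \<Rightarrow> complex" assume h: "h \<in> \<S>"
  show "u h = v h"
    using fun_cong[OF eq, of "inv_fourier h"] schwartz_inv_fourier[OF h]
    by (simp add: dist_fourier_def fourier_inv_fourier[OF h])
qed

text \<open>Justifies the definite description: the transpose of the inverse transform supplies a
  solution, injectivity its uniqueness.\<close>

lemma fourier_multiplier_works:
  fixes f :: "'n::finite dist"
  assumes a: "a \<in> schwartz_multipliers" and f: "f \<in> tempered_distributions"
  shows "fourier_multiplier a f \<in> tempered_distributions"
    and "dist_fourier (fourier_multiplier a f) = dist_mult a (dist_fourier f)"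
proof -
  let ?v = "dist_mult a (dist_fourier f)"
  define u where "u = restrict (\<lambda>g. ?v (inv_fourier g)) \<S>"
  have u: "u \<in> tempered_distributions"
    unfolding u_def
    by (rule tempered_comp[OF tempered_dist_mult[OF a tempered_dist_fourier[OF f]] schwartz_continuous_inv_fourier])
      (auto simp: inv_fourier_add inv_fourier_cmult)
  have Fu: "dist_fourier u = ?v"
  proof
    fix g
    show "dist_fourier u g = ?v g"
    proof (cases "g \<in> \<S>")
      case True
      then show ?thesis
        by (subst dist_fourier_def) (simp add: u_def schwartz_fourier inv_fourier_fourier)
    next
      case False
      then show ?thesis by (simp add: dist_fourier_def dist_mult_def)
    qed
  qed
  have "fourier_multiplier a f = u"
    unfolding fourier_multiplier_def
  proof (rule the_equality)
    show "u' = u" if "u' \<in> tempered_distributions \<and> dist_fourier u' = ?v" for u'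
      using that Fu by (intro dist_fourier_inject[OF _ u]) simp_all
  qed (use u Fu in blast)
  then show "fourier_multiplier a f \<in> tempered_distributions"
    and "dist_fourier (fourier_multiplier a f) = ?v"
    using u Fu by auto
qed

section \<open>Isometries on square integrable distributions and the two inclusions\<close>

lemma represents_fun_of: "represents g T \<Longrightarrow> represents (fun_of T) T"
  unfolding fun_of_def by (metis someI)

lemma plancherel_inv_fourier:
  "g \<in> \<S> \<Longrightarrow> (LINT x|lborel. (norm (inv_fourier g x))\<^sup>2) = (LINT x|lborel. (norm (g x))\<^sup>2)"
  using plancherel[OF schwartz_inv_fourier[of g]] by (simp add: fourier_inv_fourier)

text \<open>Abstracted over \<open>A\<close> because it is used twice, with \<open>fourier\<close>
  and with \<open>inv_fourier\<close>. The estimate between the norms is one-sided, and each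
  inclusion uses it in its own direction.\<close>

lemma isometry_square_integrable:
  fixes T :: "'n::finite dist" and g :: "real ^ 'n \<Rightarrow> complex"
    and A :: "(real ^ 'n \<Rightarrow> complex) \<Rightarrow> real ^ 'n \<Rightarrow> complex"
  assumes gen: "dyadic_generator (\<phi> :: real ^ 'n \<Rightarrow> real)"
    and T: "T \<in> tempered_distributions" and rep: "represents g T" and g: "square_integrable lborel g"
    and A: "\<And>h. h \<in> \<S> \<Longrightarrow> A h \<in> \<S>"
    and A_add: "\<And>h k. h \<in> \<S> \<Longrightarrow> k \<in> \<S> \<Longrightarrow> A (\<lambda>x. h x + k x) = (\<lambda>x. A h x + A k x)"
    and A_cmult: "\<And>c h. h \<in> \<S> \<Longrightarrow> A (\<lambda>x. c * h x) = (\<lambda>x. c * A h x)"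
    and iso: "\<And>h. h \<in> \<S> \<Longrightarrow>
      (LINT x|lborel. (norm (A h x))\<^sup>2) = (LINT x|lborel. (norm (h x))\<^sup>2)"
  obtains G where "square_integrable lborel G"
    "(LINT x|lborel. (norm (G x))\<^sup>2) \<le> (LINT x|lborel. (norm (g x))\<^sup>2)"
    "\<And>h. h \<in> \<S> \<Longrightarrow> T (A h) = (LINT x|lborel. G x * h x)"
proof -
  have sq: "square_integrable lborel h" if "h \<in> \<S>" for h :: "real ^ 'n \<Rightarrow> complex"
    using schwartz_square_integrable[OF that] schwartz_measurable[OF that] by (simp add: square_integrable_def)
  let ?B = "sqrt (LINT x|lborel. (norm (g x))\<^sup>2)"
  have B2: "?B\<^sup>2 = (LINT x|lborel. (norm (g x))\<^sup>2)" by simp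
  have bound: "norm (T (A h)) \<le> ?B * sqrt (LINT x|lborel. (norm (h x))\<^sup>2)" if h: "h \<in> \<S>" for h
    unfolding represents_square_integrable[OF gen T rep g A[OF h]] iso[OF h, symmetric]
    by (rule cauchy_schwarz_integral[OF g sq[OF A[OF h]]])
  show thesis
  proof (rule riesz_representation[where V = \<S> and M = lborel and \<Lambda> = "\<lambda>h. T (A h)" and B = ?B])
    show "\<S> \<noteq> ({} :: (real ^ 'n \<Rightarrow> complex) set)"
      using generator_schwartz[OF gen] by blast
    show "T (A (\<lambda>x. f x + h x)) = T (A f) + T (A h)"
      if "f \<in> \<S>" "h \<in> \<S>" for f h
      using that by (simp add: A_add A tempered_add[OF T])
    show "T (A (\<lambda>x. c * f x)) = c * T (A f)" if "f \<in> \<S>" for c f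
      using that by (simp add: A_cmult A tempered_cmult[OF T])
  qed (use sq schwartz_add schwartz_cmult bound that B2 in auto)
qed

context
  fixes \<phi> :: "real ^ 'n::finite \<Rightarrow> real" and b :: real
  assumes gen: "dyadic_generator \<phi>"
begin

abbreviation (input) "W \<equiv> regularisation \<phi> (w_log b)"
abbreviation (input) "\<Phi> \<equiv> \<lambda>t. 1 / w_log b (1 / t)"

lemma log_weight_measurable [measurable]: "log_weight \<in> borel_measurable borel"
  unfolding log_weight_def[abs_def] jbracket_def by measurable

text \<open>The products have the shape in which they arise: the transform of \<open>f\<close> is W
  times a square integrable function in one inclusion, and is multiplied by 1/W in the
  other.\<close>

lemma weight_bounds:
  "norm (complex_of_real (\<Phi> (jbracket \<xi>)) * (complex_of_real (W \<xi>) * z)) \<le> 3 powr \<bar>b\<bar> * norm z"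
  "norm (complex_of_real (1 / W \<xi>) * z) \<le> 3 powr \<bar>b\<bar> * norm (complex_of_real (\<Phi> (jbracket \<xi>)) * z)"
proof -
  have L: "0 < log_weight \<xi> powr b" using log_weight_ge(1)[of \<xi>] by simp
  have Wpos: "0 < W \<xi>" by (rule regularisation_pos[OF gen])
  note c = regularisation_comparable(1)[OF gen, of b \<xi>] regularisation_comparable(2)[OF gen, of \<xi> b]
  have "1 / log_weight \<xi> powr b * W \<xi> \<le> 3 powr \<bar>b\<bar>"
    using c(1) L by (simp add: field_simps)
  from mult_right_mono[OF this norm_ge_zero[of z]]
  show "norm (complex_of_real (\<Phi> (jbracket \<xi>)) * (complex_of_real (W \<xi>) * z)) \<le> 3 powr \<bar>b\<bar> * norm z"
    unfolding sobolev_weight_eq using Wpos by (simp add: norm_mult norm_divide)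
  have "1 / W \<xi> \<le> 3 powr \<bar>b\<bar> * (1 / log_weight \<xi> powr b)"
    using c(2) L Wpos by (simp add: field_simps)
  from mult_right_mono[OF this norm_ge_zero[of z]]
  show "norm (complex_of_real (1 / W \<xi>) * z) \<le> 3 powr \<bar>b\<bar> * norm (complex_of_real (\<Phi> (jbracket \<xi>)) * z)"
    unfolding sobolev_weight_eq using Wpos by (simp add: norm_mult norm_divide)
qed

lemma J_space_imp_H_space:
  fixes f :: "'n dist"
  assumes f: "f \<in> J_space W"
  shows "f \<in> H_space \<Phi> \<and> H_norm \<Phi> f \<le> 3 powr \<bar>b\<bar> * J_norm W f"
proof -
  let ?a = "\<lambda>\<xi>. complex_of_real (1 / W \<xi>)" and ?w = "\<lambda>\<xi>. complex_of_real (W \<xi>)"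
  note a = inverse_regularisation_multiplier[OF gen, of b] and w = regularisation_multiplier[OF gen, of b]
  define u where "u = fourier_multiplier ?a f"
  have fT: "f \<in> tempered_distributions" and uL: "u \<in> L2_space"
    using f by (auto simp: J_space_def u_def)
  note Fu = fourier_multiplier_works(2)[OF a fT, folded u_def]
  have uT: "u \<in> tempered_distributions" using uL by (simp add: L2_space_def)
  define g where "g = fun_of u"
  have rep: "represents g u" using uL represents_fun_of by (auto simp: L2_space_def g_def)
  then have gm: "g \<in> borel_measurable borel"
    using locally_integrable_measurable by (auto simp: represents_def)
  have g: "square_integrable lborel g"
    using uL gm by (simp add: L2_space_def square_integrable_def g_def)
  obtain G where G: "square_integrable lborel G"
    "(LINT x|lborel. (norm (G x))\<^sup>2) \<le> (LINT x|lborel. (norm (g x))\<^sup>2)"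
    "\<And>h. h \<in> \<S> \<Longrightarrow> u (fourier h) = (LINT x|lborel. G x * h x)"
    using isometry_square_integrable[OF gen uT rep g, of fourier]
      schwartz_fourier fourier_add schwartz_integrable fourier_cmult plancherel by blast
  note [measurable] = square_integrable_measurable[OF G(1)] multiplier_measurable[OF w]
  \<comment> \<open>Testing with W h undoes the multiplication by 1/W, so the transform of
    \<open>f\<close> is the function W G.\<close>
  have Ff: "dist_fourier f h = (LINT x|lborel. (?w x * G x) * h x)" if h: "h \<in> \<S>" for h
  proof -
    have wh: "(\<lambda>x. ?w x * h x) \<in> \<S>" by (rule schwartz_mult[OF w h])
    have aw: "(\<lambda>x. ?a x * (?w x * h x)) = h"
      using regularisation_pos[OF gen, of b] by (simp add: fun_eq_iff less_imp_neq[symmetric])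
    have "dist_fourier f h = dist_fourier u (\<lambda>x. ?w x * h x)"
      unfolding Fu dist_mult_def using wh by (simp only: restrict_apply' aw)
    also have "\<dots> = (LINT x|lborel. G x * (?w x * h x))"
      using wh by (simp add: dist_fourier_def G(3))
    finally show ?thesis by (simp add: mult_ac)
  qed
  have "locally_integrable (\<lambda>x. ?w x * G x)"
    by (intro locally_integrable_mult_continuous square_integrable_locally_integrable G smooth_continuous multiplier_smooth w)
  then have repf: "represents (\<lambda>x. ?w x * G x) (dist_fourier f)"
    using Ff by (simp add: represents_def)
  let ?F = "fun_of (dist_fourier f)"
  have repF: "represents ?F (dist_fourier f)" by (rule represents_fun_of[OF repf])
  then have Fm[measurable]: "?F \<in> borel_measurable borel"
    using locally_integrable_measurable by (auto simp: represents_def)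
  \<comment> \<open>\<open>H_norm\<close> sees the chosen representative, which is W G only almost
    everywhere.\<close>
  have ae: "AE \<xi> in lborel. ?F \<xi> = ?w \<xi> * G \<xi>"
    by (rule represents_unique[OF gen repF repf])
  let ?N = "\<lambda>\<xi>. (norm (complex_of_real (\<Phi> (jbracket \<xi>)) * ?F \<xi>))\<^sup>2"
  have le: "AE \<xi> in lborel. ?N \<xi> \<le> (3 powr \<bar>b\<bar>)\<^sup>2 * (norm (G \<xi>))\<^sup>2"
    using ae
  proof eventually_elim
    fix \<xi> assume eq: "?F \<xi> = ?w \<xi> * G \<xi>"
    show "?N \<xi> \<le> (3 powr \<bar>b\<bar>)\<^sup>2 * (norm (G \<xi>))\<^sup>2"
      unfolding eq power_mult_distrib[symmetric] by (intro power_mono weight_bounds(1)) auto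
  qed
  have Gi: "integrable lborel (\<lambda>\<xi>. (3 powr \<bar>b\<bar>)\<^sup>2 * (norm (G \<xi>))\<^sup>2)"
    using G(1) by (simp add: square_integrable_def)
  have Ni: "integrable lborel ?N"
  proof (rule integrable_dominated[OF Gi])
    show "?N \<in> borel_measurable lborel"
      unfolding sobolev_weight_eq by measurable
    show "AE \<xi> in lborel. norm (?N \<xi>) \<le> norm ((3 powr \<bar>b\<bar>)\<^sup>2 * (norm (G \<xi>))\<^sup>2)"
      using le by eventually_elim simp
  qed
  have "H_norm \<Phi> f \<le> sqrt (LINT \<xi>|lborel. (3 powr \<bar>b\<bar>)\<^sup>2 * (norm (G \<xi>))\<^sup>2)"
    unfolding H_norm_def by (intro real_sqrt_le_mono integral_mono_AE Ni Gi le)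
  also have "\<dots> = 3 powr \<bar>b\<bar> * sqrt (LINT \<xi>|lborel. (norm (G \<xi>))\<^sup>2)"
    by (simp add: real_sqrt_mult)
  also have "\<dots> \<le> 3 powr \<bar>b\<bar> * sqrt (LINT \<xi>|lborel. (norm (g \<xi>))\<^sup>2)"
    using G(2) by (intro mult_left_mono) auto
  also have "\<dots> = 3 powr \<bar>b\<bar> * J_norm W f"
    by (simp add: J_norm_def L2_norm_def g_def u_def)
  finally show ?thesis
    using fT repf Ni by (auto simp: H_space_def)
qed

text \<open>The way back: by the weight comparison 1/W times the transform of \<open>f\<close> is
  square integrable, and the inverse transform carries this over to the multiplier image
  \<open>u\<close>.\<close>

lemma H_space_imp_J_space:
  fixes f :: "'n dist"
  assumes f: "f \<in> H_space \<Phi>"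
  shows "f \<in> J_space W \<and> J_norm W f \<le> 3 powr \<bar>b\<bar> * H_norm \<Phi> f"
proof -
  let ?a = "\<lambda>\<xi>. complex_of_real (1 / W \<xi>)"
  note a = inverse_regularisation_multiplier[OF gen, of b]
  define u where "u = fourier_multiplier ?a f"
  let ?F = "fun_of (dist_fourier f)"
  let ?N = "\<lambda>\<xi>. (norm (complex_of_real (\<Phi> (jbracket \<xi>)) * ?F \<xi>))\<^sup>2"
  have fT: "f \<in> tempered_distributions" and Ni: "integrable lborel ?N"
    and repF: "represents ?F (dist_fourier f)"
    using f represents_fun_of by (auto simp: H_space_def)
  note uT = fourier_multiplier_works(1)[OF a fT, folded u_def]
  note Fu = fourier_multiplier_works(2)[OF a fT, folded u_def]
  note FuT = tempered_dist_fourier[OF uT]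
  \<comment> \<open>\<open>?F\<close> is known against compactly supported test functions only.
    Multiplication by 1/W keeps supports bounded, which is enough for \<open>G\<close> to represent
    the transform of \<open>u\<close>.\<close>
  have F_eq: "dist_fourier f k = (LINT x|lborel. ?F x * k x)"
    if "k \<in> \<S>" "bounded {x. k x \<noteq> 0}" for k
    using repF that by (simp add: represents_def)
  have liF: "locally_integrable ?F" using repF by (simp add: represents_def)
  note [measurable] = locally_integrable_measurable[OF liF] multiplier_measurable[OF a]
  define G where "G \<xi> = ?a \<xi> * ?F \<xi>" for \<xi>
  have le: "(norm (G \<xi>))\<^sup>2 \<le> (3 powr \<bar>b\<bar>)\<^sup>2 * ?N \<xi>" for \<xi>
    unfolding G_def power_mult_distrib[symmetric] by (intro power_mono weight_bounds(2)) auto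
  have KN: "integrable lborel (\<lambda>\<xi>. (3 powr \<bar>b\<bar>)\<^sup>2 * ?N \<xi>)"
    by (rule integrable_mult_right[OF Ni])
  have Gi: "integrable lborel (\<lambda>\<xi>. (norm (G \<xi>))\<^sup>2)"
  proof (rule integrable_dominated[OF KN])
    show "(\<lambda>\<xi>. (norm (G \<xi>))\<^sup>2) \<in> borel_measurable lborel"
      unfolding G_def by measurable
    show "AE \<xi> in lborel. norm ((norm (G \<xi>))\<^sup>2) \<le> norm ((3 powr \<bar>b\<bar>)\<^sup>2 * ?N \<xi>)"
      using order_trans[OF le abs_ge_self] by (intro AE_I2) (simp only: real_norm_def abs_power2 power_abs abs_norm_cancel)
  qed
  have G: "square_integrable lborel G"
  proof -
    have "G \<in> borel_measurable borel" unfolding G_def[abs_def] by measurable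
    then show ?thesis using Gi by (simp add: square_integrable_def)
  qed
  have "locally_integrable G"
    unfolding G_def[abs_def]
    by (intro locally_integrable_mult_continuous liF smooth_continuous multiplier_smooth a)
  moreover have "dist_fourier u h = (LINT x|lborel. G x * h x)"
    if h: "h \<in> \<S>" "bounded {x. h x \<noteq> 0}" for h
  proof -
    have ah: "(\<lambda>x. ?a x * h x) \<in> \<S>" by (rule schwartz_mult[OF a h(1)])
    have "bounded {x. ?a x * h x \<noteq> 0}" by (rule bounded_subset[OF h(2)]) auto
    with ah have "dist_fourier f (\<lambda>x. ?a x * h x) = (LINT x|lborel. ?F x * (?a x * h x))"
      by (rule F_eq)
    moreover have "dist_fourier u h = dist_fourier f (\<lambda>x. ?a x * h x)"
      using h unfolding Fu dist_mult_def by simp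
    ultimately show ?thesis unfolding G_def by (simp only: mult_ac)
  qed
  ultimately have repG: "represents G (dist_fourier u)" by (simp add: represents_def)
  obtain g where g: "square_integrable lborel g"
    "(LINT x|lborel. (norm (g x))\<^sup>2) \<le> (LINT x|lborel. (norm (G x))\<^sup>2)"
    "\<And>h. h \<in> \<S> \<Longrightarrow> dist_fourier u (inv_fourier h) = (LINT x|lborel. g x * h x)"
    using isometry_square_integrable[OF gen FuT repG G, of inv_fourier]
      schwartz_inv_fourier inv_fourier_add inv_fourier_cmult plancherel_inv_fourier by blast
  \<comment> \<open>Each \<open>h\<close> is the transform of its inverse transform, so the function
    representing the composite represents \<open>u\<close> itself.\<close>
  have "u h = (LINT x|lborel. g x * h x)" if h: "h \<in> \<S>" for h
    using g(3)[OF h] schwartz_inv_fourier[OF h]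
    by (simp add: dist_fourier_def fourier_inv_fourier[OF h])
  then have repg: "represents g u"
    using square_integrable_locally_integrable[OF g(1)] by (simp add: represents_def)
  have repu: "represents (fun_of u) u" by (rule represents_fun_of[OF repg])
  then have um[measurable]: "fun_of u \<in> borel_measurable borel"
    using locally_integrable_measurable by (auto simp: represents_def)
  note [measurable] = square_integrable_measurable[OF g(1)]
  have ae: "AE x in lborel. (norm (fun_of u x))\<^sup>2 = (norm (g x))\<^sup>2"
    using represents_unique[OF gen repu repg] by eventually_elim simp
  have ui: "integrable lborel (\<lambda>x. (norm (fun_of u x))\<^sup>2)"
    using g(1) by (subst integrable_cong_AE[OF _ _ ae]) (auto simp: square_integrable_def)
  have ieq: "(LINT x|lborel. (norm (fun_of u x))\<^sup>2) = (LINT x|lborel. (norm (g x))\<^sup>2)"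
    by (rule integral_cong_AE[OF _ _ ae]) measurable
  have uL: "u \<in> L2_space"
    using uT repg ui by (auto simp: L2_space_def)
  have "J_norm W f = sqrt (LINT x|lborel. (norm (g x))\<^sup>2)"
    unfolding J_norm_def L2_norm_def u_def[symmetric] ieq ..
  also have "\<dots> \<le> sqrt (LINT \<xi>|lborel. (3 powr \<bar>b\<bar>)\<^sup>2 * ?N \<xi>)"
    by (intro real_sqrt_le_mono order_trans[OF g(2)] integral_mono Gi KN le)
  also have "\<dots> = 3 powr \<bar>b\<bar> * H_norm \<Phi> f"
    unfolding H_norm_def integral_mult_right_zero by (simp add: real_sqrt_mult)
  finally show ?thesis
    using fT uL by (simp add: J_space_def u_def)
qed

end

theorem proposition2p29:
  fixes b :: real and \<phi>\<^sub>0 :: "real ^ 'n::finite \<Rightarrow> real"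
  assumes "dyadic_generator \<phi>\<^sub>0"
  shows "refined_weight (\<lambda>t. 1 / w_log b (1 / t)) \<and>
    J_space (regularisation \<phi>\<^sub>0 (w_log b)) = H_space (\<lambda>t. 1 / w_log b (1 / t)) \<and>
    (\<exists>C>0. \<forall>f\<in>J_space (regularisation \<phi>\<^sub>0 (w_log b)).
       J_norm (regularisation \<phi>\<^sub>0 (w_log b)) f \<le> C * H_norm (\<lambda>t. 1 / w_log b (1 / t)) f \<and>
       H_norm (\<lambda>t. 1 / w_log b (1 / t)) f \<le> C * J_norm (regularisation \<phi>\<^sub>0 (w_log b)) f)"
proof (intro conjI)
  show "refined_weight (\<lambda>t. 1 / w_log b (1 / t))" by (rule refined_weight_log)
  show "J_space (regularisation \<phi>\<^sub>0 (w_log b)) = H_space (\<lambda>t. 1 / w_log b (1 / t))"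
    using J_space_imp_H_space[OF assms, of _ b] H_space_imp_J_space[OF assms, of _ b] by blast
  show "\<exists>C>0. \<forall>f\<in>J_space (regularisation \<phi>\<^sub>0 (w_log b)).
       J_norm (regularisation \<phi>\<^sub>0 (w_log b)) f \<le> C * H_norm (\<lambda>t. 1 / w_log b (1 / t)) f \<and>
       H_norm (\<lambda>t. 1 / w_log b (1 / t)) f \<le> C * J_norm (regularisation \<phi>\<^sub>0 (w_log b)) f"
    using J_space_imp_H_space[OF assms, of _ b] H_space_imp_J_space[OF assms, of _ b]
    by (intro exI[of _ "3 powr \<bar>b\<bar>"]) auto
qed

end
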